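(* Let $k\ge3$ and let $T$ be the $k$-regular tree. 1. For all $\beta_1,\beta_2\in(0,\infty]$ with $\beta_1<\beta_2$, the measure $\mathbb W_{\beta_1}^T$ is stochastically dominated by $\mathbb W_{\beta_2}^T$. 2. For every $\beta\in(0,\infty)$ and every edge $e$ of $T$, the measure $\mathbb W_\beta^T(\,\cdot\mid e\in\omega)$ is stochastically dominated by $\mathbb W_\beta^T(\,\cdot\mid e\notin\omega)$, where both are viewed as measures on configurations of the edges of $T$ other than $e$.
   Context: Configurations on an edge set $E$ are elements $\omega\in\{0,1\}^E$, identified with subsets of $E$. Arboreal gas: for a finite (multi)graph $G=(V,E)$ and $\beta\in(0,\infty)$, $\mathbb A_\beta^G$ is the probability measure on $\{0,1\}^E$ giving each forest $\eta$ (edge set containing no cycles; a pair of parallel edges is a cycle) probability proportional to $\beta^{|\eta|}$, and giving non-forests probability $0$. Exhaustion of $T$: a growing sequence $V_1\subseteq V_2\subseteq\cdots$ of finite connected sets of vertices whose union is the whole vertex set. Wired graph $G_n$: take the subgraph of $T$ induced by $V_n$ together with its neighbours outside $V_n$, then merge these outside neighbours into a single vertex $\partial_n$ (keeping parallel edges); edges of $G_n$ are identified with edges of $T$. For $\beta\in(0,\infty)$, the wired arboreal gas $\mathbb W_\beta^T$ is the weak limit (convergence of probabilities of all events depending on finitely many edges) of $\mathbb A_\beta^{G_n}$ as $n\to\infty$; this limit exists and does not depend on the exhaustion. $\mathbb W_\infty^T$ denotes the wired uniform spanning forest of $T$, i.e. the weak limit of the uniform spanning tree measures on $G_n$ (it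 also is the weak limit of $\mathbb W_\beta^T$ as $\beta\to\infty$). A probability measure $\mu$ on $\{0,1\}^E$ is stochastically dominated by $\nu$ (written $\mu\lesssim\nu$ in the paper) if there is a coupling $(\omega_1,\omega_2)$ with $\omega_1\sim\mu$, $\omega_2\sim\nu$ and $\omega_1\subseteq\omega_2$ almost surely. *)

theory Defs
  imports "HOL-Probability.Probability"
begin

section \<open>Multigraphs\<close>

record ('v, 'e) multigraph =
  verts :: "'v set"
  edges :: "'e set"
  ends :: "'e \<Rightarrow> 'v set"

text \<open>An edge with a single end is a loop.\<close>

definition multigraph :: "('v, 'e) multigraph \<Rightarrow> bool" where
  "multigraph G \<longleftrightarrow> (\<forall>e\<in>edges G. ends G e \<subseteq> verts G \<and> card (ends G e) \<in> {1, 2})"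

text \<open>A loop is a cycle of length 1, and a pair of parallel edges is a cycle of length 2.\<close>

definition is_cycle :: "('v, 'e) multigraph \<Rightarrow> 'v list \<Rightarrow> 'e list \<Rightarrow> bool" where
  "is_cycle G vs es \<longleftrightarrow>
     es \<noteq> [] \<and> length vs = length es \<and> distinct vs \<and> distinct es \<and>
     set vs \<subseteq> verts G \<and> set es \<subseteq> edges G \<and>
     (\<forall>i<length es. ends G (es ! i) = {vs ! i, vs ! (Suc i mod length es)})"

definition forest :: "('v, 'e) multigraph \<Rightarrow> 'e set \<Rightarrow> bool" where
  "forest G F \<longleftrightarrow> F \<subseteq> edges G \<and> \<not> (\<exists>vs es. is_cycle G vs es \<and> set es \<subseteq> F)"

text \<open>Any two vertices of \<open>U\<close> are joined by a path in \<open>U\<close> that uses only edges of \<open>F\<close>.\<close>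

definition connected_in :: "('v, 'e) multigraph \<Rightarrow> 'v set \<Rightarrow> 'e set \<Rightarrow> bool" where
  "connected_in G U F \<longleftrightarrow> U \<noteq> {} \<and> U \<subseteq> verts G \<and>
     (\<forall>u\<in>U. \<forall>v\<in>U. (u, v) \<in> {(x, y). x \<in> U \<and> y \<in> U \<and> (\<exists>e\<in>F. ends G e = {x, y})}\<^sup>*)"

definition spanning_tree :: "('v, 'e) multigraph \<Rightarrow> 'e set \<Rightarrow> bool" where
  "spanning_tree G F \<longleftrightarrow> forest G F \<and> connected_in G (verts G) F"

text \<open>A forest has no loops, so the number of incident edges is the degree.\<close>

definition regular_tree :: "nat \<Rightarrow> ('v, 'e) multigraph \<Rightarrow> bool" where
  "regular_tree k T \<longleftrightarrow> multigraph T \<and> spanning_tree T (edges T) \<and>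
     (\<forall>v\<in>verts T. finite {e \<in> edges T. v \<in> ends T e} \<and> card {e \<in> edges T. v \<in> ends T e} = k)"


section \<open>Exhaustions and wired graphs\<close>

definition exhaustion :: "('v, 'e) multigraph \<Rightarrow> (nat \<Rightarrow> 'v set) \<Rightarrow> bool" where
  "exhaustion T V \<longleftrightarrow> incseq V \<and> (\<forall>n. finite (V n) \<and> connected_in T (V n) (edges T)) \<and>
     (\<Union>n. V n) = verts T"

definition outer_nbrs :: "('v, 'e) multigraph \<Rightarrow> 'v set \<Rightarrow> 'v set" where
  "outer_nbrs T U = {v \<in> verts T - U. \<exists>u\<in>U. \<exists>e\<in>edges T. ends T e = {u, v}}"

text \<open>The vertices outside \<open>U\<close> are merged into the vertex \<open>None\<close>; the edges keep their names.\<close>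

definition wire :: "'v set \<Rightarrow> 'v \<Rightarrow> 'v option" where
  "wire U v = (if v \<in> U then Some v else None)"

definition wired_graph :: "('v, 'e) multigraph \<Rightarrow> 'v set \<Rightarrow> ('v option, 'e) multigraph" where
  "wired_graph T U =
     \<lparr>verts = wire U ` (U \<union> outer_nbrs T U),
      edges = {e \<in> edges T. ends T e \<subseteq> U \<union> outer_nbrs T U},
      ends = (\<lambda>e. wire U ` ends T e)\<rparr>"


section \<open>Measures on finite multigraphs\<close>

definition arboreal_gas :: "real \<Rightarrow> ('v, 'e) multigraph \<Rightarrow> 'e set pmf" where
  "arboreal_gas \<beta> G = embed_pmf
     (\<lambda>\<eta>. if forest G \<eta> then \<beta> ^ card \<eta> / (\<Sum>\<eta>' | forest G \<eta>'. \<beta> ^ card \<eta>') else 0)"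

lemma pmf_arboreal_gas:
  assumes "finite (edges G)" and "\<beta> > 0"
  shows "pmf (arboreal_gas \<beta> G) \<eta> =
    (if forest G \<eta> then \<beta> ^ card \<eta> / (\<Sum>\<eta>' | forest G \<eta>'. \<beta> ^ card \<eta>') else 0)"
proof -
  let ?F = "{\<eta>. forest G \<eta>}"
  let ?Z = "\<Sum>\<eta>\<in>?F. \<beta> ^ card \<eta>"
  let ?p = "\<lambda>\<eta>. if forest G \<eta> then \<beta> ^ card \<eta> / ?Z else 0"
  have fin: "finite ?F"
    by (rule finite_subset[of _ "Pow (edges G)"]) (use assms in \<open>auto simp: forest_def\<close>)
  have "{} \<in> ?F"
    by (auto simp: forest_def is_cycle_def)
  then have Z: "?Z > 0"
    using fin assms(2) by (intro sum_pos) auto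
  then have nn: "\<forall>x. 0 \<le> ?p x"
    using assms(2) by simp
  have "(\<integral>\<^sup>+ x. ennreal (?p x) \<partial>count_space UNIV) = (\<Sum>x\<in>?F. ennreal (?p x))"
    using fin by (intro nn_integral_count_space') (auto split: if_splits)
  also have "\<dots> = ennreal (\<Sum>x\<in>?F. ?p x)"
    using nn by (intro sum_ennreal) blast
  also have "(\<Sum>x\<in>?F. ?p x) = 1"
    using Z by (simp flip: sum_divide_distrib)
  finally have "(\<integral>\<^sup>+ x. ennreal (?p x) \<partial>count_space UNIV) = 1"
    by simp
  then show ?thesis
    unfolding arboreal_gas_def using nn by (intro pmf_embed_pmf) blast+
qed

definition uniform_spanning_tree :: "('v, 'e) multigraph \<Rightarrow> 'e set pmf" where
  "uniform_spanning_tree G = pmf_of_set {F. spanning_tree G F}"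


section \<open>Wired limits\<close>

text \<open>A configuration on \<open>E\<close> is an extensional function from \<open>E\<close> to \<^typ>\<open>bool\<close>; the
  configuration \<open>\<omega>\<close> corresponds to the edge set \<open>{e \<in> E. \<omega> e}\<close>.\<close>

definition config_space :: "'e set \<Rightarrow> ('e \<Rightarrow> bool) measure" where
  "config_space E = Pi\<^sub>M E (\<lambda>_. count_space (UNIV :: bool set))"

text \<open>The finite-volume laws live on edge sets. An event that depends only on the edges of a
  finite set \<open>J\<close> is given by the set \<open>A\<close> of the allowed restrictions to \<open>J\<close>.\<close>

definition is_wired_limit ::
    "('v, 'e) multigraph \<Rightarrow> (('v option, 'e) multigraph \<Rightarrow> 'e set pmf) \<Rightarrow> ('e \<Rightarrow> bool) measure \<Rightarrow> bool" where
  "is_wired_limit T P \<mu> \<longleftrightarrow>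
     prob_space \<mu> \<and> sets \<mu> = sets (config_space (edges T)) \<and>
     (\<forall>V. exhaustion T V \<longrightarrow>
       (\<forall>J A. finite J \<and> J \<subseteq> edges T \<and> A \<subseteq> Pow J \<longrightarrow>
         (\<lambda>n. measure_pmf.prob (P (wired_graph T (V n))) {\<eta>. \<eta> \<inter> J \<in> A})
           \<longlonglongrightarrow> measure \<mu> {\<omega> \<in> space \<mu>. {e \<in> J. \<omega> e} \<in> A}))"

definition wired_limit ::
    "('v, 'e) multigraph \<Rightarrow> (('v option, 'e) multigraph \<Rightarrow> 'e set pmf) \<Rightarrow> ('e \<Rightarrow> bool) measure" where
  "wired_limit T P = (THE \<mu>. is_wired_limit T P \<mu>)"

definition wired_arboreal_gas :: "('v, 'e) multigraph \<Rightarrow> ereal \<Rightarrow> ('e \<Rightarrow> bool) measure" where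
  "wired_arboreal_gas T \<beta> =
     (if \<beta> = \<infinity> then wired_limit T uniform_spanning_tree
      else wired_limit T (arboreal_gas (real_of_ereal \<beta>)))"


section \<open>Stochastic domination and conditioning\<close>

definition stoch_dominated ::
    "'e set \<Rightarrow> ('e \<Rightarrow> bool) measure \<Rightarrow> ('e \<Rightarrow> bool) measure \<Rightarrow> bool" where
  "stoch_dominated E \<mu> \<nu> \<longleftrightarrow>
     (\<exists>\<kappa>. prob_space \<kappa> \<and> sets \<kappa> = sets (config_space E \<Otimes>\<^sub>M config_space E) \<and>
        distr \<kappa> (config_space E) fst = \<mu> \<and> distr \<kappa> (config_space E) snd = \<nu> \<and>
        (AE (\<omega>\<^sub>1, \<omega>\<^sub>2) in \<kappa>. \<forall>e\<in>E. \<omega>\<^sub>1 e \<longrightarrow> \<omega>\<^sub>2 e))"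

text \<open>\<^const>\<open>uniform_measure\<close> \<open>\<mu> A\<close> is \<open>\<mu>\<close> conditioned on \<open>A\<close>.\<close>

definition cond_off :: "'e set \<Rightarrow> ('e \<Rightarrow> bool) measure \<Rightarrow> 'e \<Rightarrow> bool \<Rightarrow> ('e \<Rightarrow> bool) measure" where
  "cond_off E \<mu> e b =
     distr (uniform_measure \<mu> {\<omega> \<in> space \<mu>. \<omega> e = b}) (config_space (E - {e}))
       (\<lambda>\<omega>. restrict \<omega> (E - {e}))"

end

theory Submission
  imports Defs
begin

text \<open>
  Put \<open>q = 1/\<beta>\<close>, with \<open>q = 0\<close> for \<open>\<beta> = \<infinity>\<close>. In the wired graph of a finite set of \<open>m\<close> vertices a
  forest has at most \<open>m\<close> edges, and exactly \<open>m\<close> if and only if it is a spanning tree. Up to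
  normalisation the arboreal gas therefore gives a forest \<open>\<eta>\<close> the weight \<open>q ^ (m - |\<eta>|)\<close>, and with
  \<open>0 ^ 0 = 1\<close> the same formula at \<open>q = 0\<close> is the uniform spanning tree (\<open>gibbs_gas\<close>). One argument
  treats all \<open>\<beta> \<in> (0, \<infinity>]\<close>.

  Since \<open>T\<close> is a tree, \<open>\<eta>\<close> is a forest of the wired graph if and only if it joins no two outer
  neighbours inside \<open>T\<close> (\<open>forest_G_iff\<close>). Hence, seen from a finite window with boundary \<open>D\<close>, the
  branch beyond \<open>b \<in> D\<close> matters only through one bit: whether \<open>b\<close> is joined within its branch to the
  wired vertex (``to infinity''). Let \<open>\<sigma> \<subseteq> D\<close> be the set of the vertices for which it is. The law of
  \<open>(\<eta>, \<sigma>)\<close> is a Gibbs law: no component of \<open>\<eta>\<close> may contain two vertices of \<open>\<sigma>\<close>, each component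
  that meets \<open>\<sigma>\<close> nowhere costs a factor \<open>q\<close>, and each \<open>b\<close> has a parameter \<open>u b \<in> [0, 1]\<close>. Adding
  a boundary vertex \<open>w\<close> to the window is one step of a Markov kernel; conversely, removing it
  replaces the parameters of its children, with sum \<open>s\<close>, by \<open>u w = s / (1 + q + s)\<close>
  (\<open>gibbs_step\<close>). In finite volume all parameters at the outer boundary are 1. The recursion
  \<open>h x = (k-1) x / (1 + q + (k-1) x)\<close> is increasing and its iterates from 1 decrease to its largest
  fixed point \<open>ustar = max 0 (1 - (1+q)/(k-1))\<close>, so that the parameters of a fixed window are
  squeezed to \<open>ustar\<close> along every exhaustion (\<open>finite_volume_marginal\<close>, \<open>gas_converges\<close>). This
  gives existence and uniqueness of the wired limit, and its law on every window
  (\<open>wired_limit\<close>, \<open>wired_limit_law\<close>).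

  In the limit, exploring the tree is a Markov chain. The children of a vertex receive independent
  labels: open and not joined to infinity with probability \<open>(1 - ustar)/(1 + q)\<close>, closed but
  joined with probability \<open>ustar\<close>, closed and not joined otherwise. If the vertex itself is joined to
  infinity, then in addition one uniformly chosen child edge is open and its child is joined. As \<open>q\<close>
  decreases, neither probability decreases, so that the labels for different \<open>q\<close> can be coupled
  monotonically, and the outcome of a step is increasing in the labels and in the bit of the
  explored vertex. Thus an ordering of two initial states propagates to the whole configurations
  (\<open>stoch_dominated_chain\<close>).

  For the first part, the exploration starts from a vertex, whose bit is a Bernoulli variable with
  a parameter monotone in \<open>q\<close>. For the second part, it starts from both ends of \<open>e\<close>. If \<open>e\<close> is
  open, at most one end is joined to infinity in its own branch; if \<open>e\<close> is closed, both bits are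
  independent. The second law on the pairs of bits dominates the first by an explicit coupling
  (\<open>bounds\<close>, \<open>atoms\<close>).
\<close>

section \<open>Paths and bridges in multigraphs\<close>

definition joined :: "('v, 'e) multigraph \<Rightarrow> 'e set \<Rightarrow> 'v \<Rightarrow> 'v \<Rightarrow> bool" where
  "joined G F = (\<lambda>x y. \<exists>e\<in>F. ends G e = {x, y})\<^sup>*\<^sup>*"

lemma joined_refl [simp]: "joined G F x x"
  by (simp add: joined_def)

lemma joined_sym: "joined G F x y \<Longrightarrow> joined G F y x"
  unfolding joined_def
  by (rule sympD[OF symp_rtranclp]) (auto simp: symp_def insert_commute)

lemma joined_trans [trans]: "joined G F x y \<Longrightarrow> joined G F y z \<Longrightarrow> joined G F x z"
  unfolding joined_def by (rule rtranclp_trans)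

lemma joined_edge: "e \<in> F \<Longrightarrow> ends G e = {x, y} \<Longrightarrow> joined G F x y"
  unfolding joined_def by (rule r_into_rtranclp) auto

lemma joined_mono: "joined G F x y \<Longrightarrow> F \<subseteq> F' \<Longrightarrow> joined G F' x y"
  unfolding joined_def by (rule predicate2D[OF rtranclp_mono]) auto

lemma joined_cases:
  assumes "joined G F x y" and "x \<noteq> y"
  obtains e z where "e \<in> F" "ends G e = {x, z}" "joined G F z y"
  using assms(1) unfolding joined_def
proof (cases rule: converse_rtranclpE)
  case (step z)
  then show ?thesis using that unfolding joined_def by blast
qed (use assms(2) in simp)

lemma joined_induct [consumes 1, case_names refl step]:
  assumes "joined G F x y" and "P y"
    and "\<And>x e z. e \<in> F \<Longrightarrow> ends G e = {x, z} \<Longrightarrow> joined G F z y \<Longrightarrow> P z \<Longrightarrow> P x"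
  shows "P x"
  using assms(1) unfolding joined_def
proof (induction rule: converse_rtranclp_induct)
  case base show ?case by (rule assms(2))
next
  case (step x z) then show ?case using assms(3) unfolding joined_def by blast
qed

definition is_path :: "('v, 'e) multigraph \<Rightarrow> 'v list \<Rightarrow> 'e list \<Rightarrow> bool" where
  "is_path G vs es \<longleftrightarrow> length vs = Suc (length es) \<and>
     (\<forall>i<length es. ends G (es ! i) = {vs ! i, vs ! Suc i})"

lemma is_path_Cons:
  "is_path G vs es \<Longrightarrow> ends G e = {x, hd vs} \<Longrightarrow> is_path G (x # vs) (e # es)"
  unfolding is_path_def
proof (elim conjE, intro conjI allI impI)
  fix i assume "length vs = Suc (length es)" "\<forall>i<length es. ends G (es ! i) = {vs ! i, vs ! Suc i}"
    "ends G e = {x, hd vs}" "i < length (e # es)"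
  moreover from this(1) have "hd vs = vs ! 0" by (cases vs) auto
  ultimately show "ends G ((e # es) ! i) = {(x # vs) ! i, (x # vs) ! Suc i}" by (cases i) auto
qed simp

lemma is_path_drop:
  assumes "is_path G vs es" "n < length vs"
  shows "is_path G (drop n vs) (drop n es)"
  using assms by (auto simp: is_path_def)

text \<open>If a new first vertex already lies on the path, the part of the path before it is dropped.\<close>

lemma joined_simple_path:
  assumes "joined G F x y"
  obtains vs es where "is_path G vs es" "distinct vs" "set es \<subseteq> F" "hd vs = x" "last vs = y"
proof -
  from assms have "\<exists>vs es. is_path G vs es \<and> distinct vs \<and> set es \<subseteq> F \<and> hd vs = x \<and> last vs = y"
  proof (induction rule: joined_induct)
    case refl
    show ?case by (rule exI[of _ "[y]"], rule exI[of _ "[]"]) (simp add: is_path_def)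
  next
    case (step x e z)
    then obtain vs es where p: "is_path G vs es" "distinct vs" "set es \<subseteq> F" "hd vs = z" "last vs = y"
      by blast
    have ne: "vs \<noteq> []" using p(1) by (auto simp: is_path_def)
    show ?case
    proof (cases "x \<in> set vs")
      case True
      then obtain n where n: "n < length vs" "vs ! n = x" by (meson in_set_conv_nth)
      have "is_path G (drop n vs) (drop n es)" using p(1) n(1) by (rule is_path_drop)
      moreover have "distinct (drop n vs)" "set (drop n es) \<subseteq> F" "hd (drop n vs) = x" "last (drop n vs) = y"
        using p n by (auto simp: hd_drop_conv_nth dest: in_set_dropD)
      ultimately show ?thesis by blast
    next
      case False
      have "is_path G (x # vs) (e # es)" using p(1,4) step(2) by (intro is_path_Cons) auto
      moreover have "distinct (x # vs)" "set (e # es) \<subseteq> F" "hd (x # vs) = x" "last (x # vs) = y"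
        using False p step(1) ne by auto
      ultimately show ?thesis by blast
    qed
  qed
  then show ?thesis using that by blast
qed

lemma is_path_joined:
  assumes "is_path G vs es" "set es \<subseteq> F" "i \<le> j" "j < length vs"
  shows "joined G F (vs ! i) (vs ! j)"
  using assms(3,4)
proof (induction j rule: dec_induct)
  case (step n)
  have "n < length es" using step.prems assms(1) by (simp add: is_path_def)
  then have "ends G (es ! n) = {vs ! n, vs ! Suc n}" "es ! n \<in> F"
    using assms(1,2) by (auto simp: is_path_def)
  then show ?case using step by (meson Suc_lessD joined_edge joined_trans)
qed simp

text \<open>A cycle without one of its edges joins the ends of that edge. Conversely, a simple path that
  joins the ends of \<open>e\<close> and avoids \<open>e\<close> closes up to a cycle, as distinct vertices force distinct
  edges. Loops are included, because a vertex is joined to itself. This replaces cycles by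
  connectivity in all later arguments.\<close>

lemma forest_iff_bridges:
  assumes "multigraph G"
  shows "forest G F \<longleftrightarrow> F \<subseteq> edges G \<and>
    (\<forall>e\<in>F. \<forall>x y. ends G e = {x, y} \<longrightarrow> \<not> joined G (F - {e}) x y)"
proof (intro iffI conjI ballI allI impI notI)
  assume f: "forest G F"
  then show sub: "F \<subseteq> edges G" by (simp add: forest_def)
  fix e x y assume e: "e \<in> F" "ends G e = {x, y}" "joined G (F - {e}) x y"
  obtain vs es where p: "is_path G vs es" "distinct vs" "set es \<subseteq> F - {e}" "hd vs = x" "last vs = y"
    using joined_simple_path[OF e(3)] .
  have ends: "ends G (es ! i) = {vs ! i, vs ! Suc i}" if "i < length es" for i
    using p(1) that by (simp add: is_path_def)
  have len: "length vs = Suc (length es)" using p(1) by (simp add: is_path_def)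
  have "vs \<noteq> []" using len by auto
  then have lastv: "vs ! length es = y" and hdv: "vs ! 0 = x"
    using p(4,5) len by (simp_all add: last_conv_nth hd_conv_nth)
  have end_verts: "ends G e' \<subseteq> verts G" if "e' \<in> F" for e'
    using assms sub that by (auto simp: multigraph_def)
  have "distinct es"
    unfolding distinct_conv_nth
  proof (intro allI impI notI)
    fix i j assume ij: "i < length es" "j < length es" "i \<noteq> j" "es ! i = es ! j"
    then have "{vs ! i, vs ! Suc i} = {vs ! j, vs ! Suc j}" using ends by metis
    moreover have "vs ! a = vs ! b \<longleftrightarrow> a = b" if "a < length vs" "b < length vs" for a b
      using p(2) that by (simp add: nth_eq_iff_index_eq)
    ultimately show False using ij len by (auto simp: doubleton_eq_iff)
  qed
  have vsv: "set vs \<subseteq> verts G"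
  proof
    fix v assume "v \<in> set vs"
    then obtain i where i: "i < length vs" "v = vs ! i" by (metis in_set_conv_nth)
    show "v \<in> verts G"
    proof (cases "i < length es")
      case True
      then have "v \<in> ends G (es ! i)" "es ! i \<in> F" using ends[OF True] i subsetD[OF p(3) nth_mem[OF True]] by auto
      then show ?thesis using end_verts by blast
    next
      case False
      then have "i = length es" using i len by simp
      then have "v = y" using i lastv by simp
      then show ?thesis using end_verts[OF e(1)] e(2) by auto
    qed
  qed
  have "is_cycle G vs (es @ [e])"
    unfolding is_cycle_def
  proof (intro conjI allI impI)
    show "es @ [e] \<noteq> []" "length vs = length (es @ [e])" "distinct vs" "set vs \<subseteq> verts G"
      using len p(2) vsv by simp_all
    show "distinct (es @ [e])" using \<open>distinct es\<close> p(3) by auto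
    show "set (es @ [e]) \<subseteq> edges G" using p(3) e(1) sub by auto
    fix i assume i: "i < length (es @ [e])"
    show "ends G ((es @ [e]) ! i) = {vs ! i, vs ! (Suc i mod length (es @ [e]))}"
    proof (cases "i < length es")
      case True
      then show ?thesis using ends by (simp add: nth_append)
    next
      case False
      then have [simp]: "i = length es" using i by simp
      show ?thesis using e(2) hdv lastv by (simp add: insert_commute)
    qed
  qed
  moreover have "set (es @ [e]) \<subseteq> F" using p(3) e(1) by auto
  ultimately show False using f unfolding forest_def by blast
next
  assume br: "F \<subseteq> edges G \<and>
    (\<forall>e\<in>F. \<forall>x y. ends G e = {x, y} \<longrightarrow> \<not> joined G (F - {e}) x y)"
  have False if c: "is_cycle G vs es" "set es \<subseteq> F" for vs es
  proof -
    obtain e es' where es: "es = es' @ [e]" using c(1) by (metis is_cycle_def rev_exhaust)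
    let ?n = "length es'"
    have len: "length vs = Suc ?n" and d: "distinct es" using c(1) es by (auto simp: is_cycle_def)
    have en: "ends G (es ! i) = {vs ! i, vs ! (Suc i mod length es)}" if "i < length es" for i
      using c(1) that by (simp add: is_cycle_def)
    have "is_path G vs es'"
      unfolding is_path_def
    proof (intro conjI allI impI)
      fix i assume "i < length es'"
      then show "ends G (es' ! i) = {vs ! i, vs ! Suc i}" using en[of i] by (simp add: es nth_append)
    qed (rule len)
    moreover have "set es' \<subseteq> F - {e}" using d es c(2) by auto
    ultimately have "joined G (F - {e}) (vs ! 0) (vs ! ?n)"
      using len by (intro is_path_joined) auto
    moreover have "ends G e = {vs ! 0, vs ! ?n}"
      using en[of ?n] es by (simp add: insert_commute)
    ultimately show False using br c(2) es by auto
  qed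
  then show "forest G F" using br unfolding forest_def by blast
qed

text \<open>A path is cut at its last visit to its starting point; the rest avoids all edges there, hence
  also the edge by which it leaves.\<close>

lemma joined_leave:
  assumes "joined G F x y" and "x \<noteq> y"
  obtains e z where "e \<in> F" "ends G e = {x, z}" "joined G (F - {e}) z y"
proof -
  let ?S = "{e. x \<in> ends G e}"
  have "joined G (F - ?S) a y \<or> (\<exists>e z. e \<in> F \<and> ends G e = {x, z} \<and> joined G (F - ?S) z y)"
    if "joined G F a y" for a
    using that
  proof (induction rule: joined_induct)
    case (step a e b)
    show ?case
    proof (cases "joined G (F - ?S) b y")
      case True
      have "b \<noteq> x"
      proof
        assume "b = x"
        then show False using True assms(2) by (auto elim: joined_cases)
      qed
      show ?thesis
      proof (cases "a = x")
        case True
        then show ?thesis using step \<open>joined G (F - ?S) b y\<close> by blast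
      next
        case False
        then have "e \<in> F - ?S" using step \<open>b \<noteq> x\<close> by auto
        then show ?thesis using step(2) True joined_edge joined_trans by metis
      qed
    qed (use step in blast)
  qed simp
  from this[OF assms(1)] consider "joined G (F - ?S) x y" |
    e z where "e \<in> F" "ends G e = {x, z}" "joined G (F - ?S) z y" by blast
  then show ?thesis
  proof cases
    case 1
    then show ?thesis using assms(2) by (auto elim: joined_cases)
  next
    case 2
    then have "joined G (F - {e}) z y" by (elim joined_mono) auto
    then show ?thesis using 2 that by blast
  qed
qed

lemma connected_in_joined:
  assumes "connected_in G U F" "u \<in> U" "v \<in> U"
  shows "joined G {e\<in>F. ends G e \<subseteq> U} u v"
proof -
  have "(u, v) \<in> {(x, y). x \<in> U \<and> y \<in> U \<and> (\<exists>e\<in>F. ends G e = {x, y})}\<^sup>*"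
    using assms by (auto simp: connected_in_def)
  then show ?thesis
  proof (induction rule: converse_rtrancl_induct)
    case (step y z)
    then obtain e where "e \<in> F" "ends G e = {y, z}" "y \<in> U" "z \<in> U" by blast
    then have "joined G {e\<in>F. ends G e \<subseteq> U} y z" by (intro joined_edge) auto
    then show ?case using step.IH by (rule joined_trans)
  qed simp
qed


section \<open>Windows in a regular tree\<close>

definition star :: "('v, 'e) multigraph \<Rightarrow> 'v \<Rightarrow> 'e set" where
  "star T w = {e \<in> edges T. w \<in> ends T e}"

definition far_end :: "('v, 'e) multigraph \<Rightarrow> 'v \<Rightarrow> 'e \<Rightarrow> 'v" where
  "far_end T w e = (THE z. ends T e = {w, z})"

text \<open>A part of the tree that is revealed vertex by vertex: the vertices in \<open>U\<close> are explored, those in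
  \<open>D\<close> are discovered but not yet explored, and \<open>E\<close> consists of the discovered edges. Starting from
  the two ends of an edge will serve to condition on that edge.\<close>

inductive window :: "('v, 'e) multigraph \<Rightarrow> 'v set \<Rightarrow> 'v set \<Rightarrow> 'e set \<Rightarrow> bool" for T where
  vertex: "v \<in> verts T \<Longrightarrow> window T {} {v} {}"
| edge: "e \<in> edges T \<Longrightarrow> window T {} (ends T e) {e}"
| grow: "window T U D E \<Longrightarrow> w \<in> D \<Longrightarrow>
    window T (insert w U) (D - {w} \<union> far_end T w ` (star T w - E)) (E \<union> star T w)"

locale reg_tree =
  fixes T :: "('v, 'e) multigraph" and k :: nat
  assumes k: "k \<ge> 3" and reg: "regular_tree k T"
begin

lemma mg: "multigraph T" using reg by (simp add: regular_tree_def)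

lemma bridge:
  assumes "e \<in> edges T" "ends T e = {x, y}" shows "\<not> joined T (edges T - {e}) x y"
proof -
  have "forest T (edges T)" using reg by (simp add: regular_tree_def spanning_tree_def)
  then show ?thesis using assms by (simp add: forest_iff_bridges[OF mg])
qed

lemma ends_verts: "e \<in> edges T \<Longrightarrow> ends T e \<subseteq> verts T"
  using mg by (auto simp: multigraph_def)

lemma far_end_unique: "e \<in> edges T \<Longrightarrow> ends T e = {w, z} \<Longrightarrow> far_end T w e = z"
  unfolding far_end_def by (rule the_equality) (auto simp: doubleton_eq_iff)

lemma card_ends: "e \<in> edges T \<Longrightarrow> card (ends T e) = 2"
proof -
  assume e: "e \<in> edges T"
  have "card (ends T e) \<noteq> 1"
  proof
    assume "card (ends T e) = 1"
    then obtain x where "ends T e = {x, x}" by (auto simp: card_1_singleton_iff)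
    then show False using bridge[OF e, of x x] by simp
  qed
  then show ?thesis using e mg by (auto simp: multigraph_def)
qed

lemma ends_far_end:
  assumes "e \<in> star T w" shows "ends T e = {w, far_end T w e}" "far_end T w e \<noteq> w" "far_end T w e \<in> verts T"
proof -
  have e: "e \<in> edges T" "w \<in> ends T e" using assms by (auto simp: star_def)
  obtain x y where xy: "ends T e = {x, y}" "x \<noteq> y" using card_ends[OF e(1)] by (auto simp: card_2_iff)
  then obtain z where z: "ends T e = {w, z}" "z \<noteq> w" using e(2) by auto
  then have "far_end T w e = z" using far_end_unique e(1) by blast
  then show "ends T e = {w, far_end T w e}" "far_end T w e \<noteq> w" "far_end T w e \<in> verts T"
    using z ends_verts[OF e(1)] by auto
qed

lemma finite_star: "v \<in> verts T \<Longrightarrow> finite (star T v)"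
  and card_star: "v \<in> verts T \<Longrightarrow> card (star T v) = k"
  using reg by (auto simp: regular_tree_def star_def)

lemma star_subset: "star T w \<subseteq> edges T" by (auto simp: star_def)

lemma not_joined_avoiding:
  assumes "e \<in> edges T" "ends T e = {x, y}" "F \<subseteq> edges T" "e \<notin> F" shows "\<not> joined T F x y"
proof
  assume "joined T F x y"
  then have "joined T (edges T - {e}) x y" using assms by (elim joined_mono) auto
  then show False using bridge assms by blast
qed

lemma far_end_eq_imp_eq:
  assumes "e \<in> star T w" "e' \<in> star T w" "far_end T w e = far_end T w e'" shows "e = e'"
proof (rule ccontr)
  assume "e \<noteq> e'"
  have "joined T {e'} w (far_end T w e)" using ends_far_end(1)[OF assms(2)] assms(3) by (auto intro: joined_edge)
  moreover have "\<not> joined T {e'} w (far_end T w e)"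
    using assms ends_far_end(1)[OF assms(1)] \<open>e \<noteq> e'\<close> by (intro not_joined_avoiding[of e]) (auto simp: star_def)
  ultimately show False by simp
qed

lemma inj_on_far_end: "inj_on (far_end T w) (star T w)"
  by (rule inj_onI) (rule far_end_eq_imp_eq)

text \<open>Otherwise \<open>e\<close> would close a cycle with a path in \<open>E\<close>.\<close>

lemma fresh_far_end:
  assumes "E \<subseteq> edges T" "\<And>x y. x \<in> W \<Longrightarrow> y \<in> W \<Longrightarrow> joined T E x y" "w \<in> W" "e \<in> star T w - E"
  shows "far_end T w e \<notin> W"
proof
  assume "far_end T w e \<in> W"
  then have "joined T E w (far_end T w e)" using assms(2)[OF assms(3)] by simp
  moreover have "\<not> joined T E w (far_end T w e)"
    using assms ends_far_end(1)[of e w] by (intro not_joined_avoiding[of e]) (auto simp: star_def)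
  ultimately show False by simp
qed

text \<open>All of this is carried along as the window grows. Acyclicity enters through the fact that the
  far ends of the new edges are new; therefore each boundary vertex hangs on a single discovered
  edge, except for the start from a single vertex, where nothing has been discovered.\<close>

lemma window_invariants:
  assumes "window T U D E"
  shows "finite U" "finite D" "finite E" "U \<inter> D = {}" "U \<union> D \<subseteq> verts T" "E \<subseteq> edges T"
    "\<And>e. e \<in> E \<Longrightarrow> ends T e \<subseteq> U \<union> D"
    "\<And>x y. x \<in> U \<union> D \<Longrightarrow> y \<in> U \<union> D \<Longrightarrow> joined T E x y"
    "\<And>v. v \<in> U \<Longrightarrow> star T v \<subseteq> E"
    "\<And>e. e \<in> E \<Longrightarrow> U \<noteq> {} \<Longrightarrow> ends T e \<inter> U \<noteq> {}"
    "\<And>v. v \<in> D \<Longrightarrow> U \<noteq> {} \<or> E \<noteq> {} \<Longrightarrow> card (star T v \<inter> E) = 1"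
    "D \<noteq> {}"
proof -
  from assms have "finite U \<and> finite D \<and> finite E \<and> U \<inter> D = {} \<and> U \<union> D \<subseteq> verts T \<and> E \<subseteq> edges T \<and>
    (\<forall>e\<in>E. ends T e \<subseteq> U \<union> D) \<and>
    (\<forall>x\<in>U\<union>D. \<forall>y\<in>U\<union>D. joined T E x y) \<and> (\<forall>v\<in>U. star T v \<subseteq> E) \<and>
    (\<forall>e\<in>E. U \<noteq> {} \<longrightarrow> ends T e \<inter> U \<noteq> {}) \<and>
    (\<forall>v\<in>D. U \<noteq> {} \<or> E \<noteq> {} \<longrightarrow> card (star T v \<inter> E) = 1) \<and> D \<noteq> {}"
  proof induction
    case (vertex v) then show ?case by simp
  next
    case (edge e)
    then obtain x y where xy: "ends T e = {x, y}" "x \<noteq> y" using card_ends[OF edge] by (auto simp: card_2_iff)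
    have "star T v \<inter> {e} = {e}" if "v \<in> {x,y}" for v using that xy edge by (auto simp: star_def)
    moreover have "joined T {e} x y" using xy by (auto intro: joined_edge)
    moreover have "{x, y} \<subseteq> verts T" using ends_verts[OF edge] xy by simp
    ultimately show ?case using xy edge by (auto intro: joined_sym)
  next
    case (grow U D E w)
    let ?C = "star T w - E" let ?D = "D - {w} \<union> far_end T w ` ?C" let ?E = "E \<union> star T w"
    have IH: "finite U" "finite D" "finite E" "U \<inter> D = {}" "U \<union> D \<subseteq> verts T" "E \<subseteq> edges T"
      "\<And>e. e \<in> E \<Longrightarrow> ends T e \<subseteq> U \<union> D"
      "\<And>x y. x \<in> U \<union> D \<Longrightarrow> y \<in> U \<union> D \<Longrightarrow> joined T E x y"
      "\<And>v. v \<in> U \<Longrightarrow> star T v \<subseteq> E"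
      "\<And>e. e \<in> E \<Longrightarrow> U \<noteq> {} \<Longrightarrow> ends T e \<inter> U \<noteq> {}"
      "\<And>v. v \<in> D \<Longrightarrow> U \<noteq> {} \<or> E \<noteq> {} \<Longrightarrow> card (star T v \<inter> E) = 1"
      using grow by blast+
    have w: "w \<in> verts T" "w \<in> U \<union> D" using grow IH by auto
    have fresh: "far_end T w e \<notin> U \<union> D" if "e \<in> ?C" for e
      using fresh_far_end[OF IH(6) IH(8) w(2) that] by simp
    have toW: "joined T ?E x w" if x: "x \<in> insert w U \<union> ?D" for x
    proof (cases "x \<in> U \<union> D")
      case True then show ?thesis using joined_mono[OF IH(8)[OF True w(2)], of ?E] by simp
    next
      case False
      then obtain e where "e \<in> ?C" "x = far_end T w e" using x w by auto
      then show ?thesis using ends_far_end(1)[of e w] by (intro joined_sym[OF joined_edge[of e]]) auto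
    qed
    have "card (star T v \<inter> ?E) = 1" if v: "v \<in> ?D" for v
    proof (cases "v \<in> D")
      case True
      have vw: "v \<noteq> w" using v ends_far_end(2)[of _ w] by force
      have "U \<noteq> {} \<or> E \<noteq> {}"
      proof (rule ccontr)
        assume "\<not> (U \<noteq> {} \<or> E \<noteq> {})"
        then have "joined T {} v w" using IH(8)[of v w] True w by simp
        then show False using vw by (auto elim: joined_cases)
      qed
      then have 1: "card (star T v \<inter> E) = 1" using IH(11) True by blast
      have "star T v \<inter> ?E = star T v \<inter> E"
      proof -
        have "e \<in> E" if e: "e \<in> star T v" "e \<in> star T w" for e
        proof (rule ccontr)
          assume n: "e \<notin> E"
          have "v \<in> ends T e" using e by (simp add: star_def)
          then have "far_end T w e = v" using ends_far_end(1)[OF e(2)] vw by auto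
          then show False using fresh[of e] n e True by auto
        qed
        then show ?thesis by auto
      qed
      then show ?thesis using 1 by simp
    next
      case False
      then obtain e where e: "e \<in> ?C" "v = far_end T w e" using v by auto
      have "star T v \<inter> ?E = {e}"
      proof
        show "{e} \<subseteq> star T v \<inter> ?E" using e ends_far_end(1)[of e w] by (auto simp: star_def)
        show "star T v \<inter> ?E \<subseteq> {e}"
        proof
          fix e' assume e': "e' \<in> star T v \<inter> ?E"
          have ve: "v \<in> ends T e'" using e' by (simp add: star_def)
          have "e' \<notin> E" using IH(7) ve fresh e by blast
          then have s: "e' \<in> star T w" using e' by auto
          moreover have "far_end T w e' = v"
            using ends_far_end[OF s] ve e ends_far_end(2)[of e w] by auto
          ultimately show "e' \<in> {e}" using e far_end_eq_imp_eq by auto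
        qed
      qed
      then show ?thesis by simp
    qed
    moreover have "?D \<noteq> {}"
    proof -
      have "card (star T w) = k" "finite (star T w)" using card_star finite_star w by auto
      moreover have "card (star T w \<inter> E) \<le> 1"
        using IH(11)[of w] grow(2) by (cases "E = {}") auto
      ultimately have "card ?C > 0" using k by (simp add: card_Diff_subset_Int)
      then have "?C \<noteq> {}" by (metis card.empty less_irrefl)
      then show ?thesis by blast
    qed
    moreover have "U \<inter> far_end T w ` ?C = {}" using fresh by auto
    moreover have "w \<notin> far_end T w ` ?C" using ends_far_end(2)[of _ w] by force
    moreover have "ends T e \<subseteq> insert w U \<union> ?D" if "e \<in> ?E" for e
      using that IH(7)[of e] ends_far_end(1)[of e w] w by auto
    moreover have "ends T e \<inter> insert w U \<noteq> {}" if e: "e \<in> ?E" for e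
    proof (cases "e \<in> star T w")
      case True then show ?thesis by (auto simp: star_def)
    next
      case False
      show ?thesis
      proof (cases "U = {}")
        case True
        then have "card (star T w \<inter> E) = 1" using IH(11)[of w] e False grow(2) by auto
        then obtain e' where e': "e' \<in> star T w" "e' \<in> E" by (auto simp: card_1_singleton_iff)
        have "joined T E x w" if "x \<in> D" for x using IH(8) that w by blast
        have "window T {} D E" using grow(1) True by simp
        then have "\<exists>e. E \<subseteq> {e}" by cases auto
        then show ?thesis using e False e' by auto
      next
        case False
        have "e \<in> E" using e \<open>e \<notin> star T w\<close> by simp
        then show ?thesis using IH(10) False by blast
      qed
    qed
    moreover have "star T v \<subseteq> ?E" if "v \<in> insert w U" for v using that IH(9) by auto
    moreover have "joined T ?E x y" if "x \<in> insert w U \<union> ?D" "y \<in> insert w U \<union> ?D" for x y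
      using toW[OF that(1)] joined_sym[OF toW[OF that(2)]] by (rule joined_trans)
    moreover have "insert w U \<union> ?D \<subseteq> verts T" using IH(5) w ends_far_end(3) by auto
    moreover have "?E \<subseteq> edges T" using IH(6) star_subset by auto
    moreover have "finite ?E" "finite ?D" "finite (insert w U)" using IH finite_star w by auto
    moreover have "insert w U \<inter> ?D = {}" using IH(4) calculation by auto
    ultimately show ?case by (intro conjI ballI impI) assumption+
  qed
  then show "finite U" "finite D" "finite E" "U \<inter> D = {}" "U \<union> D \<subseteq> verts T" "E \<subseteq> edges T"
    "\<And>e. e \<in> E \<Longrightarrow> ends T e \<subseteq> U \<union> D"
    "\<And>x y. x \<in> U \<union> D \<Longrightarrow> y \<in> U \<union> D \<Longrightarrow> joined T E x y"
    "\<And>v. v \<in> U \<Longrightarrow> star T v \<subseteq> E"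
    "\<And>e. e \<in> E \<Longrightarrow> U \<noteq> {} \<Longrightarrow> ends T e \<inter> U \<noteq> {}"
    "\<And>v. v \<in> D \<Longrightarrow> U \<noteq> {} \<or> E \<noteq> {} \<Longrightarrow> card (star T v \<inter> E) = 1"
    "D \<noteq> {}"
    by blast+
qed

lemma window_edges: "window T U D E \<Longrightarrow> U \<noteq> {} \<Longrightarrow> E = {e \<in> edges T. ends T e \<inter> U \<noteq> {}}"
  using window_invariants(6,9,10)[of U D E] by (auto simp: star_def)

lemma window_boundary:
  assumes "window T U D E" "U \<noteq> {}" shows "D = outer_nbrs T U"
proof
  note inv = window_invariants[OF assms(1)]
  show "D \<subseteq> outer_nbrs T U"
  proof
    fix v assume v: "v \<in> D"
    have "card (star T v \<inter> E) = 1" using inv(11)[OF v] assms(2) by simp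
    then obtain e where e: "e \<in> star T v" "e \<in> E" by (auto simp: card_1_singleton_iff)
    obtain u where u: "u \<in> U" "u \<in> ends T e" using inv(10)[OF e(2) assms(2)] by auto
    have "u \<noteq> v" using u v inv(4) by auto
    then have "ends T e = {u, v}" using ends_far_end[OF e(1)] u(2) by auto
    then show "v \<in> outer_nbrs T U" unfolding outer_nbrs_def using u v inv(4,5) e(2) inv(6) by blast
  qed
  show "outer_nbrs T U \<subseteq> D"
  proof
    fix v assume "v \<in> outer_nbrs T U"
    then obtain u e where *: "v \<notin> U" "u \<in> U" "e \<in> edges T" "ends T e = {u, v}"
      by (auto simp: outer_nbrs_def)
    then have "e \<in> E" using inv(9)[of u] by (auto simp: star_def)
    then show "v \<in> D" using inv(7)[of e] * by auto
  qed
qed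

end


section \<open>Enlarging a window by one vertex\<close>

text \<open>With \<open>\<sigma>\<close> the set of the boundary vertices that are joined to infinity outside of the window, this
  says that \<open>\<eta>\<close> closes no cycle through infinity.\<close>

definition separated :: "('v, 'e) multigraph \<Rightarrow> 'e set \<Rightarrow> 'v set \<Rightarrow> bool" where
  "separated T \<eta> \<sigma> \<longleftrightarrow> (\<forall>x\<in>\<sigma>. \<forall>y\<in>\<sigma>. joined T \<eta> x y \<longrightarrow> x = y)"

locale window_step = reg_tree T k for T :: "('v, 'e) multigraph" and k +
  fixes U D :: "'v set" and E :: "'e set" and w :: 'v
  assumes win: "window T U D E" and w: "w \<in> D"
begin

abbreviation "C \<equiv> star T w - E"
abbreviation "ch \<equiv> far_end T w"
abbreviation "U' \<equiv> insert w U"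
abbreviation "D' \<equiv> D - {w} \<union> ch ` C"
abbreviation "E' \<equiv> E \<union> star T w"

lemma win': "window T U' D' E'"
  using win w by (rule window.grow)

lemmas inv = window_invariants[OF win]
lemma finite_C: "finite C"
  using inv(5) w finite_star by auto

lemma card_C: "U \<noteq> {} \<or> E \<noteq> {} \<Longrightarrow> card C = k - 1"
  using inv(11)[OF w] card_star[of w] finite_star[of w] inv(5) w
  by (auto simp: card_Diff_subset_Int)

lemma C_ne: "C \<noteq> {}"
proof
  assume *: "C = {}"
  then have "star T w \<inter> E = star T w" by auto
  moreover have "card (star T w) = k" using inv(5) w by (intro card_star) auto
  moreover have "star T w \<inter> E = {} \<or> card (star T w \<inter> E) = 1" using inv(11)[OF w] by (cases "E = {}") auto
  ultimately show False using k by (auto)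
qed

lemma ch_fresh: "c \<in> C \<Longrightarrow> ch c \<notin> U \<union> D"
  using fresh_far_end[where w=w and e=c and W="U \<union> D", OF inv(6) inv(8)] w by auto

lemma ch_inj: "c \<in> C \<Longrightarrow> c' \<in> C \<Longrightarrow> ch c = ch c' \<longleftrightarrow> c = c'"
  using far_end_eq_imp_eq by blast

lemma inj_ch: "inj_on ch A" if "A \<subseteq> C"
  by (rule inj_on_subset[OF inj_on_far_end[of w]]) (use that in auto)

lemma ends_C: "c \<in> C \<Longrightarrow> ends T c = {w, ch c}"
  using ends_far_end(1) by auto

lemma ch_neq_w: "c \<in> C \<Longrightarrow> ch c \<noteq> w"
  using ends_far_end(2) by auto

lemma joined_child: "c \<in> S \<Longrightarrow> S \<subseteq> C \<Longrightarrow> joined T (\<eta> \<union> S) (ch c) w"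
  using ends_C[of c] by (intro joined_sym[OF joined_edge[of c]]) auto

text \<open>The only discovered edge at a child is the one that leads to it.\<close>

lemma isolated_child:
  assumes "\<eta> \<subseteq> E" "S \<subseteq> C" "c \<in> C - S" "joined T (\<eta> \<union> S) (ch c) y" shows "y = ch c"
proof (rule ccontr)
  assume "y \<noteq> ch c"
  then obtain e z where e: "e \<in> \<eta> \<union> S" "ends T e = {ch c, z}"
    using joined_cases[OF assms(4)] by metis
  then consider "e \<in> E" | "e \<in> S" using assms(1) by auto
  then show False
  proof cases
    case 1
    then show False using inv(7)[OF 1] e(2) ch_fresh[of c] assms(3) by auto
  next
    case 2
    then have "ch e = ch c" using ends_C[of e] e(2) assms(2,3) ch_neq_w[of c] by (auto simp: doubleton_eq_iff)
    then show False using 2 assms(2,3) ch_inj[of e c] by auto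
  qed
qed

text \<open>Contraction of the children attached by \<open>S\<close> onto \<open>w\<close>; it maps paths in \<open>\<eta> \<union> S\<close> to paths in \<open>\<eta>\<close>.\<close>

definition retract :: "'e set \<Rightarrow> 'v \<Rightarrow> 'v" where
  "retract S v = (if v \<in> ch ` S then w else v)"

lemma retract_old: "S \<subseteq> C \<Longrightarrow> v \<in> U \<union> D \<Longrightarrow> retract S v = v"
  using ch_fresh by (auto simp: retract_def)

lemma joined_retract:
  assumes "\<eta> \<subseteq> E" "S \<subseteq> C" "joined T (\<eta> \<union> S) x y"
  shows "joined T \<eta> (retract S x) (retract S y)"
  using assms(3)
proof (induction rule: joined_induct)
  case (step x e z)
  have "joined T \<eta> (retract S x) (retract S z)"
  proof (cases "e \<in> S")
    case True
    then have "{x, z} = {w, ch e}" using ends_C[of e] assms(2) step(2) by auto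
    moreover have "retract S w = w" "retract S (ch e) = w"
      using True by (auto simp: retract_def)
    ultimately have "retract S x = w" "retract S z = w" by (auto simp: doubleton_eq_iff)
    then show ?thesis by simp
  next
    case False
    then have e: "e \<in> \<eta>" "e \<in> E" using step(1) assms(1) by auto
    then have "x \<in> U \<union> D" "z \<in> U \<union> D" using inv(7)[OF e(2)] step(2) by auto
    then show ?thesis using e step(2) by (simp only: retract_old[OF assms(2)]) (rule joined_edge)
  qed
  then show ?case using step.IH by (rule joined_trans)
qed simp

text \<open>Children reached by open edges lie in the component of \<open>w\<close>. So \<open>w\<close> counts as joined to infinity
  exactly if some open edge leads to a child that is, and two such children are forbidden.\<close>

lemma separated_step:
  assumes "\<eta> \<subseteq> E" "S \<subseteq> C" "\<tau> \<subseteq> C" "\<sigma> \<subseteq> D - {w}"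
  shows "separated T (\<eta> \<union> S) (\<sigma> \<union> ch ` \<tau>) \<longleftrightarrow>
    card (S \<inter> \<tau>) \<le> 1 \<and> separated T \<eta> (\<sigma> \<union> (if S \<inter> \<tau> = {} then {} else {w}))"
    (is "?L \<longleftrightarrow> ?c \<and> separated T \<eta> ?\<sigma>0")
proof
  assume L: ?L
  have fS: "finite (S \<inter> \<tau>)" using finite_subset[OF assms(2) finite_C] by simp
  have "c = c'" if "c \<in> S \<inter> \<tau>" "c' \<in> S \<inter> \<tau>" for c c'
  proof -
    have "joined T (\<eta> \<union> S) (ch c) (ch c')"
      using joined_trans[OF joined_child joined_sym[OF joined_child]] that assms(2) by blast
    then have "ch c = ch c'" using L that unfolding separated_def by blast
    then show ?thesis using ch_inj that assms(2) by blast
  qed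
  then have 1: ?c unfolding One_nat_def by (subst card_le_Suc0_iff_eq[OF fS]) blast
  have w_case: False if "y \<in> \<sigma>" "joined T \<eta> w y" "S \<inter> \<tau> \<noteq> {}" for y
  proof -
    obtain c where c: "c \<in> S" "c \<in> \<tau>" using \<open>S \<inter> \<tau> \<noteq> {}\<close> by blast
    have "joined T (\<eta> \<union> S) (ch c) y"
      using joined_trans[OF joined_child[OF c(1) assms(2)] joined_mono[OF that(2)]] by blast
    then have "ch c = y" using L that(1) c unfolding separated_def by blast
    then show False using ch_fresh[of c] c assms that by blast
  qed
  have "separated T \<eta> ?\<sigma>0"
    unfolding separated_def
  proof (intro ballI impI)
    fix x y assume xy: "x \<in> ?\<sigma>0" "y \<in> ?\<sigma>0" "joined T \<eta> x y"
    show "x = y"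
    proof (cases "x \<in> \<sigma> \<and> y \<in> \<sigma>")
      case True
      then show ?thesis using L joined_mono[OF xy(3), of "\<eta> \<union> S"] unfolding separated_def by blast
    next
      case False
      then show ?thesis using xy w_case joined_sym[OF xy(3)] by (auto split: if_splits)
    qed
  qed
  then show "?c \<and> separated T \<eta> ?\<sigma>0" using 1 by blast
next
  assume R: "?c \<and> separated T \<eta> ?\<sigma>0"
  have fS: "finite (S \<inter> \<tau>)" using finite_subset[OF assms(2) finite_C] by simp
  show ?L
    unfolding separated_def
  proof (intro ballI impI)
    fix x y assume xy: "x \<in> \<sigma> \<union> ch ` \<tau>" "y \<in> \<sigma> \<union> ch ` \<tau>" "joined T (\<eta> \<union> S) x y"
    have iso: "z = x" if "x \<in> ch ` (\<tau> - S)" "joined T (\<eta> \<union> S) x z" for x z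
      using isolated_child[OF assms(1,2)] that assms(3) by auto
    consider "x \<in> ch ` (\<tau> - S)" | "y \<in> ch ` (\<tau> - S)" |
      "x \<in> \<sigma> \<union> ch ` (S \<inter> \<tau>)" "y \<in> \<sigma> \<union> ch ` (S \<inter> \<tau>)" using xy by blast
    then show "x = y"
    proof cases
      case 1 then show ?thesis using iso xy(3) by blast
    next
      case 2 then show ?thesis using iso joined_sym[OF xy(3)] by blast
    next
      case 3
      have st: "\<exists>c\<in>S \<inter> \<tau>. v = ch c" if "v \<in> \<sigma> \<union> ch ` (S \<inter> \<tau>)" "v \<notin> \<sigma>" for v using that by blast
      have r\<sigma>: "retract S v = v" "v \<noteq> w" if "v \<in> \<sigma>" for v
        using that assms(4) retract_old[OF assms(2), of v] by auto
      have rc: "retract S v = w" if "v \<in> ch ` (S \<inter> \<tau>)" for v using that by (auto simp: retract_def)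
      have mem: "retract S v \<in> ?\<sigma>0" if "v \<in> \<sigma> \<union> ch ` (S \<inter> \<tau>)" for v
        using that r\<sigma>[of v] rc[of v] by (cases "v \<in> \<sigma>") auto
      have eq: "retract S x = retract S y"
        using R joined_retract[OF assms(1,2) xy(3)] mem 3 unfolding separated_def by blast
      show ?thesis
      proof (cases "x \<in> \<sigma>")
        case True
        then show ?thesis using eq r\<sigma> rc 3(2) by (metis Un_iff)
      next
        case False
        then have "y \<notin> \<sigma>" using eq r\<sigma> rc 3(1) by (metis Un_iff)
        then obtain c c' where "c \<in> S \<inter> \<tau>" "c' \<in> S \<inter> \<tau>" "x = ch c" "y = ch c'" using st 3 False by blast
        moreover have "c = c'"
          using R calculation(1,2) unfolding One_nat_def by (subst (asm) card_le_Suc0_iff_eq[OF fS]) blast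
        ultimately show ?thesis by simp
      qed
    qed
  qed
qed

text \<open>The states of the larger window are exactly the states of the smaller one together with the
  open edges \<open>S\<close> at \<open>w\<close> and the edges \<open>\<tau>\<close> to the children that are joined to infinity.\<close>

lemma split_state:
  assumes "\<eta>' \<subseteq> E'" "\<sigma>' \<subseteq> D'"
  obtains \<eta> \<sigma> S \<tau> where "\<eta> \<subseteq> E" "S \<subseteq> C" "\<tau> \<subseteq> C" "\<sigma> \<subseteq> D - {w}" "\<eta>' = \<eta> \<union> S" "\<sigma>' = \<sigma> \<union> ch ` \<tau>"
proof
  show "\<eta>' \<inter> E \<subseteq> E" "\<eta>' \<inter> C \<subseteq> C" "{c\<in>C. ch c \<in> \<sigma>'} \<subseteq> C" "\<sigma>' \<inter> (D - {w}) \<subseteq> D - {w}" by auto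
  show "\<eta>' = \<eta>' \<inter> E \<union> \<eta>' \<inter> C" using assms by auto
  show "\<sigma>' = \<sigma>' \<inter> (D - {w}) \<union> ch ` {c\<in>C. ch c \<in> \<sigma>'}" using assms by auto
qed

lemma card_step:
  assumes "\<eta> \<subseteq> E" "S \<subseteq> C" "\<tau> \<subseteq> C" "\<sigma> \<subseteq> D - {w}"
  shows "card (\<eta> \<union> S) = card \<eta> + card S" "card (\<sigma> \<union> ch ` \<tau>) = card \<sigma> + card \<tau>"
    "card (U' \<union> D') = card (U \<union> D) + card C"
    "card S + card \<tau> = card (S \<union> \<tau>) + card (S \<inter> \<tau>)"
    "card C = card (S \<union> \<tau>) + card (C - S - \<tau>)"
proof -
  have fin: "finite \<eta>" "finite S" "finite \<tau>" "finite \<sigma>"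
    using finite_subset[OF assms(1) inv(3)] finite_subset[OF assms(2) finite_C]
      finite_subset[OF assms(3) finite_C] finite_subset[OF assms(4)] inv(2) by simp_all
  have disj: "\<sigma> \<inter> ch ` \<tau> = {}" using assms(3,4) ch_fresh by blast
  show "card (\<eta> \<union> S) = card \<eta> + card S" using fin assms by (intro card_Un_disjoint) auto
  have "card (\<sigma> \<union> ch ` \<tau>) = card \<sigma> + card (ch ` \<tau>)"
    using fin disj by (intro card_Un_disjoint) auto
  then show "card (\<sigma> \<union> ch ` \<tau>) = card \<sigma> + card \<tau>" using card_image[OF inj_ch[OF assms(3)]] by simp
  have eqU: "U' \<union> D' = (U \<union> D) \<union> ch ` C" using w by auto
  have "(U \<union> D) \<inter> ch ` C = {}" using ch_fresh by blast
  then have "card ((U \<union> D) \<union> ch ` C) = card (U \<union> D) + card (ch ` C)"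
    using inv(1,2) finite_C by (intro card_Un_disjoint) simp_all
  then show "card (U' \<union> D') = card (U \<union> D) + card C"
    unfolding eqU card_image[OF inj_ch[OF subset_refl]] .
  show "card S + card \<tau> = card (S \<union> \<tau>) + card (S \<inter> \<tau>)" using fin by (intro card_Un_Int)
  have "C = (S \<union> \<tau>) \<union> (C - S - \<tau>)" using assms by auto
  then have "card C = card ((S \<union> \<tau>) \<union> (C - S - \<tau>))" by simp
  also have "\<dots> = card (S \<union> \<tau>) + card (C - S - \<tau>)"
    using fin finite_C by (intro card_Un_disjoint) auto
  finally show "card C = card (S \<union> \<tau>) + card (C - S - \<tau>)" .
qed

text \<open>The same bookkeeping for the property that every vertex is joined to infinity: in addition, every
  new child must be attached to \<open>w\<close> or be joined to infinity itself.\<close>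

lemma covered_step:
  assumes "\<eta> \<subseteq> E" "S \<subseteq> C" "\<tau> \<subseteq> C" "\<sigma> \<subseteq> D - {w}"
  shows "(\<forall>v\<in>U'\<union>D'. \<exists>s\<in>\<sigma> \<union> ch ` \<tau>. joined T (\<eta> \<union> S) v s) \<longleftrightarrow>
    (\<forall>v\<in>U\<union>D. \<exists>s\<in>\<sigma> \<union> (if S \<inter> \<tau> = {} then {} else {w}). joined T \<eta> v s) \<and> S \<union> \<tau> = C"
    (is "?L \<longleftrightarrow> ?R \<and> _")
proof
  assume L: ?L
  have iso: "z = ch c" if "c \<in> C - S" "joined T (\<eta> \<union> S) (ch c) z" for c z
    using isolated_child[OF assms(1,2) that] .
  have "c \<in> S \<union> \<tau>" if c: "c \<in> C" for c
  proof (rule ccontr)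
    assume n: "c \<notin> S \<union> \<tau>"
    obtain s where s: "s \<in> \<sigma> \<union> ch ` \<tau>" "joined T (\<eta> \<union> S) (ch c) s" using L c by blast
    then have "s = ch c" using iso c n by blast
    then show False using s(1) n assms ch_fresh[OF c] ch_inj[OF c] by blast
  qed
  then have "S \<union> \<tau> = C" using assms by blast
  moreover have ?R
  proof
    fix v assume v: "v \<in> U \<union> D"
    then have "v \<in> U' \<union> D'" by auto
    then obtain s where s: "s \<in> \<sigma> \<union> ch ` \<tau>" "joined T (\<eta> \<union> S) v s" using L by blast
    have j: "joined T \<eta> v (retract S s)"
      using joined_retract[OF assms(1,2) s(2)] retract_old[OF assms(2) v] by simp
    show "\<exists>s\<in>\<sigma> \<union> (if S \<inter> \<tau> = {} then {} else {w}). joined T \<eta> v s"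
    proof (cases "s \<in> \<sigma>")
      case True
      then have "retract S s = s" using assms(4) by (intro retract_old[OF assms(2)]) auto
      then show ?thesis using j True by auto
    next
      case False
      then obtain c where c: "c \<in> \<tau>" "s = ch c" using s(1) by blast
      show ?thesis
      proof (cases "c \<in> S")
        case True
        then show ?thesis using c j by (auto simp: retract_def)
      next
        case False
        then have "v = ch c" using iso joined_sym[OF s(2)] c assms(3) by blast
        then show ?thesis using v ch_fresh c assms by blast
      qed
    qed
  qed
  ultimately show "?R \<and> S \<union> \<tau> = C" by blast
next
  assume R: "?R \<and> S \<union> \<tau> = C"
  have old: "\<exists>s\<in>\<sigma> \<union> ch ` \<tau>. joined T (\<eta> \<union> S) v s" if v: "v \<in> U \<union> D" for v
  proof -
    obtain s where s: "s\<in>\<sigma> \<union> (if S \<inter> \<tau> = {} then {} else {w})" "joined T \<eta> v s" using R v by blast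
    have j: "joined T (\<eta> \<union> S) v s" using joined_mono[OF s(2)] by blast
    show ?thesis
    proof (cases "s \<in> \<sigma>")
      case True then show ?thesis using j by blast
    next
      case False
      then obtain c where c: "c \<in> S" "c \<in> \<tau>" "s = w" using s(1) by (auto split: if_splits)
      have "joined T (\<eta> \<union> S) v (ch c)"
        using joined_trans[OF j] joined_sym[OF joined_child[OF c(1) assms(2)]] c(3) by blast
      then show ?thesis using c by blast
    qed
  qed
  show ?L
  proof
    fix v assume "v \<in> U' \<union> D'"
    then consider "v \<in> U \<union> D" | c where "c \<in> C" "v = ch c" using w by blast
    then show "\<exists>s\<in>\<sigma> \<union> ch ` \<tau>. joined T (\<eta> \<union> S) v s"
    proof cases
      case 1 then show ?thesis by (rule old)
    next
      case 2
      show ?thesis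
      proof (cases "c \<in> \<tau>")
        case True then show ?thesis using 2 by (intro bexI[of _ "ch c"]) auto
      next
        case False
        then have "c \<in> S" using R 2 by blast
        then have "joined T (\<eta> \<union> S) v w" using joined_child assms(2) 2 by blast
        moreover obtain s where "s\<in>\<sigma> \<union> ch ` \<tau>" "joined T (\<eta> \<union> S) w s" using old[of w] w by blast
        ultimately show ?thesis by (meson joined_trans)
      qed
    qed
  qed
qed

end

context reg_tree begin

text \<open>The graph on \<open>U \<union> D\<close> with the edges \<open>\<eta>\<close> is a forest, so \<open>|U \<union> D| - |\<eta>|\<close> is the number of its
  components, of which \<open>|\<sigma>|\<close> meet \<open>\<sigma>\<close>. Hence \<open>|U \<union> D| - |\<eta>| - |\<sigma>|\<close> counts the components that
  meet \<open>\<sigma>\<close> nowhere. Growing the window avoids counting components.\<close>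

lemma separated_card:
  assumes "window T U D E" "\<eta> \<subseteq> E" "\<sigma> \<subseteq> D" "separated T \<eta> \<sigma>"
  shows "card \<eta> + card \<sigma> \<le> card (U \<union> D) \<and>
    (card \<eta> + card \<sigma> = card (U \<union> D) \<longleftrightarrow> (\<forall>v\<in>U\<union>D. \<exists>s\<in>\<sigma>. joined T \<eta> v s))"
  using assms
proof (induction arbitrary: \<eta> \<sigma> rule: window.induct)
  case (vertex v)
  then show ?case by (auto simp: subset_singleton_iff)
next
  case (edge e)
  then obtain x y where xy: "ends T e = {x, y}" "x \<noteq> y" using card_ends by (metis card_2_iff)
  have no_edges: "joined T {} a b \<longleftrightarrow> a = b" for a b by (auto elim: joined_cases)
  have c2: "card {x, y} = 2" using xy by simp
  consider "\<eta> = {}" | "\<eta> = {e}" using edge(2) by auto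
  then show ?case
  proof cases
    case 1
    have "card \<sigma> \<le> card {x, y}" using edge(3) xy by (intro card_mono) auto
    moreover have "card \<sigma> = card {x, y} \<longleftrightarrow> {x, y} \<subseteq> \<sigma>"
      using edge(3) xy card_subset_eq[of "{x,y}" \<sigma>] by (metis antisym finite.emptyI finite.insertI order_refl)
    ultimately show ?thesis using 1 xy edge(3) by (auto simp: no_edges)
  next
    case 2
    have j: "joined T {e} x y" "joined T {e} y x" using xy joined_edge[of e "{e}" T] joined_sym by (metis singletonI)+
    have "\<not> (x \<in> \<sigma> \<and> y \<in> \<sigma>)" using edge(4) 2 xy j unfolding separated_def by blast
    then have "\<sigma> = {} \<or> \<sigma> = {x} \<or> \<sigma> = {y}" using edge(3) xy by auto
    then show ?thesis using 2 xy j by auto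
  qed
next
  case (grow U D E w)
  interpret window_step T k U D E w using grow by unfold_locales auto
  obtain \<eta>0 \<sigma>0 S \<tau> where *: "\<eta>0 \<subseteq> E" "S \<subseteq> C" "\<tau> \<subseteq> C" "\<sigma>0 \<subseteq> D - {w}" "\<eta> = \<eta>0 \<union> S" "\<sigma> = \<sigma>0 \<union> ch ` \<tau>"
    using split_state[OF grow.prems(1,2)] .
  let ?\<sigma> = "\<sigma>0 \<union> (if S \<inter> \<tau> = {} then {} else {w})"
  have sep: "card (S \<inter> \<tau>) \<le> 1" "separated T \<eta>0 ?\<sigma>"
    using grow.prems(3) separated_step[OF *(1-4)] unfolding *(5,6) by auto
  have fin: "finite (S \<inter> \<tau>)" "finite \<sigma>0" using * finite_C inv(2) by (auto intro: finite_subset)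
  have w\<sigma>0: "w \<notin> \<sigma>0" using *(4) by auto
  have sub: "?\<sigma> \<subseteq> D" using *(4) w by auto
  have cardst: "card (S \<inter> \<tau>) = (if S \<inter> \<tau> = {} then 0 else 1)"
    using sep(1) fin by (auto simp: le_Suc_eq card_gt_0_iff)
  have card\<sigma>: "card ?\<sigma> = card \<sigma>0 + card (S \<inter> \<tau>)" using fin w\<sigma>0 cardst by (cases "S \<inter> \<tau> = {}") simp_all
  have IH: "card \<eta>0 + card ?\<sigma> \<le> card (U \<union> D)"
    "card \<eta>0 + card ?\<sigma> = card (U \<union> D) \<longleftrightarrow> (\<forall>v\<in>U\<union>D. \<exists>s\<in>?\<sigma>. joined T \<eta>0 v s)"
    using grow.IH[OF *(1) sub sep(2)] by blast+
  note cs = card_step[OF *(1-4)]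
  have full: "card (C - S - \<tau>) = 0 \<longleftrightarrow> S \<union> \<tau> = C" using finite_C *(2,3) by auto
  have "card \<eta> + card \<sigma> = card \<eta>0 + card ?\<sigma> + card (S \<union> \<tau>)"
    unfolding *(5,6) cs(1,2) card\<sigma> using cs(4) by simp
  moreover have "card (U' \<union> D') = card (U \<union> D) + card (S \<union> \<tau>) + card (C - S - \<tau>)"
    using cs(3,5) by simp
  moreover have "(\<forall>v\<in>U'\<union>D'. \<exists>s\<in>\<sigma>. joined T \<eta> v s) \<longleftrightarrow>
    (\<forall>v\<in>U\<union>D. \<exists>s\<in>?\<sigma>. joined T \<eta>0 v s) \<and> S \<union> \<tau> = C"
    using covered_step[OF *(1-4)] unfolding *(5,6) .
  ultimately show ?case using IH full by linarith
qed

end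


section \<open>Gibbs weights and their one-step kernel\<close>

text \<open>The weights \<open>B = u b\<close> and \<open>A = (1 - u b) / (1 + q)\<close> of \<open>b\<close> being joined to infinity or not are
  normalised by \<open>(1 + q) A + B = 1\<close>: that is the total over the two states of \<open>b\<close> and over the
  possible states of the edge that leads to \<open>b\<close>, seen from a vertex that is not joined to infinity.\<close>

definition boundary_weight :: "real \<Rightarrow> ('v \<Rightarrow> real) \<Rightarrow> 'v set \<Rightarrow> 'v set \<Rightarrow> real" where
  "boundary_weight q u D \<sigma> = (\<Prod>b\<in>D. if b \<in> \<sigma> then u b else (1 - u b) / (1 + q))"

text \<open>By \<open>separated_card\<close> the exponent is the number of components that are not joined to infinity.\<close>

definition weight :: "('v, 'e) multigraph \<Rightarrow> real \<Rightarrow> ('v \<Rightarrow> real) \<Rightarrow> 'v set \<Rightarrow> 'v set \<Rightarrow> 'e set \<Rightarrow> 'e set \<times> 'v set \<Rightarrow> real" where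
  "weight T q u U D E x =
     (if fst x \<subseteq> E \<and> snd x \<subseteq> D \<and> separated T (fst x) (snd x)
      then q ^ (card (U \<union> D) - card (fst x) - card (snd x)) * boundary_weight q u D (snd x) else 0)"

definition gibbs :: "('v, 'e) multigraph \<Rightarrow> real \<Rightarrow> ('v \<Rightarrow> real) \<Rightarrow> 'v set \<Rightarrow> 'v set \<Rightarrow> 'e set \<Rightarrow> ('e set \<times> 'v set) pmf \<Rightarrow> bool" where
  "gibbs T q u U D E p \<longleftrightarrow> (\<exists>z>0. \<forall>x. weight T q u U D E x = z * pmf p x)"

text \<open>The states of an edge to a child, seen from a vertex that does not owe its connection to infinity
  to that child: open, closed with a child not joined to infinity, closed with a child that is. An
  open edge to a joined child is missing, as it would join the vertex to infinity.\<close>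

datatype label = Opn | Cl0 | Cl1

definition label_pmf :: "real \<Rightarrow> real \<Rightarrow> label pmf" where
  "label_pmf q t = pmf_of_list [(Opn, (1 - t) / (1 + q)), (Cl0, q * (1 - t) / (1 + q)), (Cl1, t)]"

lemma pmf_label:
  assumes "q \<ge> 0" "0 \<le> t" "t \<le> 1"
  shows "pmf (label_pmf q t) Opn = (1 - t) / (1 + q)" "pmf (label_pmf q t) Cl0 = q * (1 - t) / (1 + q)"
    "pmf (label_pmf q t) Cl1 = t"
proof -
  have "(1 - t) / (1 + q) + q * (1 - t) / (1 + q) = 1 - t"
    using assms(1) by (simp add: add_divide_distrib[symmetric] distrib_right[of 1 q "1 - t", symmetric, simplified])
  then have "pmf_of_list_wf [(Opn, (1 - t) / (1 + q)), (Cl0, q * (1 - t) / (1 + q)), (Cl1, t)]"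
    using assms by (auto simp: pmf_of_list_wf_def)
  then show "pmf (label_pmf q t) Opn = (1 - t) / (1 + q)" "pmf (label_pmf q t) Cl0 = q * (1 - t) / (1 + q)"
    "pmf (label_pmf q t) Cl1 = t"
    by (simp_all add: label_pmf_def pmf_pmf_of_list)
qed

text \<open>The child through which a vertex is joined to infinity. If all parameters vanish, a joined vertex
  has probability 0, and any law will do.\<close>

definition pick_pmf :: "'e set \<Rightarrow> ('e \<Rightarrow> real) \<Rightarrow> 'e pmf" where
  "pick_pmf C u = (if sum u C > 0 then embed_pmf (\<lambda>c. if c \<in> C then u c / sum u C else 0) else pmf_of_set C)"

lemma pick_pmf:
  assumes "finite C" "C \<noteq> {}" "\<And>c. c \<in> C \<Longrightarrow> u c \<ge> 0"
  shows "sum u C > 0 \<Longrightarrow> pmf (pick_pmf C u) c = (if c \<in> C then u c / sum u C else 0)"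
    and "set_pmf (pick_pmf C u) \<subseteq> C"
proof -
  have *: "pmf (pick_pmf C u) c = (if c \<in> C then u c / sum u C else 0)" if s: "sum u C > 0" for c
  proof -
    let ?f = "\<lambda>c. if c \<in> C then u c / sum u C else 0"
    have nn: "?f x \<ge> 0" for x using assms(3) s by simp
    have "(\<integral>\<^sup>+ x. ennreal (?f x) \<partial>count_space UNIV) = (\<Sum>x\<in>C. ennreal (?f x))"
      using assms(1) by (intro nn_integral_count_space') (auto split: if_splits)
    also have "\<dots> = ennreal (\<Sum>x\<in>C. ?f x)" using nn by (intro sum_ennreal) blast
    also have "(\<Sum>x\<in>C. ?f x) = 1" using s by (simp flip: sum_divide_distrib)
    finally have "pmf (embed_pmf ?f) c = ?f c" using nn by (intro pmf_embed_pmf) auto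
    then show ?thesis using s by (simp add: pick_pmf_def)
  qed
  then show "sum u C > 0 \<Longrightarrow> pmf (pick_pmf C u) c = (if c \<in> C then u c / sum u C else 0)" .
  show "set_pmf (pick_pmf C u) \<subseteq> C"
  proof (cases "sum u C > 0")
    case True then show ?thesis using * by (auto simp: set_pmf_eq)
  next
    case False then show ?thesis using assms by (simp add: pick_pmf_def)
  qed
qed

lemma pick_pmf_const:
  assumes "finite C" "C \<noteq> {}" "t \<ge> 0"
  shows "pick_pmf C (\<lambda>_. t) = pmf_of_set C"
proof (cases "t > 0")
  case True
  then have "sum (\<lambda>_. t) C > 0" using assms by (intro sum_pos) auto
  then have "pmf (pick_pmf C (\<lambda>_. t)) c = pmf (pmf_of_set C) c" for c
    using assms True by (subst pick_pmf(1)) (auto simp: indicator_def)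
  then show ?thesis by (intro pmf_eqI)
next
  case False then show ?thesis using assms by (simp add: pick_pmf_def)
qed

text \<open>If the explored vertex is joined to infinity (\<open>s\<close>), the label of the picked child is overwritten by
  ``open and joined''. Keeping labels for all children makes the outcome increasing in \<open>s\<close>.\<close>

definition star_outcome :: "'e set \<Rightarrow> bool \<Rightarrow> ('e \<Rightarrow> label) \<Rightarrow> 'e \<Rightarrow> 'e set \<times> 'e set" where
  "star_outcome C s l c =
     ({e\<in>C. l e = Opn} \<union> (if s then {c} else {}), {e\<in>C. l e = Cl1} \<union> (if s then {c} else {}))"

definition star_pmf :: "real \<Rightarrow> ('e \<Rightarrow> real) \<Rightarrow> 'e set \<Rightarrow> bool \<Rightarrow> ('e set \<times> 'e set) pmf" where
  "star_pmf q u C s = bind_pmf (pick_pmf C u) (\<lambda>c.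
     map_pmf (\<lambda>l. star_outcome C s l c) (Pi_pmf C Cl0 (\<lambda>e. label_pmf q (u e))))"

definition child_weight :: "real \<Rightarrow> ('e \<Rightarrow> real) \<Rightarrow> 'e set \<Rightarrow> 'e set \<Rightarrow> 'e \<Rightarrow> real" where
  "child_weight q u S \<tau> e =
     (if e \<in> \<tau> then u e else if e \<in> S then (1 - u e) / (1 + q) else q * (1 - u e) / (1 + q))"

locale star_params =
  fixes q :: real and u :: "'e \<Rightarrow> real" and C :: "'e set"
  assumes q: "q \<ge> 0" and fin: "finite C" and ne: "C \<noteq> {}" and u: "\<And>c. c \<in> C \<Longrightarrow> 0 \<le> u c \<and> u c \<le> 1"
begin

lemma measure_labels:
  assumes "A \<subseteq> C" "S \<inter> \<tau> \<inter> A = {}"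
  shows "measure (Pi_pmf C Cl0 (\<lambda>e. label_pmf q (u e)))
      {l. \<forall>e\<in>A. l e = (if e \<in> \<tau> then Cl1 else if e \<in> S then Opn else Cl0)} = (\<Prod>e\<in>A. child_weight q u S \<tau> e)"
proof -
  let ?lab = "\<lambda>e. if e \<in> \<tau> then Cl1 else if e \<in> S then Opn else Cl0"
  have "{l. \<forall>e\<in>A. l e = ?lab e} = Pi C (\<lambda>e. if e \<in> A then {?lab e} else UNIV)"
    using assms by (auto simp: Pi_def)
  then have "measure (Pi_pmf C Cl0 (\<lambda>e. label_pmf q (u e))) {l. \<forall>e\<in>A. l e = ?lab e}
    = (\<Prod>e\<in>C. measure (label_pmf q (u e)) (if e \<in> A then {?lab e} else UNIV))"
    using measure_Pi_pmf_Pi[OF fin] by simp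
  also have "\<dots> = (\<Prod>e\<in>C. if e \<in> A then child_weight q u S \<tau> e else 1)"
    using assms u q by (intro prod.cong refl) (auto simp: child_weight_def measure_pmf_single pmf_label)
  also have "\<dots> = (\<Prod>e\<in>A. child_weight q u S \<tau> e)"
    using assms fin by (simp add: prod.If_cases Int_absorb1)
  finally show ?thesis .
qed

lemma set_pick: "set_pmf (pick_pmf C u) \<subseteq> C"
  using pick_pmf(2)[OF fin ne] u by blast

lemma set_star_pmf:
  assumes "(S, \<tau>) \<in> set_pmf (star_pmf q u C s)"
  shows "S \<subseteq> C" "\<tau> \<subseteq> C" "S \<inter> \<tau> \<noteq> {} \<longleftrightarrow> s"
proof -
  obtain c l where cl: "c \<in> C" "(S, \<tau>) = star_outcome C s l c"
    using assms set_pick by (auto simp: star_pmf_def)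
  have [simp]: "S = {e\<in>C. l e = Opn} \<union> (if s then {c} else {})" "\<tau> = {e\<in>C. l e = Cl1} \<union> (if s then {c} else {})"
    using cl(2) by (simp_all add: star_outcome_def)
  show "S \<subseteq> C" "\<tau> \<subseteq> C" "S \<inter> \<tau> \<noteq> {} \<longleftrightarrow> s" using cl(1) by auto
qed

lemma star_outcome_eq_iff:
  assumes "S \<subseteq> C" "\<tau> \<subseteq> C" "c \<in> C"
  shows "star_outcome C s l c = (S, \<tau>) \<longleftrightarrow> S \<inter> \<tau> = (if s then {c} else {}) \<and>
    (\<forall>e\<in>C - (if s then {c} else {}). l e = (if e \<in> \<tau> then Cl1 else if e \<in> S then Opn else Cl0))"
    (is "?L \<longleftrightarrow> ?R1 \<and> ?R2")
proof
  assume ?L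
  then have S: "S = {e\<in>C. l e = Opn} \<union> (if s then {c} else {})" "\<tau> = {e\<in>C. l e = Cl1} \<union> (if s then {c} else {})"
    by (simp_all add: star_outcome_def)
  have "l e = (if e \<in> \<tau> then Cl1 else if e \<in> S then Opn else Cl0)" if "e\<in>C - (if s then {c} else {})" for e
    using that unfolding S by (cases "l e") auto
  then show "?R1 \<and> ?R2" unfolding S using assms(3) by auto
next
  assume R: "?R1 \<and> ?R2"
  have "e \<in> S \<longleftrightarrow> (e \<in> C \<and> l e = Opn) \<or> (s \<and> e = c)" for e
  proof (cases "e \<in> C - (if s then {c} else {})")
    case True
    then have "l e = (if e \<in> \<tau> then Cl1 else if e \<in> S then Opn else Cl0)" using R by blast
    moreover have "e \<notin> S \<inter> \<tau>" using R True by auto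
    ultimately show ?thesis using True assms by (auto split: if_splits)
  next
    case False
    then show ?thesis using R assms by (auto split: if_splits)
  qed
  moreover have "e \<in> \<tau> \<longleftrightarrow> (e \<in> C \<and> l e = Cl1) \<or> (s \<and> e = c)" for e
  proof (cases "e \<in> C - (if s then {c} else {})")
    case True
    then have "l e = (if e \<in> \<tau> then Cl1 else if e \<in> S then Opn else Cl0)" using R by blast
    then show ?thesis using True assms by (auto split: if_splits)
  next
    case False
    then show ?thesis using R assms by (auto split: if_splits)
  qed
  ultimately show ?L unfolding star_outcome_def by (auto split: if_splits)
qed

lemma pmf_star_eq_sum:
  assumes "S \<subseteq> C" "\<tau> \<subseteq> C"
  shows "pmf (star_pmf q u C s) (S, \<tau>) =
    (\<Sum>c\<in>C. pmf (pick_pmf C u) c * (if S \<inter> \<tau> = (if s then {c} else {})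
        then \<Prod>e\<in>C - (if s then {c} else {}). child_weight q u S \<tau> e else 0))"
proof -
  let ?L = "Pi_pmf C Cl0 (\<lambda>e. label_pmf q (u e))"
  have 1: "pmf (map_pmf (\<lambda>l. star_outcome C s l c) ?L) (S, \<tau>) = (if S \<inter> \<tau> = (if s then {c} else {})
        then \<Prod>e\<in>C - (if s then {c} else {}). child_weight q u S \<tau> e else 0)" if c: "c \<in> C" for c
  proof -
    have "pmf (map_pmf (\<lambda>l. star_outcome C s l c) ?L) (S, \<tau>) = measure ?L {l. star_outcome C s l c = (S, \<tau>)}"
      by (simp add: pmf_map vimage_def)
    also have "\<dots> = (if S \<inter> \<tau> = (if s then {c} else {})
        then \<Prod>e\<in>C - (if s then {c} else {}). child_weight q u S \<tau> e else 0)"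
      unfolding star_outcome_eq_iff[OF assms c]
      using measure_labels[of "C - (if s then {c} else {})" S \<tau>] by auto
    finally show ?thesis .
  qed
  have "pmf (star_pmf q u C s) (S, \<tau>) =
    (\<Sum>c\<in>C. pmf (map_pmf (\<lambda>l. star_outcome C s l c) ?L) (S, \<tau>) * pmf (pick_pmf C u) c)"
    unfolding star_pmf_def pmf_bind using set_pick by (intro integral_measure_pmf_real[OF fin]) auto
  then show ?thesis using 1 by (simp add: mult.commute cong: sum.cong)
qed

lemma pmf_star_False:
  assumes "S \<subseteq> C" "\<tau> \<subseteq> C"
  shows "pmf (star_pmf q u C False) (S, \<tau>) = (if S \<inter> \<tau> = {} then \<Prod>e\<in>C. child_weight q u S \<tau> e else 0)"
proof -
  have "sum (pmf (pick_pmf C u)) C = 1" using set_pick by (intro sum_pmf_eq_1 fin)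
  then show ?thesis unfolding pmf_star_eq_sum[OF assms] by (simp flip: sum_distrib_right)
qed

lemma pmf_star_True:
  assumes "S \<subseteq> C" "\<tau> \<subseteq> C" "sum u C > 0" "S \<inter> \<tau> = {c}"
  shows "pmf (star_pmf q u C True) (S, \<tau>) = u c / sum u C * (\<Prod>e\<in>C - {c}. child_weight q u S \<tau> e)"
proof -
  have c: "c \<in> C" using assms by auto
  have "pmf (star_pmf q u C True) (S, \<tau>) =
    (\<Sum>d\<in>C. if d = c then pmf (pick_pmf C u) c * (\<Prod>e\<in>C - {c}. child_weight q u S \<tau> e) else 0)"
    unfolding pmf_star_eq_sum[OF assms(1,2)] using assms(4) by (intro sum.cong refl) auto
  also have "\<dots> = pmf (pick_pmf C u) c * (\<Prod>e\<in>C - {c}. child_weight q u S \<tau> e)"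
    using fin c by simp
  finally show ?thesis using pick_pmf(1)[OF fin ne _ assms(3), of c] u c by simp
qed

lemma pmf_star_True_0:
  assumes "S \<subseteq> C" "\<tau> \<subseteq> C" "card (S \<inter> \<tau>) \<noteq> 1"
  shows "pmf (star_pmf q u C True) (S, \<tau>) = 0"
  unfolding pmf_star_eq_sum[OF assms(1,2)] using assms(3) by (intro sum.neutral ballI) auto

lemma prod_child_weight:
  assumes "S \<subseteq> C" "\<tau> \<subseteq> C" and that: "finite A"
  shows "(\<Prod>e\<in>A. child_weight q u S \<tau> e) =
    q ^ card (A - S - \<tau>) * (\<Prod>e\<in>A. if e \<in> \<tau> then u e else (1 - u e) / (1 + q))"
proof -
  have "(\<Prod>e\<in>A. child_weight q u S \<tau> e) =
    (\<Prod>e\<in>A. (if e \<in> A - S - \<tau> then q else 1) * (if e \<in> \<tau> then u e else (1 - u e) / (1 + q)))"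
    by (intro prod.cong refl) (auto simp: child_weight_def)
  also have "\<dots> = q ^ card (A - S - \<tau>) * (\<Prod>e\<in>A. if e \<in> \<tau> then u e else (1 - u e) / (1 + q))"
  proof -
    have "(\<Prod>e\<in>A. if e \<in> A - S - \<tau> then q else 1) = prod (\<lambda>_. q) (A \<inter> (A - S - \<tau>))"
      using that by (rule prod.inter_restrict[symmetric])
    also have "A \<inter> (A - S - \<tau>) = A - S - \<tau>" by auto
    finally show ?thesis by (simp add: prod.distrib)
  qed
  finally show ?thesis .
qed

end

lemma pmf_map_inj_on:
  assumes "inj_on g A" "set_pmf p \<subseteq> A" "a \<in> A"
  shows "pmf (map_pmf g p) (g a) = pmf p a"
proof -
  have "pmf (map_pmf g p) (g a) = measure p (g -` {g a})" by (simp add: pmf_map)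
  also have "\<dots> = measure p {a}"
    by (rule measure_eq_AE) (use assms in \<open>auto simp: AE_measure_pmf_iff inj_on_def\<close>)
  finally show ?thesis by (simp add: measure_pmf_single)
qed

lemma (in reg_tree) weight_pos_subset:
  "weight T q u U D E x \<noteq> 0 \<Longrightarrow> fst x \<subseteq> E \<and> snd x \<subseteq> D"
  by (auto simp: weight_def split: if_splits)

context window_step begin

definition step_pmf :: "real \<Rightarrow> ('v \<Rightarrow> real) \<Rightarrow> 'e set \<times> 'v set \<Rightarrow> ('e set \<times> 'v set) pmf" where
  "step_pmf q u x = map_pmf (\<lambda>(S, \<tau>). (fst x \<union> S, snd x - {w} \<union> ch ` \<tau>))
     (star_pmf q (\<lambda>c. u (ch c)) C (w \<in> snd x))"

lemma boundary_weight_step: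
  assumes "\<sigma> \<subseteq> D - {w}" "\<tau> \<subseteq> C"
  shows "boundary_weight q u D' (\<sigma> \<union> ch ` \<tau>) =
    boundary_weight q u (D - {w}) \<sigma> * (\<Prod>c\<in>C. if c \<in> \<tau> then u (ch c) else (1 - u (ch c)) / (1 + q))"
proof -
  let ?f = "\<lambda>b. if b \<in> \<sigma> \<union> ch ` \<tau> then u b else (1 - u b) / (1 + q)"
  have "boundary_weight q u D' (\<sigma> \<union> ch ` \<tau>) = prod ?f (D - {w}) * prod ?f (ch ` C)"
    unfolding boundary_weight_def using inv(2) finite_C ch_fresh by (intro prod.union_disjoint) auto
  also have "prod ?f (D - {w}) = boundary_weight q u (D - {w}) \<sigma>"
    unfolding boundary_weight_def using assms ch_fresh by (intro prod.cong refl) auto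
  also have "prod ?f (ch ` C) = (\<Prod>c\<in>C. ?f (ch c))"
    using prod.reindex[OF inj_ch[OF subset_refl], of ?f] by (simp add: comp_def)
  also have "\<dots> = (\<Prod>c\<in>C. if c \<in> \<tau> then u (ch c) else (1 - u (ch c)) / (1 + q))"
  proof (intro prod.cong refl)
    fix c assume c: "c \<in> C"
    have "ch c \<notin> \<sigma>" using assms(1) ch_fresh[OF c] by auto
    moreover have "ch c \<in> ch ` \<tau> \<longleftrightarrow> c \<in> \<tau>" using ch_inj[OF c] assms(2) by blast
    ultimately show "?f (ch c) = (if c \<in> \<tau> then u (ch c) else (1 - u (ch c)) / (1 + q))" by simp
  qed
  finally show ?thesis .
qed

lemma boundary_weight_cong: "(\<And>b. b \<in> A \<Longrightarrow> u b = u' b) \<Longrightarrow> boundary_weight q u A \<sigma> = boundary_weight q u' A \<sigma>"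
  unfolding boundary_weight_def by (intro prod.cong refl) simp

lemma boundary_weight_old:
  assumes "\<sigma> \<subseteq> D - {w}"
  shows "boundary_weight q u D (\<sigma> \<union> (if b then {w} else {})) =
    (if b then u w else (1 - u w) / (1 + q)) * boundary_weight q u (D - {w}) \<sigma>"
proof -
  let ?f = "\<lambda>x. if x \<in> \<sigma> \<union> (if b then {w} else {}) then u x else (1 - u x) / (1 + q)"
  have "boundary_weight q u D (\<sigma> \<union> (if b then {w} else {})) = ?f w * prod ?f (D - {w})"
    unfolding boundary_weight_def by (rule prod.remove[OF inv(2) w])
  also have "prod ?f (D - {w}) = boundary_weight q u (D - {w}) \<sigma>"
    unfolding boundary_weight_def by (intro prod.cong refl) auto
  also have "?f w = (if b then u w else (1 - u w) / (1 + q))" using assms by auto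
  finally show ?thesis .
qed

text \<open>The recursion before summation. The explored vertex \<open>w\<close> is not joined to infinity with relative
  weight 1, and joined through exactly one of its children with relative weight \<open>s\<close>. Under the
  normalisation \<open>(1 + q) A + B = 1\<close> this is \<open>u w = s / (1 + q + s)\<close>.\<close>

lemma weight_step:
  fixes u u' :: "'v \<Rightarrow> real"
  defines "s \<equiv> \<Sum>c\<in>C. u' (ch c)"
  assumes q: "q \<ge> 0" and u': "\<And>c. c \<in> C \<Longrightarrow> 0 \<le> u' (ch c) \<and> u' (ch c) \<le> 1"
    and uw: "u w = s / (1 + q + s)" and u_eq: "\<And>b. b \<in> D - {w} \<Longrightarrow> u b = u' b"
    and sub: "\<eta> \<subseteq> E" "S \<subseteq> C" "\<tau> \<subseteq> C" "\<sigma> \<subseteq> D - {w}"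
  shows "weight T q u' U' D' E' (\<eta> \<union> S, \<sigma> \<union> ch ` \<tau>) =
    (1 + q + s) * weight T q u U D E (\<eta>, \<sigma> \<union> (if S \<inter> \<tau> = {} then {} else {w})) *
      pmf (star_pmf q (\<lambda>c. u' (ch c)) C (S \<inter> \<tau> \<noteq> {})) (S, \<tau>)"
proof -
  interpret star_params q "\<lambda>c. u' (ch c)" C
    using q finite_C C_ne u' by unfold_locales auto
  have s: "s \<ge> 0" unfolding s_def using u' by (intro sum_nonneg) auto
  let ?\<sigma> = "\<sigma> \<union> (if S \<inter> \<tau> = {} then {} else {w})"
  have sub\<sigma>: "?\<sigma> \<subseteq> D" using sub(4) w by auto
  note sep = separated_step[OF sub]
  have sub': "\<eta> \<union> S \<subseteq> E'" "\<sigma> \<union> ch ` \<tau> \<subseteq> D'" using sub by auto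
  show ?thesis
  proof (cases "separated T (\<eta> \<union> S) (\<sigma> \<union> ch ` \<tau>)")
    case False
    have "weight T q u U D E (\<eta>, ?\<sigma>) * pmf (star_pmf q (\<lambda>c. u' (ch c)) C (S \<inter> \<tau> \<noteq> {})) (S, \<tau>) = 0"
    proof (cases "separated T \<eta> ?\<sigma>")
      case True
      then have c: "card (S \<inter> \<tau>) > 1" using sep False by auto
      then have "S \<inter> \<tau> \<noteq> {}" by auto
      then show ?thesis using pmf_star_True_0[OF sub(2,3)] c by auto
    next
      case False then show ?thesis by (simp add: weight_def)
    qed
    then show ?thesis using False by (simp add: weight_def)
  next
    case True
    have sep0: "separated T \<eta> ?\<sigma>" "card (S \<inter> \<tau>) \<le> 1" using True sep by auto
    have finS: "finite (S \<inter> \<tau>)" "finite \<sigma>" using sub finite_C inv(2) by (auto intro: finite_subset)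
    have w\<sigma>: "w \<notin> \<sigma>" using sub(4) by auto
    have cardst: "card (S \<inter> \<tau>) = (if S \<inter> \<tau> = {} then 0 else 1)"
      using sep0(2) finS by (auto simp: le_Suc_eq card_gt_0_iff)
    have card\<sigma>: "card ?\<sigma> = card \<sigma> + card (S \<inter> \<tau>)"
      using finS w\<sigma> cardst by (cases "S \<inter> \<tau> = {}") simp_all
    note cs = card_step[OF sub]
    have "card \<eta> + card ?\<sigma> \<le> card (U \<union> D)"
      using separated_card[OF win sub(1) sub\<sigma> sep0(1)] by simp
    then have expo: "card (U' \<union> D') - card (\<eta> \<union> S) - card (\<sigma> \<union> ch ` \<tau>) =
      (card (U \<union> D) - card \<eta> - card ?\<sigma>) + card (C - S - \<tau>)"
      using cs card\<sigma> by linarith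
    let ?B = "\<lambda>c. if c \<in> \<tau> then u' (ch c) else (1 - u' (ch c)) / (1 + q)"
    have lhs: "weight T q u' U' D' E' (\<eta> \<union> S, \<sigma> \<union> ch ` \<tau>) =
      q ^ (card (U \<union> D) - card \<eta> - card ?\<sigma>) * q ^ card (C - S - \<tau>) *
        (boundary_weight q u' (D - {w}) \<sigma> * prod ?B C)"
      unfolding weight_def fst_conv snd_conv expo
      using True sub' by (simp add: power_add boundary_weight_step[OF sub(4,3)])
    have bw: "boundary_weight q u D ?\<sigma> = (if S \<inter> \<tau> \<noteq> {} then u w else (1 - u w) / (1 + q)) * boundary_weight q u' (D - {w}) \<sigma>"
    proof -
      have cong: "boundary_weight q u (D - {w}) \<sigma> = boundary_weight q u' (D - {w}) \<sigma>"
        by (rule boundary_weight_cong) (rule u_eq)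
      show ?thesis
        using boundary_weight_old[OF sub(4), of q u "S \<inter> \<tau> \<noteq> {}"] unfolding cong
        by (cases "S \<inter> \<tau> = {}") simp_all
    qed
    have rhs: "weight T q u U D E (\<eta>, ?\<sigma>) = q ^ (card (U \<union> D) - card \<eta> - card ?\<sigma>) *
      ((if S \<inter> \<tau> \<noteq> {} then u w else (1 - u w) / (1 + q)) * boundary_weight q u' (D - {w}) \<sigma>)"
      using sep0(1) sub(1) sub\<sigma> by (simp add: weight_def bw)
    show ?thesis
    proof (cases "S \<inter> \<tau> = {}")
      case True
      have p: "pmf (star_pmf q (\<lambda>c. u' (ch c)) C False) (S, \<tau>) = q ^ card (C - S - \<tau>) * prod ?B C"
        using True by (simp add: pmf_star_False[OF sub(2,3)] prod_child_weight[OF sub(2,3) finite_C])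
      have "1 - u w = (1 + q) / (1 + q + s)" using q s by (simp add: uw field_simps)
      then have e: "(1 + q + s) * ((1 - u w) / (1 + q)) = 1" using q s by (simp add: field_simps)
      have "(1 + q + s) * weight T q u U D E (\<eta>, ?\<sigma>) = q ^ (card (U \<union> D) - card \<eta> - card ?\<sigma>) *
        (((1 + q + s) * ((1 - u w) / (1 + q))) * boundary_weight q u' (D - {w}) \<sigma>)"
        unfolding rhs using True by (simp add: mult_ac)
      then have "(1 + q + s) * weight T q u U D E (\<eta>, ?\<sigma>) =
        q ^ (card (U \<union> D) - card \<eta> - card ?\<sigma>) * boundary_weight q u' (D - {w}) \<sigma>"
        unfolding e by simp
      then show ?thesis using lhs True p by simp
    next
      case False
      then obtain c where c: "S \<inter> \<tau> = {c}" using cardst by (auto simp: card_1_singleton_iff)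
      then have cC: "c \<in> C" "c \<in> \<tau>" "c \<in> S" using sub by auto
      have rem: "prod ?B C = u' (ch c) * prod ?B (C - {c})"
        using prod.remove[OF finite_C cC(1), of ?B] cC by simp
      show ?thesis
      proof (cases "s > 0")
        case True
        have Ceq: "C - {c} - S - \<tau> = C - S - \<tau>" using cC by auto
        have p: "pmf (star_pmf q (\<lambda>c. u' (ch c)) C True) (S, \<tau>) =
            u' (ch c) / s * (q ^ card (C - S - \<tau>) * prod ?B (C - {c}))"
          using pmf_star_True[OF sub(2,3) _ c] True
          by (simp add: s_def prod_child_weight[OF sub(2,3)] finite_C Ceq)
        have "(1 + q + s) * u w = s" using q s by (simp add: uw)
        then have "(1 + q + s) * weight T q u U D E (\<eta>, ?\<sigma>) =
          q ^ (card (U \<union> D) - card \<eta> - card ?\<sigma>) * (s * boundary_weight q u' (D - {w}) \<sigma>)"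
          unfolding rhs using False by simp
        then have "(1 + q + s) * weight T q u U D E (\<eta>, ?\<sigma>) *
          pmf (star_pmf q (\<lambda>c. u' (ch c)) C (S \<inter> \<tau> \<noteq> {})) (S, \<tau>) =
          q ^ (card (U \<union> D) - card \<eta> - card ?\<sigma>) * (s * boundary_weight q u' (D - {w}) \<sigma>) *
            (u' (ch c) / s * (q ^ card (C - S - \<tau>) * prod ?B (C - {c})))"
          using False p by simp
        also have "\<dots> = weight T q u' U' D' E' (\<eta> \<union> S, \<sigma> \<union> ch ` \<tau>)"
          unfolding lhs rem using True by (simp add: field_simps)
        finally show ?thesis ..
      next
        case False
        then have "s = 0" using s by simp
        then have "u' (ch c) = 0" unfolding s_def using sum_nonneg_eq_0_iff[OF finite_C, of "\<lambda>c. u' (ch c)"] u' cC by auto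
        moreover have "u w = 0" using uw \<open>s = 0\<close> by simp
        ultimately show ?thesis using \<open>S \<inter> \<tau> \<noteq> {}\<close> unfolding lhs rhs rem by simp
      qed
    qed
  qed
qed

text \<open>A state of the larger window determines the state of the smaller one and the outcome at \<open>w\<close>, so
  that the law of the larger window is a product, with no sum over states of the smaller one.\<close>

lemma gibbs_step:
  fixes u u' :: "'v \<Rightarrow> real"
  defines "s \<equiv> \<Sum>c\<in>C. u' (ch c)"
  assumes q: "q \<ge> 0" and u': "\<And>c. c \<in> C \<Longrightarrow> 0 \<le> u' (ch c) \<and> u' (ch c) \<le> 1"
    and uw: "u w = s / (1 + q + s)" and u_eq: "\<And>b. b \<in> D - {w} \<Longrightarrow> u b = u' b"
    and g: "gibbs T q u U D E p"
  shows "gibbs T q u' U' D' E' (bind_pmf p (step_pmf q u'))"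
proof -
  interpret star_params q "\<lambda>c. u' (ch c)" C
    using q finite_C C_ne u' by unfold_locales auto
  obtain z where z: "z > 0" "\<And>x. weight T q u U D E x = z * pmf p x" using g by (auto simp: gibbs_def)
  have s: "s \<ge> 0" unfolding s_def using u' by (intro sum_nonneg) auto
  let ?st = "\<lambda>x. star_pmf q (\<lambda>c. u' (ch c)) C (w \<in> snd x)"
  \<comment> \<open>\<open>J\<close> is the joint law of the old state and the outcome at \<open>w\<close>; the map \<open>g\<close> to the new state is
    injective on the set \<open>A\<close>, which carries \<open>J\<close>.\<close>
  define J where "J = bind_pmf p (\<lambda>x. map_pmf (Pair x) (?st x))"
  define g where "g = (\<lambda>(x :: 'e set \<times> 'v set, y). (fst x \<union> fst y, snd x - {w} \<union> ch ` snd y))"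
  define A where "A = {(x :: 'e set \<times> 'v set, y). fst x \<subseteq> E \<and> snd x \<subseteq> D \<and> fst y \<subseteq> C \<and> snd y \<subseteq> C \<and>
     (w \<in> snd x \<longleftrightarrow> fst y \<inter> snd y \<noteq> {})}"
  have bindJ: "bind_pmf p (step_pmf q u') = map_pmf g J"
    by (simp add: J_def step_pmf_def[abs_def] map_bind_pmf map_pmf_comp g_def case_prod_unfold)
  have pmfJ: "pmf J (x, y) = pmf p x * pmf (?st x) y" for x y
  proof -
    have "pmf (map_pmf (Pair x') (?st x')) (x, y) = (if x' = x then pmf (?st x) y else 0)" for x'
    proof (cases "x' = x")
      case True then show ?thesis using pmf_map_inj'[of "Pair x" "?st x" y] by (simp add: inj_on_def)
    next
      case False then show ?thesis by (auto simp: pmf_eq_0_set_pmf)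
    qed
    then have "pmf J (x, y) = (\<integral>x'. (if x' = x then pmf (?st x) y else 0) \<partial>measure_pmf p)"
      by (simp add: J_def pmf_bind)
    also have "\<dots> = (\<Sum>x'\<in>{x}. (if x' = x then pmf (?st x) y else 0) * pmf p x')"
      by (rule integral_measure_pmf_real) (auto split: if_splits)
    finally show ?thesis by simp
  qed
  have suppJ: "set_pmf J \<subseteq> A"
  proof
    fix a assume a: "a \<in> set_pmf J"
    then obtain x S \<tau> where a: "a = (x, (S, \<tau>))" "x \<in> set_pmf p" "(S, \<tau>) \<in> set_pmf (?st x)"
      by (auto simp: J_def)
    have "weight T q u U D E x \<noteq> 0" using a(2) z by (simp add: set_pmf_iff)
    then show "a \<in> A" using weight_pos_subset[of q u U D E x] set_star_pmf[OF a(3)] by (auto simp: A_def a)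
  qed
  have injg: "inj_on g A"
  proof (rule inj_onI)
    fix a b assume ab: "a \<in> A" "b \<in> A" "g a = g b"
    obtain \<eta> \<sigma> S \<tau> where a: "a = ((\<eta>, \<sigma>), (S, \<tau>))" by (metis prod.exhaust)
    obtain \<eta>2 \<sigma>2 S2 \<tau>2 where b: "b = ((\<eta>2, \<sigma>2), (S2, \<tau>2))" by (metis prod.exhaust)
    have sub: "\<eta> \<subseteq> E" "\<sigma> \<subseteq> D" "S \<subseteq> C" "\<tau> \<subseteq> C" "w \<in> \<sigma> \<longleftrightarrow> S \<inter> \<tau> \<noteq> {}"
      "\<eta>2 \<subseteq> E" "\<sigma>2 \<subseteq> D" "S2 \<subseteq> C" "\<tau>2 \<subseteq> C" "w \<in> \<sigma>2 \<longleftrightarrow> S2 \<inter> \<tau>2 \<noteq> {}"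
      using ab(1,2) by (auto simp: A_def a b)
    have eq: "\<eta> \<union> S = \<eta>2 \<union> S2" "\<sigma> - {w} \<union> ch ` \<tau> = \<sigma>2 - {w} \<union> ch ` \<tau>2"
      using ab(3) by (auto simp: g_def a b)
    have "\<eta> = (\<eta> \<union> S) \<inter> E" "\<eta>2 = (\<eta>2 \<union> S2) \<inter> E" "S = (\<eta> \<union> S) - E" "S2 = (\<eta>2 \<union> S2) - E"
      using sub(1,3,6,8) by auto
    then have 1: "\<eta> = \<eta>2" "S = S2" using eq(1) by simp_all
    have 2: "\<sigma> - {w} = \<sigma>2 - {w}" "ch ` \<tau> = ch ` \<tau>2"
    proof -
      have "ch ` \<tau> \<inter> D = {}" "ch ` \<tau>2 \<inter> D = {}" using sub(4,9) ch_fresh by blast+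
      then have "\<sigma> - {w} = (\<sigma> - {w} \<union> ch ` \<tau>) \<inter> D" "\<sigma>2 - {w} = (\<sigma>2 - {w} \<union> ch ` \<tau>2) \<inter> D"
        "ch ` \<tau> = (\<sigma> - {w} \<union> ch ` \<tau>) - D" "ch ` \<tau>2 = (\<sigma>2 - {w} \<union> ch ` \<tau>2) - D"
        using sub(2,7) by auto
      then show "\<sigma> - {w} = \<sigma>2 - {w}" "ch ` \<tau> = ch ` \<tau>2" using eq(2) by simp_all
    qed
    have 3: "\<tau> = \<tau>2" using 2(2) inj_on_image_eq_iff[OF inj_ch[OF subset_refl] sub(4,9)] by simp
    have "\<sigma> = \<sigma>2" using 2(1) sub(5,10) 1 3 by blast
    then show "a = b" using 1 3 by (simp add: a b)
  qed
  have wA: "weight T q u' U' D' E' (g a) = z * (1 + q + s) * pmf (map_pmf g J) (g a)" if aA: "a \<in> A" for a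
  proof -
    obtain \<eta> \<sigma> S \<tau> where a: "a = ((\<eta>, \<sigma>), (S, \<tau>))" by (metis prod.exhaust)
    have sub: "\<eta> \<subseteq> E" "S \<subseteq> C" "\<tau> \<subseteq> C" "\<sigma> - {w} \<subseteq> D - {w}" and w\<sigma>: "w \<in> \<sigma> \<longleftrightarrow> S \<inter> \<tau> \<noteq> {}"
      using aA by (auto simp: A_def a)
    have \<sigma>: "\<sigma> - {w} \<union> (if S \<inter> \<tau> = {} then {} else {w}) = \<sigma>" using w\<sigma> by auto
    have "weight T q u' U' D' E' (g a) = (1 + q + s) * weight T q u U D E (\<eta>, \<sigma>) *
        pmf (star_pmf q (\<lambda>c. u' (ch c)) C (S \<inter> \<tau> \<noteq> {})) (S, \<tau>)"
      using weight_step[OF q u' uw[unfolded s_def] u_eq sub] unfolding \<sigma> by (simp add: g_def a s_def)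
    also have "\<dots> = z * (1 + q + s) * pmf J a"
      by (simp add: a pmfJ z(2) w\<sigma>)
    also have "pmf J a = pmf (map_pmf g J) (g a)"
      using pmf_map_inj_on[OF injg suppJ aA] by simp
    finally show ?thesis .
  qed
  have "weight T q u' U' D' E' x = z * (1 + q + s) * pmf (map_pmf g J) x" for x
  proof (cases "x \<in> g ` A")
    case True then show ?thesis using wA by auto
  next
    case False
    have "pmf (map_pmf g J) x = 0" using False suppJ by (auto simp: pmf_eq_0_set_pmf)
    moreover have "weight T q u' U' D' E' x = 0"
    proof (rule ccontr)
      assume "weight T q u' U' D' E' x \<noteq> 0"
      then have "fst x \<subseteq> E'" "snd x \<subseteq> D'" using weight_pos_subset by blast+
      then obtain \<eta> \<sigma> S \<tau> where *: "\<eta> \<subseteq> E" "S \<subseteq> C" "\<tau> \<subseteq> C" "\<sigma> \<subseteq> D - {w}" "fst x = \<eta> \<union> S" "snd x = \<sigma> \<union> ch ` \<tau>"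
        using split_state by metis
      let ?a = "((\<eta>, \<sigma> \<union> (if S \<inter> \<tau> = {} then {} else {w})), (S, \<tau>))"
      have w\<sigma>: "w \<notin> \<sigma>" using *(4) by auto
      have "?a \<in> A" using * w w\<sigma> by (auto simp: A_def)
      moreover have "g ?a = x" using *(5,6) w\<sigma> by (auto simp: g_def prod_eq_iff)
      ultimately show False using False by (metis imageI)
    qed
    ultimately show ?thesis by simp
  qed
  then show ?thesis unfolding gibbs_def bindJ using z(1) q s by (intro exI[of _ "z * (1 + q + s)"]) auto
qed

end


section \<open>The wired graph as a window\<close>

text \<open>The law with parameter \<open>q = 1/\<beta>\<close>, where \<open>q = 0\<close> stands for \<open>\<beta> = \<infinity>\<close>.\<close>

definition gas :: "real \<Rightarrow> ('v, 'e) multigraph \<Rightarrow> 'e set pmf" where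
  "gas q G = (if q = 0 then uniform_spanning_tree G else arboreal_gas (1 / q) G)"

lemma joined_imp_rtrancl_in:
  assumes "\<And>e. e \<in> F \<Longrightarrow> ends G e \<subseteq> W" "F \<subseteq> F'" "joined G F a b" "b \<in> W"
  shows "a \<in> W \<and> (a, b) \<in> {(x, y). x \<in> W \<and> y \<in> W \<and> (\<exists>e\<in>F'. ends G e = {x, y})}\<^sup>*"
  using assms(3)
proof (induction rule: joined_induct)
  case (step x e z)
  have "x \<in> W" using step(2) assms(1)[OF step(1)] by auto
  then show ?case using step assms(2) by (auto intro!: converse_rtrancl_into_rtrancl[of x z])
qed (use assms(4) in simp)

locale wired = reg_tree T k for T :: "('v, 'e) multigraph" and k +
  fixes V D :: "'v set" and E :: "'e set"
  assumes win: "window T V D E" and V_ne: "V \<noteq> {}"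
begin

abbreviation "G \<equiv> wired_graph T V"

lemmas inv = window_invariants[OF win]

lemma D_eq: "outer_nbrs T V = D" using window_boundary[OF win V_ne] by simp

lemma edges_G: "edges G = E"
proof
  show "E \<subseteq> edges G" using inv(6,7) by (auto simp: wired_graph_def D_eq)
  show "edges G \<subseteq> E"
  proof
    fix e assume "e \<in> edges G"
    then have e: "e \<in> edges T" "ends T e \<subseteq> V \<union> D" by (auto simp: wired_graph_def D_eq)
    obtain x y where xy: "ends T e = {x, y}" using card_ends[OF e(1)] by (auto simp: card_2_iff)
    show "e \<in> E"
    proof (rule ccontr)
      assume "e \<notin> E"
      then show False using not_joined_avoiding[OF e(1) xy inv(6)] inv(8)[of x y] e(2) xy by simp
    qed
  qed
qed

lemma verts_G: "verts G = wire V ` (V \<union> D)" by (simp add: wired_graph_def D_eq)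

lemma ends_G: "ends G e = wire V ` ends T e" by (simp add: wired_graph_def)

lemma mg_G: "multigraph G"
  unfolding multigraph_def
proof
  fix e assume "e \<in> edges G"
  then have e: "e \<in> E" by (simp add: edges_G)
  then obtain x y where xy: "ends T e = {x, y}" using card_ends inv(6) by (metis card_2_iff subsetD)
  have "card {wire V x, wire V y} \<in> {1, 2}" by (cases "wire V x = wire V y") auto
  then show "ends G e \<subseteq> verts G \<and> card (ends G e) \<in> {1, 2}"
    using inv(7)[OF e] xy by (auto simp: ends_G verts_G)
qed

lemma wire_eq: "x \<in> V \<union> D \<Longrightarrow> y \<in> V \<union> D \<Longrightarrow> wire V x = wire V y \<longleftrightarrow> x = y \<or> (x \<in> D \<and> y \<in> D)"
  using inv(4) by (auto simp: wire_def)

lemma wire_D: "x \<in> D \<Longrightarrow> wire V x = None" using inv(4) by (auto simp: wire_def)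

lemma joined_wire: "joined T F x y \<Longrightarrow> joined G F (wire V x) (wire V y)"
proof (induction rule: joined_induct)
  case (step x e z)
  then have "joined G F (wire V x) (wire V z)" by (intro joined_edge[of e]) (auto simp: ends_G)
  then show ?case using step.IH by (rule joined_trans)
qed simp

lemma ends_G_cases:
  assumes "e \<in> E" "ends G e = {a, b}"
  obtains x y where "ends T e = {x, y}" "wire V x = a" "wire V y = b" "x \<in> V \<union> D" "y \<in> V \<union> D"
proof -
  obtain x y where xy: "ends T e = {x, y}" using card_ends inv(6) assms(1) by (metis card_2_iff subsetD)
  then have "{wire V x, wire V y} = {a, b}" using assms(2) by (simp add: ends_G)
  then consider "wire V x = a" "wire V y = b" | "wire V x = b" "wire V y = a" by (auto simp: doubleton_eq_iff)
  moreover have "x \<in> V \<union> D" "y \<in> V \<union> D" using inv(7)[OF assms(1)] xy by auto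
  moreover have "ends T e = {y, x}" using xy by auto
  ultimately show ?thesis using that xy by metis
qed

text \<open>A path of the wired graph lifts to \<open>T\<close> except for jumps between boundary vertices.\<close>

lemma joined_G:
  assumes "F \<subseteq> E" "x \<in> V \<union> D" "y \<in> V \<union> D" "joined G F (wire V x) (wire V y)"
  shows "joined T F x y \<or> (\<exists>b\<in>D. \<exists>b'\<in>D. joined T F x b \<and> joined T F y b')"
proof -
  have "\<forall>x\<in>V\<union>D. wire V x = a \<longrightarrow> joined T F x y \<or> (\<exists>b\<in>D. \<exists>b'\<in>D. joined T F x b \<and> joined T F y b')"
    if "joined G F a (wire V y)" for a
    using that
  proof (induction rule: joined_induct)
    case refl
    show ?case
    proof (intro ballI impI)
      fix x assume "x \<in> V \<union> D" "wire V x = wire V y"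
      then have "x = y \<or> (x \<in> D \<and> y \<in> D)" using wire_eq assms(3) by blast
      then show "joined T F x y \<or> (\<exists>b\<in>D. \<exists>b'\<in>D. joined T F x b \<and> joined T F y b')"
        using joined_refl by metis
    qed
  next
    case (step a e c)
    obtain p r where pr: "ends T e = {p, r}" "wire V p = a" "wire V r = c" "p \<in> V \<union> D" "r \<in> V \<union> D"
      using ends_G_cases[OF _ step(2)] step(1) assms(1) by blast
    have j: "joined T F p r" using joined_edge[OF step(1) pr(1)] .
    have IH: "joined T F r y \<or> (\<exists>b\<in>D. \<exists>b'\<in>D. joined T F r b \<and> joined T F y b')"
      using step.IH pr by blast
    show ?case
    proof (intro ballI impI)
      fix x assume x: "x \<in> V \<union> D" "wire V x = a"
      then consider "x = p" | "x \<in> D" "p \<in> D" using wire_eq pr(2,4) by metis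
      then show "joined T F x y \<or> (\<exists>b\<in>D. \<exists>b'\<in>D. joined T F x b \<and> joined T F y b')"
      proof cases
        case 1
        then show ?thesis using IH j by (meson joined_trans)
      next
        case 2
        show ?thesis
        proof (cases "joined T F r y")
          case True
          then have "joined T F y p" using j joined_trans joined_sym by metis
          then show ?thesis using 2 joined_refl by metis
        next
          case False
          then show ?thesis using IH 2 joined_refl by metis
        qed
      qed
    qed
  qed
  then show ?thesis using assms by blast
qed

text \<open>If \<open>\<eta>\<close> joins two boundary vertices, the edge by which a joining path leaves the first of them is no
  bridge in the wired graph. Conversely, an edge of \<open>\<eta>\<close> is a bridge in \<open>T\<close>, so a detour around it in
  the wired graph must use two different boundary vertices, which the edge and the detour join.\<close>

lemma forest_G_iff: "forest G \<eta> \<longleftrightarrow> \<eta> \<subseteq> E \<and> separated T \<eta> D"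
proof
  assume f: "forest G \<eta>"
  then have sub: "\<eta> \<subseteq> E" and br: "\<And>e a b. e \<in> \<eta> \<Longrightarrow> ends G e = {a, b} \<Longrightarrow> \<not> joined G (\<eta> - {e}) a b"
    unfolding forest_iff_bridges[OF mg_G] edges_G by blast+
  have "separated T \<eta> D"
    unfolding separated_def
  proof (intro ballI impI, rule ccontr)
    fix x y assume xy: "x \<in> D" "y \<in> D" "joined T \<eta> x y" "x \<noteq> y"
    then obtain e z where e: "e \<in> \<eta>" "ends T e = {x, z}" "joined T (\<eta> - {e}) z y"
      using joined_leave by metis
    have "joined G (\<eta> - {e}) (wire V z) (wire V x)"
      using joined_wire[OF e(3)] wire_D xy(1,2) by simp
    moreover have "ends G e = {wire V z, wire V x}" using e(2) by (auto simp: ends_G)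
    ultimately show False using br[OF e(1)] by blast
  qed
  then show "\<eta> \<subseteq> E \<and> separated T \<eta> D" using sub by blast
next
  assume s: "\<eta> \<subseteq> E \<and> separated T \<eta> D"
  show "forest G \<eta>"
    unfolding forest_iff_bridges[OF mg_G] edges_G
  proof (intro conjI ballI allI impI notI)
    fix e a b assume e: "e \<in> \<eta>" "ends G e = {a, b}" "joined G (\<eta> - {e}) a b"
    obtain x y where xy: "ends T e = {x, y}" "wire V x = a" "wire V y = b" "x \<in> V \<union> D" "y \<in> V \<union> D"
      using ends_G_cases[OF _ e(2)] e(1) s by blast
    have eT: "e \<in> edges T" using e(1) s inv(6) by auto
    have nj: "\<not> joined T (\<eta> - {e}) x y"
      using s inv(6) by (intro not_joined_avoiding[OF eT xy(1)]) auto
    then obtain b b' where b: "b \<in> D" "b' \<in> D" "joined T (\<eta> - {e}) x b" "joined T (\<eta> - {e}) y b'"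
      using joined_G[of "\<eta> - {e}" x y] xy e(3) s by blast
    have m: "joined T \<eta> x b" "joined T \<eta> y b'" using joined_mono[OF b(3)] joined_mono[OF b(4)] by auto
    have "joined T \<eta> b b'"
      using joined_trans[OF joined_trans[OF joined_sym[OF m(1)] joined_edge[OF e(1) xy(1)]] m(2)] .
    then have "b = b'" using s b(1,2) unfolding separated_def by blast
    then show False using nj joined_trans[OF b(3)] joined_sym[OF b(4)] by blast
  qed (use s in simp)
qed

lemma card_V: "card (V \<union> D) = card V + card D"
  using inv(1,2,4) by (rule card_Un_disjoint)

lemma connected_G_iff:
  assumes "\<eta> \<subseteq> E"
  shows "connected_in G (verts G) \<eta> \<longleftrightarrow> (\<forall>v\<in>V\<union>D. \<exists>s\<in>D. joined T \<eta> v s)"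
proof
  obtain d where d: "d \<in> D" using inv(12) by blast
  have dv: "None \<in> verts G" using d wire_D[OF d] by (metis UnI2 imageI verts_G)
  assume c: "connected_in G (verts G) \<eta>"
  show "\<forall>v\<in>V\<union>D. \<exists>s\<in>D. joined T \<eta> v s"
  proof
    fix v assume v: "v \<in> V \<union> D"
    have "joined G {e\<in>\<eta>. ends G e \<subseteq> verts G} (wire V v) None"
      using v dv by (intro connected_in_joined[OF c]) (auto simp: verts_G)
    then have "joined G \<eta> (wire V v) (wire V d)" using wire_D[OF d] by (auto elim: joined_mono)
    then have "joined T \<eta> v d \<or> (\<exists>b\<in>D. \<exists>b'\<in>D. joined T \<eta> v b \<and> joined T \<eta> d b')"
      using assms v d by (intro joined_G) auto
    then show "\<exists>s\<in>D. joined T \<eta> v s" using d by blast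
  qed
next
  assume cov: "\<forall>v\<in>V\<union>D. \<exists>s\<in>D. joined T \<eta> v s"
  have toN: "joined G \<eta> a None" if "a \<in> verts G" for a
  proof -
    obtain x where x: "x \<in> V \<union> D" "a = wire V x" using \<open>a \<in> verts G\<close> by (auto simp: verts_G)
    obtain s where s: "s \<in> D" "joined T \<eta> x s" using cov x by blast
    show ?thesis using joined_wire[OF s(2)] wire_D[OF s(1)] x by simp
  qed
  show "connected_in G (verts G) \<eta>"
    unfolding connected_in_def
  proof (intro conjI ballI)
    show "verts G \<noteq> {}" using V_ne by (auto simp: verts_G)
    fix a b assume ab: "a \<in> verts G" "b \<in> verts G"
    have "joined G \<eta> a b" using joined_trans[OF toN[OF ab(1)] joined_sym[OF toN[OF ab(2)]]] .
    then show "(a, b) \<in> {(x, y). x \<in> verts G \<and> y \<in> verts G \<and> (\<exists>e\<in>\<eta>. ends G e = {x, y})}\<^sup>*"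
      using joined_imp_rtrancl_in[where F=\<eta> and a=a and G=G, OF _ subset_refl _ ab(2)] mg_G assms edges_G
      unfolding multigraph_def by blast
  qed simp
qed

lemma forest_card: "\<eta> \<subseteq> E \<Longrightarrow> separated T \<eta> D \<Longrightarrow> card \<eta> \<le> card V"
  using separated_card[OF win, of \<eta> D] by (simp add: card_V)

lemma spanning_tree_G_iff:
  "spanning_tree G \<eta> \<longleftrightarrow> \<eta> \<subseteq> E \<and> separated T \<eta> D \<and> card \<eta> = card V"
proof (cases "\<eta> \<subseteq> E \<and> separated T \<eta> D")
  case True
  then show ?thesis
    using separated_card[OF win, of \<eta> D] by (auto simp: spanning_tree_def forest_G_iff connected_G_iff card_V)
qed (auto simp: spanning_tree_def forest_G_iff)

lemma weight_one:
  "weight T q (\<lambda>_. 1) V D E (\<eta>, \<sigma>) =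
    (if \<eta> \<subseteq> E \<and> \<sigma> = D \<and> separated T \<eta> D then q ^ (card V - card \<eta>) else 0)"
proof (cases "\<sigma> = D")
  case True
  then show ?thesis by (simp add: weight_def boundary_weight_def card_V)
next
  case False
  then have "\<sigma> \<subseteq> D \<longrightarrow> (\<exists>b\<in>D. b \<notin> \<sigma>)" by blast
  then have "\<sigma> \<subseteq> D \<longrightarrow> boundary_weight q (\<lambda>_. 1) D \<sigma> = 0"
    unfolding boundary_weight_def using inv(2) by auto
  then show ?thesis using False by (auto simp: weight_def)
qed

end

context reg_tree begin

text \<open>One open edge from every explored vertex to one of its children.\<close>

lemma exists_spanning:
  "window T U D E \<Longrightarrow> \<exists>\<eta>\<subseteq>E. separated T \<eta> D \<and> card \<eta> = card U"
proof (induction rule: window.induct)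
  case (vertex v)
  show ?case by (auto simp: separated_def)
next
  case (edge e)
  have "joined T {} x y \<Longrightarrow> x = y" for x y by (auto elim: joined_cases)
  then show ?case by (intro exI[of _ "{}"]) (auto simp: separated_def)
next
  case (grow U D E w)
  interpret window_step T k U D E w using grow by unfold_locales auto
  obtain \<eta> where \<eta>: "\<eta> \<subseteq> E" "separated T \<eta> D" "card \<eta> = card U" using grow.IH by blast
  obtain c where c: "c \<in> C" using C_ne by blast
  have sub: "\<eta> \<subseteq> E" "{c} \<subseteq> C" "C \<subseteq> C" "D - {w} \<subseteq> D - {w}" using \<eta> c by auto
  have "{c} \<inter> C = {c}" using c by auto
  moreover have "D - {w} \<union> {w} = D" using w by auto
  ultimately have "separated T (\<eta> \<union> {c}) D'"
    unfolding separated_step[OF sub] using \<eta>(2) by simp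
  moreover have "card (\<eta> \<union> {c}) = card U'"
  proof -
    have "w \<notin> U" using inv(4) w by blast
    then show ?thesis using card_step(1)[OF sub] \<eta>(3) inv(1) by simp
  qed
  moreover have "\<eta> \<union> {c} \<subseteq> E'" using \<eta> c by auto
  ultimately show ?case by blast
qed

text \<open>In the wired graph all boundary vertices are joined to infinity, that is, \<open>u = 1\<close> and \<open>\<sigma> = D\<close>.\<close>

lemma gibbs_gas:
  assumes q: "q \<ge> 0" and win: "window T V D E" and ne: "V \<noteq> {}"
  shows "gibbs T q (\<lambda>_. 1) V D E (map_pmf (\<lambda>\<eta>. (\<eta>, D)) (gas q (wired_graph T V)))"
proof -
  interpret wired T k V D E using win ne by unfold_locales
  have finE: "finite E" by (rule inv(3))
  have pm: "pmf (map_pmf (\<lambda>\<eta>. (\<eta>, D)) p) (\<eta>, \<sigma>) = (if \<sigma> = D then pmf p \<eta> else 0)" for p \<eta> \<sigma>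
  proof (cases "\<sigma> = D")
    case True
    then show ?thesis using pmf_map_inj'[of "\<lambda>\<eta>. (\<eta>, D)" p \<eta>] by (simp add: inj_on_def)
  next
    case False then show ?thesis by (auto simp: pmf_eq_0_set_pmf)
  qed
  have "\<exists>z>0. \<forall>\<eta>. (if \<eta> \<subseteq> E \<and> separated T \<eta> D then q ^ (card V - card \<eta>) else 0) = z * pmf (gas q G) \<eta>"
  proof (cases "q = 0")
    case True
    let ?S = "{F. spanning_tree G F}"
    have "?S \<subseteq> Pow E" by (auto simp: spanning_tree_G_iff)
    then have fin: "finite ?S" using finE by (auto intro: finite_subset)
    have ne: "?S \<noteq> {}" using exists_spanning[OF win] by (auto simp: spanning_tree_G_iff)
    have "(if \<eta> \<subseteq> E \<and> separated T \<eta> D then q ^ (card V - card \<eta>) else 0) = real (card ?S) * pmf (gas q G) \<eta>" for \<eta>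
    proof -
      have "pmf (gas q G) \<eta> = indicator ?S \<eta> / card ?S"
        using pmf_of_set[OF ne fin] by (simp add: gas_def True uniform_spanning_tree_def)
      moreover have "card ?S \<noteq> 0" using fin ne by simp
      ultimately have "real (card ?S) * pmf (gas q G) \<eta> = indicator ?S \<eta>" by simp
      then show ?thesis using forest_card[of \<eta>] True
        by (auto simp: indicator_def spanning_tree_G_iff)
    qed
    moreover have "real (card ?S) > 0" using fin ne by (simp add: card_gt_0_iff)
    ultimately show ?thesis by blast
  next
    case False
    then have q0: "q > 0" using q by simp
    let ?Z = "\<Sum>\<eta>' | forest G \<eta>'. (1 / q) ^ card \<eta>'"
    have fin: "finite {\<eta>. forest G \<eta>}"
      by (rule finite_subset[of _ "Pow E"]) (use finE in \<open>auto simp: forest_G_iff\<close>)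
    have "{} \<in> {\<eta>. forest G \<eta>}"
      by (auto simp: forest_def is_cycle_def)
    then have Z: "?Z > 0" using fin q0 by (intro sum_pos) auto
    have "(if \<eta> \<subseteq> E \<and> separated T \<eta> D then q ^ (card V - card \<eta>) else 0) = (q ^ card V * ?Z) * pmf (gas q G) \<eta>" for \<eta>
    proof (cases "\<eta> \<subseteq> E \<and> separated T \<eta> D")
      case True
      then have "q ^ (card V - card \<eta>) = q ^ card V * (1 / q) ^ card \<eta>"
        using forest_card[of \<eta>] q0 by (simp add: power_diff power_one_over divide_inverse power_inverse)
      moreover have "pmf (gas q G) \<eta> = (1 / q) ^ card \<eta> / ?Z"
        using pmf_arboreal_gas[of G "1 / q" \<eta>] forest_G_iff[of \<eta>] True q0 finE False
        by (simp add: gas_def edges_G)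
      ultimately show ?thesis using True Z by simp
    next
      case nf: False
      then have "pmf (gas q G) \<eta> = 0"
        using pmf_arboreal_gas[of G "1 / q" \<eta>] q0 finE False by (auto simp: gas_def edges_G forest_G_iff)
      then show ?thesis using nf by auto
    qed
    moreover have "q ^ card V * ?Z > 0" using Z q0 by simp
    ultimately show ?thesis by blast
  qed
  then obtain z where z: "z > 0"
    "\<And>\<eta>. (if \<eta> \<subseteq> E \<and> separated T \<eta> D then q ^ (card V - card \<eta>) else 0) = z * pmf (gas q G) \<eta>"
    by blast
  have "weight T q (\<lambda>_. 1) V D E x = z * pmf (map_pmf (\<lambda>\<eta>. (\<eta>, D)) (gas q G)) x" for x
  proof (cases x)
    case (Pair \<eta> \<sigma>)
    then show ?thesis by (cases "\<sigma> = D") (simp_all add: weight_one pm flip: z(2))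
  qed
  then show ?thesis using z(1) unfolding gibbs_def by blast
qed

end


section \<open>Convergence in finite volume\<close>

text \<open>The vertices at distance less than \<open>r\<close> from \<open>b\<close> lie in \<open>V\<close>. The recursion follows the exploration.\<close>

fun ball_within :: "('v, 'e) multigraph \<Rightarrow> nat \<Rightarrow> 'v set \<Rightarrow> 'v \<Rightarrow> bool" where
  "ball_within T 0 V b \<longleftrightarrow> True"
| "ball_within T (Suc r) V b \<longleftrightarrow> b \<in> V \<and> (\<forall>e\<in>star T b. ball_within T r V (far_end T b e))"

locale gas_tree = reg_tree T k for T :: "('v, 'e) multigraph" and k +
  fixes q :: real
  assumes q: "q \<ge> 0"
begin

definition d :: real where "d = real (k - 1)"

lemma d: "d \<ge> 2" using k by (simp add: d_def)

text \<open>The recursion for the parameters if all \<open>k - 1\<close> children have the parameter \<open>x\<close>.\<close>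

definition h :: "real \<Rightarrow> real" where "h x = d * x / (1 + q + d * x)"

text \<open>The larger one of the fixed points 0 and \<open>1 - (1 + q) / d\<close> of \<open>h\<close>.\<close>

definition ustar :: real where "ustar = max 0 (1 - (1 + q) / d)"

lemma ustar: "0 \<le> ustar" "ustar \<le> 1"
  using d q by (auto simp: ustar_def)

lemma ustar_pos: assumes "q = 0" shows "ustar > 0"
proof -
  have "1 - (1 + q) / d > 0" using d assms by (simp add: field_simps)
  then show ?thesis unfolding ustar_def less_max_iff_disj by (rule disjI2)
qed

lemma gibbs_support:
  assumes "gibbs T q u U D E p" "x \<in> set_pmf p" shows "fst x \<subseteq> E" "snd x \<subseteq> D"
proof -
  obtain z where "z > 0" "weight T q u U D E x = z * pmf p x" using assms(1) unfolding gibbs_def by blast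
  then have "weight T q u U D E x \<noteq> 0" using assms(2) by (simp add: set_pmf_iff)
  then show "fst x \<subseteq> E" "snd x \<subseteq> D" using weight_pos_subset by blast+
qed

lemma ratio_mono: "0 \<le> s \<Longrightarrow> s \<le> t \<Longrightarrow> s / (1 + q + s) \<le> t / (1 + q + t)" for s t :: real
  using q mult_left_mono[of s t q] by (simp add: field_simps)

lemma h_ustar: "h ustar = ustar"
proof (cases "ustar = 0")
  case False
  then have u: "ustar = 1 - (1 + q) / d" by (auto simp: ustar_def max_def split: if_splits)
  then have "d * ustar = d - (1 + q)" using d by (simp add: field_simps)
  then have "h ustar = (d - (1 + q)) / d" by (simp add: h_def)
  then show ?thesis using d by (simp add: u field_simps)
qed (simp add: h_def)

lemma h_mono: "0 \<le> x \<Longrightarrow> x \<le> y \<Longrightarrow> h x \<le> h y"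
  using ratio_mono[of "d * x" "d * y"] d by (simp add: h_def)

text \<open>The iterates decrease and stay above \<open>ustar\<close>, so their limit is a fixed point that is at least
  \<open>ustar\<close>.\<close>

lemma h_iterates: "(\<lambda>r. (h ^^ r) 1) \<longlonglongrightarrow> ustar"
proof -
  let ?a = "\<lambda>r. (h ^^ r) 1"
  have lb: "ustar \<le> ?a r" for r
  proof (induction r)
    case (Suc r) then show ?case using h_mono[OF ustar(1), of "?a r"] h_ustar by simp
  qed (use ustar in simp)
  have h1: "h 1 \<le> 1" using d q by (simp add: h_def)
  have dec: "?a (Suc r) \<le> ?a r" for r
  proof (induction r)
    case (Suc r)
    have "0 \<le> ?a (Suc r)" using lb[of "Suc r"] ustar(1) by linarith
    then show ?case using h_mono[OF _ Suc] by simp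
  qed (use h1 in simp)
  have "decseq ?a" using dec by (rule decseq_SucI)
  then obtain L where L: "?a \<longlonglongrightarrow> L" using decseq_convergent[OF \<open>decseq ?a\<close>, of ustar] lb by metis
  have Lu: "ustar \<le> L" using L lb by (intro LIMSEQ_le_const[OF L]) blast
  then have L0: "0 \<le> L" using ustar by simp
  have pos: "1 + q + d * L > 0" using q d L0 by (simp add: add_pos_nonneg)
  have "isCont h L"
    unfolding h_def[abs_def] using pos by (intro continuous_intros) auto
  then have "(\<lambda>r. h (?a r)) \<longlonglongrightarrow> h L" using L by (rule isCont_tendsto_compose)
  moreover have "(\<lambda>r. h (?a r)) \<longlonglongrightarrow> L" using LIMSEQ_Suc[OF L] by simp
  ultimately have hL: "h L = L" by (rule LIMSEQ_unique)
  have "L \<le> ustar"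
  proof (cases "L = 0")
    case False
    then have "d * L = L * (1 + q + d * L)" using hL pos by (simp add: h_def field_simps)
    then have "L * d = L * (1 + q + d * L)" by (simp add: mult.commute)
    then have "d = 1 + q + d * L" using False by simp
    then have "L = 1 - (1 + q) / d" using d by (simp add: field_simps)
    then show ?thesis by (simp add: ustar_def)
  qed (use ustar in simp)
  then show ?thesis using L Lu by simp
qed

lemma crossing:
  assumes "window T U D E" "U \<noteq> {}" "U \<subseteq> V" "U \<noteq> V" "connected_in T V (edges T)"
  obtains w where "w \<in> D" "w \<in> V"
proof -
  obtain u v where uv: "u \<in> U" "v \<in> V" "v \<notin> U" using assms by blast
  have "(u, v) \<in> {(x, y). x \<in> V \<and> y \<in> V \<and> (\<exists>e\<in>edges T. ends T e = {x, y})}\<^sup>*"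
    using assms(5) uv assms(3) by (auto simp: connected_in_def)
  then have "u \<in> U \<longrightarrow> (\<exists>x y e. x \<in> U \<and> y \<in> V - U \<and> e \<in> edges T \<and> ends T e = {x, y})"
  proof (induction rule: converse_rtrancl_induct)
    case (step x y)
    then show ?case by blast
  qed (use uv in simp)
  then obtain x y e where *: "x \<in> U" "y \<in> V - U" "e \<in> edges T" "ends T e = {x, y}" using uv by blast
  then have "e \<in> E" using window_invariants(9)[OF assms(1) *(1)] by (auto simp: star_def)
  then have "y \<in> D" using window_invariants(7)[OF assms(1), of e] * by auto
  then show ?thesis using that * by blast
qed

lemma exists_window:
  assumes "finite V" "connected_in T V (edges T)"
  obtains D E where "window T V D E"
proof -
  have grow: "\<exists>D E. window T V D E" if "window T U D E" "U \<noteq> {}" "U \<subseteq> V" for U D E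
    using that
  proof (induction "card (V - U)" arbitrary: U D E rule: less_induct)
    case less
    show ?case
    proof (cases "U = V")
      case False
      then obtain w where w: "w \<in> D" "w \<in> V" using crossing[OF less.prems(1,2,3)] assms(2) by blast
      have "w \<notin> U" using window_invariants(4)[OF less.prems(1)] w by blast
      then have "card (V - insert w U) < card (V - U)" using w assms(1) by (intro psubset_card_mono) auto
      then show ?thesis using less.hyps window.grow[OF less.prems(1) w(1)] less.prems(3) w(2) by blast
    qed (use less.prems in blast)
  qed
  obtain v where v: "v \<in> V" using assms(2) by (auto simp: connected_in_def)
  then have "v \<in> verts T" using assms(2) by (auto simp: connected_in_def)
  from window.grow[OF window.vertex[OF this], of v] have "\<exists>D E. window T {v} D E" by auto
  then show ?thesis using grow v that by blast
qed

text \<open>The vertices of \<open>V\<close> outside \<open>U\<close> are removed one by one, starting from the parameters 1 at the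
  boundary of \<open>V\<close>. As the recursion is increasing and \<open>ustar\<close> is a fixed point, all parameters stay
  above \<open>ustar\<close>; and if \<open>V\<close> contains a ball of radius \<open>r\<close> around \<open>b\<close>, the value at \<open>b\<close> is at most
  that of \<open>r\<close> steps started from 1. Each removal preserves the marginal, since the kernel only adds
  new edges.\<close>

lemma finite_volume_marginal:
  assumes winV: "window T V DV EV" and fV: "finite V" and cV: "connected_in T V (edges T)"
    and "window T U D E" "U \<noteq> {}" "U \<subseteq> V"
  shows "\<exists>u. (\<forall>b\<in>D. ustar \<le> u b \<and> u b \<le> 1 \<and> (\<forall>r. ball_within T r V b \<longrightarrow> u b \<le> (h ^^ r) 1)) \<and>
    (\<forall>p. gibbs T q u U D E p \<longrightarrow> (\<exists>p'. gibbs T q (\<lambda>_. 1) V DV EV p' \<and>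
      map_pmf (\<lambda>x. fst x \<inter> E) p' = map_pmf fst p))"
  using assms(4-6)
proof (induction "card (V - U)" arbitrary: U D E rule: less_induct)
  case less
  show ?case
  proof (cases "U = V")
    case True
    have DE: "D = DV" "E = EV"
      using window_boundary[OF less.prems(1,2)] window_boundary[OF winV] window_edges[OF less.prems(1,2)]
        window_edges[OF winV] less.prems(2) True by simp_all
    show ?thesis
    proof (intro exI[of _ "\<lambda>_. 1"] conjI ballI allI impI)
      fix b r assume b: "b \<in> D" "ball_within T r V b"
      have "b \<notin> V" using window_invariants(4)[OF less.prems(1)] b True by blast
      then have "r = 0" using b(2) by (cases r) auto
      then show "1 \<le> (h ^^ r) 1" by simp
    next
      fix p assume g: "gibbs T q (\<lambda>_. 1) U D E p"
      have "fst x \<subseteq> E" if "x \<in> set_pmf p" for x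
        using gibbs_support(1)[OF g that] .
      then have "map_pmf (\<lambda>x. fst x \<inter> E) p = map_pmf fst p" by (intro map_pmf_cong refl) auto
      then show "\<exists>p'. gibbs T q (\<lambda>_. 1) V DV EV p' \<and> map_pmf (\<lambda>x. fst x \<inter> E) p' = map_pmf fst p"
        using g True DE by blast
    qed (use ustar in simp_all)
  next
    case False
    obtain w where wD: "w \<in> D" and wV: "w \<in> V" using crossing[OF less.prems False cV] .
    interpret window_step T k U D E w using less.prems(1) wD by unfold_locales
    have "w \<notin> U" using inv(4) wD by blast
    then have card: "card (V - U') < card (V - U)" using wV fV by (intro psubset_card_mono) auto
    have sub: "U' \<subseteq> V" using less.prems(3) wV by simp
    from less.hyps[OF card win' insert_not_empty sub] obtain u' where
      IH: "(\<forall>b\<in>D'. ustar \<le> u' b \<and> u' b \<le> 1 \<and> (\<forall>r. ball_within T r V b \<longrightarrow> u' b \<le> (h ^^ r) 1)) \<and>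
        (\<forall>p. gibbs T q u' U' D' E' p \<longrightarrow> (\<exists>p'. gibbs T q (\<lambda>_. 1) V DV EV p' \<and>
          map_pmf (\<lambda>x. fst x \<inter> E') p' = map_pmf fst p))" ..
    have u': "ustar \<le> u' b \<and> u' b \<le> 1 \<and> (\<forall>r. ball_within T r V b \<longrightarrow> u' b \<le> (h ^^ r) 1)" if "b \<in> D'" for b
      using conjunct1[OF IH] that by (rule bspec)
    have marg: "\<exists>p'. gibbs T q (\<lambda>_. 1) V DV EV p' \<and> map_pmf (\<lambda>x. fst x \<inter> E') p' = map_pmf fst p"
      if "gibbs T q u' U' D' E' p" for p
      using conjunct2[OF IH] that by blast
    define s where "s = (\<Sum>c\<in>C. u' (ch c))"
    define u where "u = u'(w := s / (1 + q + s))"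
    have u'c: "ustar \<le> u' (ch c)" "u' (ch c) \<le> 1" if "c \<in> C" for c using u'[of "ch c"] that by auto
    have cC: "real (card C) = d" using card_C less.prems(2) by (simp add: d_def)
    have s_ub: "s \<le> d * y" if "\<And>c. c \<in> C \<Longrightarrow> u' (ch c) \<le> y" for y
      using sum_bounded_above[of C "\<lambda>c. u' (ch c)" y] that cC by (simp add: s_def)
    have s_lb: "d * ustar \<le> s"
      using sum_bounded_below[of C ustar "\<lambda>c. u' (ch c)"] u'c cC by (simp add: s_def)
    have s0: "0 \<le> s" using s_lb d ustar(1) by (meson mult_nonneg_nonneg order_trans zero_le_numeral)
    have uw: "ustar \<le> u w" "u w \<le> 1"
    proof -
      have "0 \<le> d * ustar" using d ustar(1) by simp
      then show "ustar \<le> u w" using ratio_mono[OF _ s_lb] h_ustar by (simp add: u_def h_def)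
      show "u w \<le> 1" using s0 q by (simp add: u_def)
    qed
    have uwr: "u w \<le> (h ^^ r) 1" if "ball_within T r V w" for r
    proof (cases r)
      case 0 then show ?thesis using uw by simp
    next
      case (Suc r')
      have "u' (ch c) \<le> (h ^^ r') 1" if c: "c \<in> C" for c
        using \<open>ball_within T r V w\<close> c u'[of "ch c"] by (auto simp: Suc)
      then have "s \<le> d * (h ^^ r') 1" by (rule s_ub)
      then show ?thesis using ratio_mono[OF s0] by (simp add: u_def Suc h_def)
    qed
    have ub: "u b = u' b" "b \<in> D'" if "b \<in> D - {w}" for b using that by (auto simp: u_def)
    show ?thesis
    proof (intro exI[of _ u] conjI ballI allI impI)
      fix b assume "b \<in> D"
      then show "ustar \<le> u b" "u b \<le> 1" using uw ub[of b] u'[of b] by (cases "b = w"; auto)+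
    next
      fix b r assume "b \<in> D" "ball_within T r V b"
      then show "u b \<le> (h ^^ r) 1" using uwr ub[of b] u'[of b] by (cases "b = w") auto
    next
      fix p assume g: "gibbs T q u U D E p"
      have "gibbs T q u' U' D' E' (bind_pmf p (step_pmf q u'))"
        using q u'c ustar(1) ub(1) g by (intro gibbs_step) (auto simp: u_def s_def intro: order_trans)
      then obtain p' where p': "gibbs T q (\<lambda>_. 1) V DV EV p'"
        "map_pmf (\<lambda>x. fst x \<inter> E') p' = map_pmf fst (bind_pmf p (step_pmf q u'))" using marg by blast
      have "map_pmf (\<lambda>x. fst x \<inter> E) p' = map_pmf (\<lambda>\<eta>. \<eta> \<inter> E) (map_pmf (\<lambda>x. fst x \<inter> E') p')"
        unfolding map_pmf_comp by (intro map_pmf_cong refl) auto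
      also have "\<dots> = bind_pmf p (\<lambda>x. map_pmf (\<lambda>y. fst y \<inter> E) (step_pmf q u' x))"
        unfolding p'(2) by (simp add: map_bind_pmf map_pmf_comp)
      also have "\<dots> = bind_pmf p (\<lambda>x. return_pmf (fst x))"
      proof (intro bind_pmf_cong refl)
        fix x assume "x \<in> set_pmf p"
        then have x: "fst x \<subseteq> E" by (rule gibbs_support(1)[OF g])
        interpret star_params q "\<lambda>c. u' (ch c)" C
          using q finite_C C_ne u'c ustar(1) by unfold_locales (auto intro: order_trans)
        have "map_pmf (\<lambda>y. fst y \<inter> E) (step_pmf q u' x) =
          map_pmf (\<lambda>_. fst x) (star_pmf q (\<lambda>c. u' (ch c)) C (w \<in> snd x))"
          unfolding step_pmf_def map_pmf_comp
          using x set_star_pmf(1)[of _ _ "w \<in> snd x"] by (intro map_pmf_cong refl) (auto; blast)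
        then show "map_pmf (\<lambda>y. fst y \<inter> E) (step_pmf q u' x) = return_pmf (fst x)" by simp
      qed
      also have "\<dots> = map_pmf fst p" by (simp add: map_pmf_def)
      finally show "\<exists>p'. gibbs T q (\<lambda>_. 1) V DV EV p' \<and> map_pmf (\<lambda>x. fst x \<inter> E) p' = map_pmf fst p"
        using p'(1) by blast
    qed
  qed
qed

lemma finite_states: "window T U D E \<Longrightarrow> finite (Pow E \<times> Pow D)"
  using window_invariants(2,3) by blast

lemma weight_support: "weight T q u U D E x \<noteq> 0 \<Longrightarrow> x \<in> Pow E \<times> Pow D"
  using weight_pos_subset[of q u U D E x] by (auto simp: mem_Times_iff)

lemma gibbs_pmf_eq:
  assumes "window T U D E" "gibbs T q u U D E p"
  shows "sum (weight T q u U D E) (Pow E \<times> Pow D) > 0"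
    "pmf p x = weight T q u U D E x / sum (weight T q u U D E) (Pow E \<times> Pow D)"
proof -
  let ?B = "Pow E \<times> Pow D"
  obtain z where z: "z > 0" "\<And>x. weight T q u U D E x = z * pmf p x" using assms(2) by (auto simp: gibbs_def)
  have "set_pmf p \<subseteq> ?B"
  proof
    fix x assume "x \<in> set_pmf p"
    then have "weight T q u U D E x \<noteq> 0" using z by (simp add: set_pmf_iff)
    then show "x \<in> ?B" by (rule weight_support)
  qed
  then have "sum (pmf p) ?B = 1" by (intro sum_pmf_eq_1 finite_states[OF assms(1)])
  then have "sum (weight T q u U D E) ?B = z" by (simp add: z(2) flip: sum_distrib_left)
  then show "sum (weight T q u U D E) ?B > 0" "pmf p x = weight T q u U D E x / sum (weight T q u U D E) ?B"
    using z by simp_all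
qed

lemma gibbs_unique:
  assumes "window T U D E" "gibbs T q u U D E p" "gibbs T q u U D E p'" shows "p = p'"
  using gibbs_pmf_eq(2)[OF assms(1,2)] gibbs_pmf_eq(2)[OF assms(1,3)] by (intro pmf_eqI) simp

lemma gibbs_exists:
  assumes win: "window T U D E" and pos: "sum (weight T q u U D E) (Pow E \<times> Pow D) > 0"
    and u: "\<And>b. b \<in> D \<Longrightarrow> 0 \<le> u b \<and> u b \<le> 1"
  shows "\<exists>p. gibbs T q u U D E p"
proof -
  let ?B = "Pow E \<times> Pow D" let ?W = "weight T q u U D E"
  let ?f = "\<lambda>x. ?W x / sum ?W ?B"
  have fin: "finite ?B" using finite_states[OF win] .
  have "boundary_weight q u D \<sigma> \<ge> 0" for \<sigma>
    unfolding boundary_weight_def using u q by (intro prod_nonneg) auto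
  then have "?W x \<ge> 0" for x using q by (auto simp: weight_def)
  then have nn: "?f x \<ge> 0" for x using pos by simp
  have "?W x = 0" if "x \<notin> ?B" for x using weight_support that by blast
  then have "(\<integral>\<^sup>+ x. ennreal (?f x) \<partial>count_space UNIV) = (\<Sum>x\<in>?B. ennreal (?f x))"
    by (intro nn_integral_count_space'[OF fin]) simp_all
  also have "\<dots> = ennreal (\<Sum>x\<in>?B. ?f x)" using nn by (intro sum_ennreal) blast
  also have "(\<Sum>x\<in>?B. ?f x) = 1" using pos by (simp flip: sum_divide_distrib)
  finally have "pmf (embed_pmf ?f) x = ?f x" for x using nn by (intro pmf_embed_pmf) auto
  then have "gibbs T q u U D E (embed_pmf ?f)"
    unfolding gibbs_def using pos by (intro exI[of _ "sum ?W ?B"]) simp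
  then show ?thesis by blast
qed

lemma eventually_within:
  assumes "exhaustion T V" "b \<in> verts T"
  shows "eventually (\<lambda>n. ball_within T r (V n) b) sequentially"
  using assms(2)
proof (induction r arbitrary: b)
  case (Suc r)
  have "\<exists>m. b \<in> V m" using assms(1) Suc.prems unfolding exhaustion_def by blast
  then obtain m where "b \<in> V m" by blast
  then have "\<forall>n\<ge>m. b \<in> V n" using assms(1) unfolding exhaustion_def incseq_def by blast
  then have 1: "eventually (\<lambda>n. b \<in> V n) sequentially" by (auto simp: eventually_sequentially)
  have "eventually (\<lambda>n. \<forall>e\<in>star T b. ball_within T r (V n) (far_end T b e)) sequentially"
    using finite_star[OF Suc.prems] Suc.IH ends_far_end(3) by (intro eventually_ball_finite) auto
  then show ?case using 1 by eventually_elim simp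
qed simp

lemma eventually_subset:
  assumes "exhaustion T V" "finite U" "U \<subseteq> verts T"
  shows "eventually (\<lambda>n. U \<subseteq> V n) sequentially"
proof -
  have "eventually (\<lambda>n. \<forall>b\<in>U. b \<in> V n) sequentially"
    using assms(2)
  proof (rule eventually_ball_finite, intro ballI)
    fix b assume "b \<in> U"
    then have "eventually (\<lambda>n. ball_within T (Suc 0) (V n) b) sequentially" using assms by (intro eventually_within) auto
    then show "eventually (\<lambda>n. b \<in> V n) sequentially" by eventually_elim simp
  qed
  then show ?thesis by eventually_elim blast
qed

text \<open>For a fixed window the finite-volume parameters converge to \<open>ustar\<close>, and Gibbs probabilities are
  continuous in the parameters.\<close>

lemma gas_converges:
  assumes win: "window T U D E" and ne: "U \<noteq> {}" and g: "gibbs T q (\<lambda>_. ustar) U D E p"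
    and ex: "exhaustion T V" and J: "J \<subseteq> E"
  shows "(\<lambda>n. measure_pmf.prob (gas q (wired_graph T (V n))) {\<eta>. \<eta> \<inter> J \<in> A})
    \<longlonglongrightarrow> measure_pmf.prob p {x. fst x \<inter> J \<in> A}"
proof -
  note inv = window_invariants[OF win]
  let ?B = "Pow E \<times> Pow D"
  have finB: "finite ?B" using finite_states[OF win] .
  \<comment> \<open>\<open>good n u\<close>: the parameters \<open>u\<close> describe the marginal of the \<open>n\<close>-th finite-volume law on the window.\<close>
  define good where "good n u \<longleftrightarrow> (\<forall>b\<in>D. ustar \<le> u b \<and> u b \<le> 1 \<and> (\<forall>r. ball_within T r (V n) b \<longrightarrow> u b \<le> (h ^^ r) 1)) \<and>
    (\<forall>p. gibbs T q u U D E p \<longrightarrow>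
      measure_pmf.prob (gas q (wired_graph T (V n))) {\<eta>. \<eta> \<inter> J \<in> A} = measure_pmf.prob p {x. fst x \<inter> J \<in> A})" for n u
  have ex_good: "\<exists>u. good n u" if sub: "U \<subseteq> V n" for n
  proof -
    have fV: "finite (V n)" and cV: "connected_in T (V n) (edges T)" using ex by (auto simp: exhaustion_def)
    have Vne: "V n \<noteq> {}" using sub ne by blast
    obtain DV EV where winV: "window T (V n) DV EV" using exists_window[OF fV cV] .
    obtain u where u: "\<forall>b\<in>D. ustar \<le> u b \<and> u b \<le> 1 \<and> (\<forall>r. ball_within T r (V n) b \<longrightarrow> u b \<le> (h ^^ r) 1)"
      "\<And>p. gibbs T q u U D E p \<Longrightarrow> (\<exists>p'. gibbs T q (\<lambda>_. 1) (V n) DV EV p' \<and>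
      map_pmf (\<lambda>x. fst x \<inter> E) p' = map_pmf fst p)"
      using finite_volume_marginal[OF winV fV cV win ne sub] by blast
    have "measure_pmf.prob (gas q (wired_graph T (V n))) {\<eta>. \<eta> \<inter> J \<in> A} = measure_pmf.prob p {x. fst x \<inter> J \<in> A}"
      if gp: "gibbs T q u U D E p" for p
    proof -
      obtain p' where p': "gibbs T q (\<lambda>_. 1) (V n) DV EV p'" "map_pmf (\<lambda>x. fst x \<inter> E) p' = map_pmf fst p"
        using u(2)[OF gp] by blast
      have p'_eq: "p' = map_pmf (\<lambda>\<eta>. (\<eta>, DV)) (gas q (wired_graph T (V n)))"
        using gibbs_unique[OF winV p'(1) gibbs_gas[OF q winV Vne]] .
      have "measure_pmf.prob p {x. fst x \<inter> J \<in> A} = measure_pmf.prob (map_pmf fst p) {\<eta>. \<eta> \<inter> J \<in> A}"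
        by (simp add: vimage_def)
      also have "\<dots> = measure_pmf.prob (gas q (wired_graph T (V n))) {\<eta>. \<eta> \<inter> E \<inter> J \<in> A}"
        unfolding p'(2)[symmetric] p'_eq by (simp add: vimage_def map_pmf_comp)
      also have "{\<eta>. \<eta> \<inter> E \<inter> J \<in> A} = {\<eta>. \<eta> \<inter> J \<in> A}"
        using J by (simp add: Int_assoc Int_absorb1)
      finally show ?thesis by simp
    qed
    then show ?thesis using u(1) unfolding good_def by blast
  qed
  define u where "u n = (SOME u. good n u)" for n
  have evU: "eventually (\<lambda>n. U \<subseteq> V n) sequentially" using inv(1,5) by (intro eventually_subset[OF ex]) auto
  then have ev_good: "eventually (\<lambda>n. good n (u n)) sequentially"
    by eventually_elim (simp add: u_def someI_ex[OF ex_good])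
  have u_lim: "(\<lambda>n. u n b) \<longlonglongrightarrow> ustar" if b: "b \<in> D" for b
  proof (rule order_tendstoI)
    fix a assume a: "a < ustar"
    show "eventually (\<lambda>n. a < u n b) sequentially"
      using ev_good by eventually_elim (use a b in \<open>auto simp: good_def intro: less_le_trans\<close>)
  next
    fix a assume a: "ustar < a"
    then have "eventually (\<lambda>r. (h ^^ r) 1 < a) sequentially" using order_tendstoD(2)[OF h_iterates] by blast
    then obtain r where r: "(h ^^ r) 1 < a" by (auto simp: eventually_sequentially)
    have "eventually (\<lambda>n. ball_within T r (V n) b) sequentially" using b inv(5) by (intro eventually_within[OF ex]) auto
    then show "eventually (\<lambda>n. u n b < a) sequentially"
      using ev_good by eventually_elim (use r b in \<open>auto simp: good_def intro: le_less_trans\<close>)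
  qed
  let ?W = "\<lambda>n. weight T q (u n) U D E" let ?Ws = "weight T q (\<lambda>_. ustar) U D E"
  have W_lim: "(\<lambda>n. ?W n x) \<longlonglongrightarrow> ?Ws x" for x
  proof -
    have bw: "(\<lambda>n. boundary_weight q (u n) D \<sigma>) \<longlonglongrightarrow> boundary_weight q (\<lambda>_. ustar) D \<sigma>" for \<sigma>
      unfolding boundary_weight_def
    proof (rule tendsto_prod)
      fix b assume b: "b \<in> D"
      show "(\<lambda>n. if b \<in> \<sigma> then u n b else (1 - u n b) / (1 + q)) \<longlonglongrightarrow> (if b \<in> \<sigma> then ustar else (1 - ustar) / (1 + q))"
        using u_lim[OF b] q by (auto intro!: tendsto_intros)
    qed
    show ?thesis
    proof (cases "fst x \<subseteq> E \<and> snd x \<subseteq> D \<and> separated T (fst x) (snd x)")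
      case True
      show ?thesis unfolding weight_def if_P[OF True] by (intro tendsto_mult tendsto_const bw)
    next
      case False
      show ?thesis unfolding weight_def if_not_P[OF False] by (rule tendsto_const)
    qed
  qed
  have Z_lim: "(\<lambda>n. sum (?W n) ?B) \<longlonglongrightarrow> sum ?Ws ?B" by (intro tendsto_sum W_lim)
  have Zpos: "sum ?Ws ?B > 0" using gibbs_pmf_eq(1)[OF win g] .
  then have ev_pos: "eventually (\<lambda>n. sum (?W n) ?B > 0) sequentially" using order_tendstoD(1)[OF Z_lim] by blast
  let ?B' = "{x \<in> ?B. fst x \<inter> J \<in> A}"
  have prob_eq: "measure_pmf.prob p {x. fst x \<inter> J \<in> A} = sum (weight T q u U D E) ?B' / sum (weight T q u U D E) ?B"
    if gp: "gibbs T q u U D E p" for u p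
  proof -
    have "set_pmf p \<subseteq> ?B"
    proof
      fix x assume "x \<in> set_pmf p"
      then have "weight T q u U D E x \<noteq> 0" using gibbs_pmf_eq(2)[OF win gp, of x] by (auto simp: set_pmf_iff)
      then show "x \<in> ?B" by (rule weight_support)
    qed
    then have "measure_pmf.prob p {x. fst x \<inter> J \<in> A} = measure_pmf.prob p ?B'"
      by (intro measure_prob_cong_0) (auto simp: set_pmf_iff)
    also have "\<dots> = sum (pmf p) ?B'" using finB by (intro measure_measure_pmf_finite) simp
    also have "\<dots> = sum (weight T q u U D E) ?B' / sum (weight T q u U D E) ?B"
      unfolding gibbs_pmf_eq(2)[OF win gp] by (simp add: sum_divide_distrib)
    finally show ?thesis .
  qed
  have "(\<lambda>n. sum (?W n) ?B' / sum (?W n) ?B) \<longlonglongrightarrow> sum ?Ws ?B' / sum ?Ws ?B"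
    using Zpos by (intro tendsto_divide tendsto_sum W_lim) simp
  then have lim: "(\<lambda>n. sum (?W n) ?B' / sum (?W n) ?B) \<longlonglongrightarrow> measure_pmf.prob p {x. fst x \<inter> J \<in> A}"
    by (simp only: prob_eq[OF g])
  have "eventually (\<lambda>n. sum (?W n) ?B' / sum (?W n) ?B =
    measure_pmf.prob (gas q (wired_graph T (V n))) {\<eta>. \<eta> \<inter> J \<in> A}) sequentially"
    using ev_good ev_pos
  proof eventually_elim
    case (elim n)
    have "0 \<le> u n b \<and> u n b \<le> 1" if "b \<in> D" for b
      using elim(1) that ustar(1) unfolding good_def by (meson order_trans)
    then obtain pn where pn: "gibbs T q (u n) U D E pn" using gibbs_exists[OF win elim(2)] by blast
    then show ?case using elim(1) prob_eq[OF pn] unfolding good_def by simp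
  qed
  then show ?thesis using lim by (rule Lim_transform_eventually[rotated])
qed

end


section \<open>Path measures of Markov chains\<close>

text \<open>The Ionescu-Tulcea theorem for kernels that depend on the last state only.\<close>

lemma markov_chain_path_measure:
  fixes p :: "nat \<Rightarrow> 's pmf" and K :: "nat \<Rightarrow> 's \<Rightarrow> 's pmf"
  assumes p: "\<And>n. p (Suc n) = bind_pmf (p n) (K n)"
  obtains M where "prob_space M" and "sets M = sets (\<Pi>\<^sub>M i\<in>(UNIV::nat set). count_space (UNIV::'s set))"
    and "\<And>n. distr M (count_space UNIV) (\<lambda>x. x n) = measure_pmf (p n)"
    and "AE x in M. \<forall>n. x (Suc n) \<in> set_pmf (K n (x n))"
proof -
  define P :: "nat \<Rightarrow> (nat \<Rightarrow> 's) \<Rightarrow> 's measure" where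
    "P n x = measure_pmf (case n of 0 \<Rightarrow> p 0 | Suc m \<Rightarrow> K m (x m))" for n x
  let ?M = "\<lambda>_::nat. count_space (UNIV::'s set)"
  have measP: "P n \<in> measurable (PiM {0..<n} ?M) (subprob_algebra (?M n))" for n
  proof (cases n)
    case 0
    then show ?thesis by (auto simp: P_def[abs_def] space_subprob_algebra intro!: measurable_const prob_space_imp_subprob_space measure_pmf.prob_space_axioms)
  next
    case (Suc m)
    have 1: "(\<lambda>x. x m) \<in> measurable (PiM {0..<n} ?M) (count_space UNIV)"
      using Suc by (intro measurable_component_singleton) auto
    have 2: "(\<lambda>s. measure_pmf (K m s)) \<in> measurable (count_space UNIV) (subprob_algebra (?M n))"
      by (auto simp: space_subprob_algebra intro: prob_space_imp_subprob_space measure_pmf.prob_space_axioms)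
    show ?thesis using measurable_compose[OF 1 2] by (simp add: P_def[abs_def] Suc)
  qed
  interpret IT: Ionescu_Tulcea P ?M
    by (rule Ionescu_Tulcea.intro[OF measP]) (simp add: P_def measure_pmf.prob_space_axioms)
  define u0 :: "nat \<Rightarrow> 's" where "u0 = (\<lambda>_. undefined)"
  define N where "N n = IT.C 0 n u0" for n
  have u0: "u0 \<in> space (PiM {0..<0} ?M)" by (simp add: u0_def space_PiM)
  have sN[measurable_cong]: "sets (N n) = sets (PiM {0..<n} ?M)" for n
    using IT.sets_C[OF u0, of n] by (simp add: N_def)
  have pN: "prob_space (N n)" for n
    using IT.prob_space_C[OF u0, of n] by (simp add: N_def)
  have spN: "space (N n) = space (PiM {0..<n} ?M)" for n using sN by (rule sets_eq_imp_space_eq)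
  have NSuc: "N (Suc n) = N n \<bind> IT.eP n" for n by (simp add: N_def)
  have neN: "space (N n) \<noteq> {}" for n using prob_space.not_empty[OF pN] .
  have meP: "IT.eP n \<in> measurable (N n) (subprob_algebra (PiM {0..<Suc n} ?M))" for n
    using IT.measurable_eP[of n] measurable_cong_sets[OF sN refl] by blast
  have comp: "(\<lambda>x. x i) \<in> measurable (PiM {0..<n} ?M) (count_space UNIV)" if "i < n" for i n
    using that by (intro measurable_component_singleton) auto
  have deP: "distr (IT.eP n x) (count_space UNIV) (\<lambda>x. x n) = P n x"
    if x: "x \<in> space (PiM {0..<n} ?M)" for n x
  proof -
    have upd: "fun_upd x n \<in> measurable (P n x) (PiM {0..<Suc n} ?M)"
      using x IT.sets_P[OF x] by (intro measurable_fun_upd[where J="{0..<n}"]) (auto simp: P_def)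
    have "distr (IT.eP n x) (count_space UNIV) (\<lambda>x. x n) = distr (P n x) (count_space UNIV) ((\<lambda>x. x n) \<circ> fun_upd x n)"
      unfolding IT.eP_def by (rule distr_distr[OF comp upd]) simp
    also have "\<dots> = P n x" by (simp add: comp_def P_def distr_id2)
    finally show ?thesis .
  qed
  have marg: "distr (N (Suc n)) (count_space UNIV) (\<lambda>x. x n) = measure_pmf (p n)" for n
  proof (induction n)
    case 0
    have "distr (N (Suc 0)) (count_space UNIV) (\<lambda>x. x 0) = N 0 \<bind> (\<lambda>x. distr (IT.eP 0 x) (count_space UNIV) (\<lambda>x. x 0))"
      unfolding NSuc by (rule distr_bind[OF meP neN comp]) simp
    also have "\<dots> = N 0 \<bind> (\<lambda>x. measure_pmf (p 0))"
      by (intro bind_cong refl) (simp add: deP spN, simp add: P_def)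
    also have "\<dots> = measure_pmf (p 0)"
      by (rule bind_const'[OF pN]) (rule prob_space_imp_subprob_space[OF measure_pmf.prob_space_axioms])
    finally show ?case .
  next
    case (Suc n)
    have "distr (N (Suc (Suc n))) (count_space UNIV) (\<lambda>x. x (Suc n)) =
        N (Suc n) \<bind> (\<lambda>x. distr (IT.eP (Suc n) x) (count_space UNIV) (\<lambda>x. x (Suc n)))"
      unfolding NSuc[of "Suc n"] by (rule distr_bind[OF meP neN comp]) simp
    also have "\<dots> = N (Suc n) \<bind> (\<lambda>x. measure_pmf (K n (x n)))"
      by (intro bind_cong refl) (simp add: deP spN, simp add: P_def)
    also have "\<dots> = distr (N (Suc n)) (count_space UNIV) (\<lambda>x. x n) \<bind> (\<lambda>s. measure_pmf (K n s))"
      by (rule bind_distr[symmetric, where K="count_space UNIV"])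
        (auto simp: space_subprob_algebra neN measurable_cong_sets[OF sN refl] comp intro: prob_space_imp_subprob_space measure_pmf.prob_space_axioms)
    also have "\<dots> = measure_pmf (p (Suc n))"
      by (simp add: Suc p measure_pmf_bind)
    finally show ?case .
  qed
  have distrN: "N n = distr IT.PF.lim (PiM {0..<n} ?M) (\<lambda>x. restrict x {0..<n})" for n
  proof -
    have a: "distr IT.PF.lim (PiM {0..<n} ?M) (\<lambda>x. restrict x {0..<n}) = IT.CI {0..<n}"
      by (rule IT.distr_lim) simp
    have le: "IT.up_to {0..<n} \<le> n" by (subst IT.up_to_iff) auto
    have ge: "n \<le> IT.up_to {0..<n}"
      using IT.up_to[of "{0..<n}"] by auto
    have e: "IT.up_to {0..<n} = n" using le ge by simp
    have "IT.CI {0..<n} = distr (N n) (PiM {0..<n} ?M) (\<lambda>x. restrict x {0..<n})"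
      by (simp only: IT.CI_def e N_def u0_def)
    also have "\<dots> = distr (N n) (N n) (\<lambda>x. x)"
      by (rule distr_cong) (auto simp: sN spN space_PiM PiE_restrict)
    finally show ?thesis using a by simp
  qed
  have restr: "(\<lambda>x. restrict x {0..<n}) \<in> measurable IT.PF.lim (PiM {0..<n} ?M)" for n
    by (rule measurable_restrict) (simp add: measurable_cong_sets[OF IT.PF.sets_lim refl])
  show ?thesis
  proof
    have "prob_space (N 0)" by (rule pN)
    then show "prob_space IT.PF.lim"
      unfolding distrN by (rule prob_space_distrD[OF restr])
    show "sets IT.PF.lim = sets (PiM UNIV ?M)" by simp
    show "distr IT.PF.lim (count_space UNIV) (\<lambda>x. x n) = measure_pmf (p n)" for n
    proof -
      have "measure_pmf (p n) = distr IT.PF.lim (count_space UNIV) ((\<lambda>x. x n) \<circ> (\<lambda>x. restrict x {0..<Suc n}))"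
        unfolding marg[symmetric] distrN by (rule distr_distr[OF comp restr]) simp
      then show ?thesis by (simp add: comp_def)
    qed
    have "AE x in IT.PF.lim. x (Suc n) \<in> set_pmf (K n (x n))" for n
    proof -
      \<comment> \<open>The state space may be uncountable, so the set of the pairs of consecutive states need not be
        measurable; the countable support of \<^term>\<open>p n\<close> makes it so.\<close>
      let ?Q = "\<lambda>x. \<exists>s\<in>set_pmf (p n). x n = s \<and> x (Suc n) \<in> set_pmf (K n s)"
      have c1: "(\<lambda>x. x n) \<in> measurable (PiM {0..<Suc (Suc n)} ?M) (count_space UNIV)"
        and c2: "(\<lambda>x. x (Suc n)) \<in> measurable (PiM {0..<Suc (Suc n)} ?M) (count_space UNIV)"
        by (intro comp; simp)+
      have "Measurable.pred (PiM {0..<Suc (Suc n)} ?M) (\<lambda>x. x n = s \<and> x (Suc n) \<in> set_pmf (K n s))" for s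
        by (intro pred_intros_logic(3) measurable_compose[OF c1] measurable_compose[OF c2]) auto
      then have "(\<Union>s\<in>set_pmf (p n). {x \<in> space (PiM {0..<Suc (Suc n)} ?M). x n = s \<and> x (Suc n) \<in> set_pmf (K n s)})
          \<in> sets (PiM {0..<Suc (Suc n)} ?M)"
        unfolding pred_def by (intro sets.countable_UN' countable_set_pmf) auto
      also have "(\<Union>s\<in>set_pmf (p n). {x \<in> space (PiM {0..<Suc (Suc n)} ?M). x n = s \<and> x (Suc n) \<in> set_pmf (K n s)})
          = {x \<in> space (PiM {0..<Suc (Suc n)} ?M). ?Q x}" by auto
      finally have meas: "Measurable.pred (PiM {0..<Suc (Suc n)} ?M) ?Q"
        unfolding pred_def .
      have "AE s in distr (N (Suc n)) (count_space UNIV) (\<lambda>x. x n). s \<in> set_pmf (p n)"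
        unfolding marg by (simp add: AE_measure_pmf_iff)
      then have AE_supp: "AE x in N (Suc n). x \<in> space (N (Suc n)) \<longrightarrow> x n \<in> set_pmf (p n)"
        by (subst (asm) AE_distr_iff) (auto simp: comp measurable_cong_sets[OF sN refl])
      have "AE x in N (Suc n). AE y in IT.eP (Suc n) x. ?Q y"
      proof (rule AE_mp[OF AE_supp], rule AE_I2, intro impI)
        fix x assume spx: "x \<in> space (N (Suc n))"
          and "x \<in> space (N (Suc n)) \<longrightarrow> x n \<in> set_pmf (p n)"
        then have sx: "x n \<in> set_pmf (p n)" by simp
        have x: "x \<in> space (PiM {0..<Suc n} ?M)" using spx by (simp only: spN)
        have upd: "fun_upd x (Suc n) \<in> measurable (P (Suc n) x) (PiM {0..<Suc (Suc n)} ?M)"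
          using x IT.sets_P[OF x] by (intro measurable_fun_upd[where J="{0..<Suc n}"]) (auto simp: P_def)
        show "AE y in IT.eP (Suc n) x. ?Q y"
          unfolding IT.eP_def
        proof (subst AE_distr_iff[OF upd])
          show "AE y in P (Suc n) x. ?Q (x(Suc n := y))"
            unfolding P_def using sx by (simp add: AE_measure_pmf_iff)
        qed (use meas in \<open>simp add: pred_def\<close>)
      qed
      then have "AE x in N (Suc (Suc n)). ?Q x"
        unfolding NSuc[of "Suc n"] by (subst AE_bind[OF meP meas])
      then have "AE x in IT.PF.lim. ?Q (restrict x {0..<Suc (Suc n)})"
        unfolding distrN by (subst (asm) AE_distr_iff[OF restr]) (use meas in auto)
      then show ?thesis by eventually_elim auto
    qed
    then show "AE x in IT.PF.lim. \<forall>n. x (Suc n) \<in> set_pmf (K n (x n))"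
      by (simp add: AE_all_countable)
  qed
qed


section \<open>Measures on configurations\<close>

lemma space_config [simp]: "space (config_space E) = (\<Pi>\<^sub>E e\<in>E. UNIV)"
  by (simp add: config_space_def space_PiM)

lemma cylinder_measurable:
  assumes "finite J" "J \<subseteq> E"
  shows "{\<omega> \<in> space (config_space E). {e \<in> J. \<omega> e} \<in> A} \<in> sets (config_space E)"
proof -
  have *: "{\<omega> \<in> space (config_space E). {e \<in> J. \<omega> e} \<in> A} =
    (\<Union>a\<in>A \<inter> Pow J. {\<omega> \<in> space (config_space E). \<forall>e\<in>J. \<omega> e = (e \<in> a)})"
    (is "?L = ?R")
  proof (intro equalityI subsetI)
    fix \<omega> assume "\<omega> \<in> ?L"
    then show "\<omega> \<in> ?R" by (intro UN_I[of "{e \<in> J. \<omega> e}"]) auto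
  next
    fix \<omega> assume "\<omega> \<in> ?R"
    then obtain a where a: "a \<in> A" "a \<subseteq> J" "\<omega> \<in> space (config_space E)" "\<forall>e\<in>J. \<omega> e = (e \<in> a)" by blast
    then have "{e \<in> J. \<omega> e} = a" by blast
    then show "\<omega> \<in> ?L" using a by simp
  qed
  have comp: "(\<lambda>\<omega>. \<omega> e) \<in> measurable (config_space E) (count_space UNIV)" if "e \<in> E" for e
    unfolding config_space_def using that by (rule measurable_component_singleton)
  have "{\<omega> \<in> space (config_space E). \<forall>e\<in>J. \<omega> e = (e \<in> a)} \<in> sets (config_space E)" for a
  proof (intro sets.sets_Collect_finite_All assms(1))
    fix e assume "e \<in> J"
    then have "(\<lambda>\<omega>. \<omega> e) \<in> measurable (config_space E) (count_space UNIV)" using assms(2) by (intro comp) auto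
    then show "{\<omega> \<in> space (config_space E). \<omega> e = (e \<in> a)} \<in> sets (config_space E)" by measurable
  qed
  then show ?thesis unfolding * using assms(1) by (intro sets.finite_UN) auto
qed

definition config_law :: "'e set \<Rightarrow> ('e \<Rightarrow> bool) measure \<Rightarrow> 'e set \<Rightarrow> 'e set set \<Rightarrow> real" where
  "config_law E \<mu> J A = measure \<mu> {\<omega> \<in> space (config_space E). {e \<in> J. \<omega> e} \<in> A}"

lemma config_measure_eqI:
  assumes "prob_space \<mu>" "prob_space \<nu>" "sets \<mu> = sets (config_space E)" "sets \<nu> = sets (config_space E)"
    and eq: "\<And>J A. finite J \<Longrightarrow> J \<subseteq> E \<Longrightarrow> A \<subseteq> Pow J \<Longrightarrow> config_law E \<mu> J A = config_law E \<nu> J A"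
  shows "\<mu> = \<nu>"
proof (rule measure_eqI_PiM_infinite)
  interpret \<mu>: prob_space \<mu> by fact
  interpret \<nu>: prob_space \<nu> by fact
  show "sets \<mu> = sets (Pi\<^sub>M E (\<lambda>_. count_space UNIV))" "sets \<nu> = sets (Pi\<^sub>M E (\<lambda>_. count_space UNIV))"
    using assms by (simp_all add: config_space_def)
  show "finite_measure \<mu>" by unfold_locales
  fix X :: "_ \<Rightarrow> bool set" and J assume J: "finite J" "J \<subseteq> E"
  let ?A = "{a \<in> Pow J. \<forall>e\<in>J. (e \<in> a) \<in> X e}"
  have "prod_emb E (\<lambda>_. count_space UNIV) J (Pi\<^sub>E J X) =
      {\<omega> \<in> space (config_space E). {e \<in> J. \<omega> e} \<in> ?A}"
    using J by (subst prod_emb_PiE) (auto simp: PiE_iff extensional_def split: if_splits)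
  moreover have "?A \<subseteq> Pow J" by blast
  ultimately show "emeasure \<mu> (prod_emb E (\<lambda>_. count_space UNIV) J (Pi\<^sub>E J X)) =
      emeasure \<nu> (prod_emb E (\<lambda>_. count_space UNIV) J (Pi\<^sub>E J X))"
    using eq[OF J, of ?A] unfolding config_law_def \<mu>.emeasure_eq_measure \<nu>.emeasure_eq_measure by simp
qed

definition monotone_coupling :: "'e set \<Rightarrow> (('e \<Rightarrow> bool) \<times> ('e \<Rightarrow> bool)) measure \<Rightarrow> bool" where
  "monotone_coupling E \<kappa> \<longleftrightarrow> prob_space \<kappa> \<and> sets \<kappa> = sets (config_space E \<Otimes>\<^sub>M config_space E) \<and>
     (AE (\<omega>1, \<omega>2) in \<kappa>. \<forall>e\<in>E. \<omega>1 e \<longrightarrow> \<omega>2 e)"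

text \<open>The states of the chain carry two configurations \<open>f\<close> and \<open>g\<close>, in which the edges of \<open>F n\<close> are
  settled from time \<open>n\<close> on; so the configurations converge along almost every path.\<close>

lemma chain_config_coupling:
  fixes p :: "nat \<Rightarrow> 's pmf" and f g :: "'s \<Rightarrow> 'e set"
  assumes p: "\<And>n. p (Suc n) = bind_pmf (p n) (K n)"
    and F: "\<And>n. finite (F n)" "\<And>n. F n \<subseteq> F (Suc n)" "(\<Union>n. F n) = E"
    and f: "\<And>n x y. y \<in> set_pmf (K n x) \<Longrightarrow> f y \<inter> F n = f x \<inter> F n"
    and g: "\<And>n x y. y \<in> set_pmf (K n x) \<Longrightarrow> g y \<inter> F n = g x \<inter> F n"
    and dom: "\<And>n x. x \<in> set_pmf (p n) \<Longrightarrow> f x \<inter> F n \<subseteq> g x"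
  obtains \<kappa> where "monotone_coupling E \<kappa>"
    "\<And>n J A. J \<subseteq> F n \<Longrightarrow> config_law E (distr \<kappa> (config_space E) fst) J A = measure_pmf.prob (p n) {x. f x \<inter> J \<in> A}"
    "\<And>n J A. J \<subseteq> F n \<Longrightarrow> config_law E (distr \<kappa> (config_space E) snd) J A = measure_pmf.prob (p n) {x. g x \<inter> J \<in> A}"
proof -
  obtain M where M: "prob_space M" and sM: "sets M = sets (\<Pi>\<^sub>M i\<in>(UNIV::nat set). count_space (UNIV::'s set))"
    and dM: "\<And>n. distr M (count_space UNIV) (\<lambda>x. x n) = measure_pmf (p n)"
    and aeM: "AE x in M. \<forall>n. x (Suc n) \<in> set_pmf (K n (x n))"
    by (rule markov_chain_path_measure[of p K, OF p]) blast
  interpret M: prob_space M by fact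
  have comp: "(\<lambda>x. x n) \<in> measurable M (count_space UNIV)" for n
    unfolding measurable_cong_sets[OF sM refl] by (intro measurable_component_singleton) auto
  define conf where "conf f x = (\<lambda>e\<in>E. \<exists>n. e \<in> F n \<and> e \<in> f (x n))" for f :: "'s \<Rightarrow> 'e set" and x :: "nat \<Rightarrow> 's"
  have conf_meas: "conf f \<in> measurable M (config_space E)" for f :: "'s \<Rightarrow> 'e set"
    unfolding conf_def[abs_def] config_space_def
  proof (rule measurable_restrict)
    fix e assume "e \<in> E"
    have "Measurable.pred M (\<lambda>x. e \<in> f (x n))" for n
      by (rule measurable_compose[OF comp]) simp
    then show "(\<lambda>x. \<exists>n. e \<in> F n \<and> e \<in> f (x n)) \<in> measurable M (count_space UNIV)"
      by (intro pred_intros_countable pred_intros_logic) auto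
  qed
  have Fmono: "F n \<subseteq> F m" if "n \<le> m" for n m using F(2) lift_Suc_mono_le[of F] that by blast
  have stable: "conf f x e \<longleftrightarrow> e \<in> f (x n)"
    if path: "\<And>n. x (Suc n) \<in> set_pmf (K n (x n))" and e: "e \<in> F n"
      and f: "\<And>n x y. y \<in> set_pmf (K n x) \<Longrightarrow> f y \<inter> F n = f x \<inter> F n" for f x e n
  proof -
    have up: "f (x m) \<inter> F n = f (x n) \<inter> F n" if "n \<le> m" for n m
      using that
    proof (induction m rule: dec_induct)
      case (step i)
      then have "f (x (Suc i)) \<inter> F n = f (x i) \<inter> F n" using f[OF path[of i]] Fmono[OF step(1)] by blast
      then show ?case using step by simp
    qed simp
    have same: "e \<in> f (x m) \<longleftrightarrow> e \<in> f (x n)" if "e \<in> F m" for m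
    proof (cases "n \<le> m")
      case True then show ?thesis using up[OF True] e by blast
    next
      case False then show ?thesis using up[of m n] that by auto
    qed
    have "(\<exists>m. e \<in> F m \<and> e \<in> f (x m)) \<longleftrightarrow> e \<in> f (x n)" using same e by (meson)
    moreover have "e \<in> E" using e F(3) by blast
    ultimately show ?thesis by (simp add: conf_def)
  qed
  \<comment> \<open>Almost surely the settled edges keep their states, so the configuration agrees with the state at
    time \<open>n\<close> on \<open>F n\<close>.\<close>
  have law: "config_law E (distr M (config_space E) (conf f)) J A = measure_pmf.prob (p n) {x. f x \<inter> J \<in> A}"
    if J: "J \<subseteq> F n" and f: "\<And>n x y. y \<in> set_pmf (K n x) \<Longrightarrow> f y \<inter> F n = f x \<inter> F n" for f J A n
  proof -
    have fJ: "finite J" "J \<subseteq> E" using finite_subset[OF J F(1)] J F(3) by auto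
    have vim: "conf f -` {\<omega> \<in> space (config_space E). {e \<in> J. \<omega> e} \<in> A} \<inter> space M = {x \<in> space M. {e\<in>J. conf f x e} \<in> A}" for A
      using measurable_space[OF conf_meas] by (auto simp del: space_config)
    have "config_law E (distr M (config_space E) (conf f)) J A = measure M {x \<in> space M. {e\<in>J. conf f x e} \<in> A}"
      unfolding config_law_def measure_distr[OF conf_meas cylinder_measurable[OF fJ]] vim ..
    also have "\<dots> = measure M {x \<in> space M. f (x n) \<inter> J \<in> A}"
    proof (rule measure_eq_AE)
      show "AE x in M. (x \<in> {x \<in> space M. {e\<in>J. conf f x e} \<in> A}) = (x \<in> {x \<in> space M. f (x n) \<inter> J \<in> A})"
        using aeM
      proof eventually_elim
        case (elim x)
        have "conf f x e \<longleftrightarrow> e \<in> f (x n)" if "e \<in> J" for e using that elim J f by (intro stable) auto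
        then have "{e\<in>J. conf f x e} = f (x n) \<inter> J" by auto
        then show ?case by simp
      qed
      show "{x \<in> space M. {e\<in>J. conf f x e} \<in> A} \<in> sets M"
        using measurable_sets[OF conf_meas[of f] cylinder_measurable[OF fJ, of A]] unfolding vim .
      have "Measurable.pred M (\<lambda>x. f (x n) \<inter> J \<in> A)" by (rule measurable_compose[OF comp]) simp
      then show "{x \<in> space M. f (x n) \<inter> J \<in> A} \<in> sets M" by (simp add: pred_def)
    qed
    also have "\<dots> = measure (distr M (count_space UNIV) (\<lambda>x. x n)) {s. f s \<inter> J \<in> A}"
      by (subst measure_distr[OF comp]) (auto intro!: arg_cong[where f="measure M"])
    finally show ?thesis by (simp add: dM)
  qed
  let ?c = "\<lambda>x. (conf f x, conf g x)"
  let ?\<kappa> = "distr M (config_space E \<Otimes>\<^sub>M config_space E) ?c"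
  have c_meas: "?c \<in> measurable M (config_space E \<Otimes>\<^sub>M config_space E)"
    using conf_meas by (intro measurable_Pair) auto
  have d1: "distr ?\<kappa> (config_space E) fst = distr M (config_space E) (conf f)"
    by (subst distr_distr[OF measurable_fst c_meas]) (simp add: comp_def)
  have d2: "distr ?\<kappa> (config_space E) snd = distr M (config_space E) (conf g)"
    by (subst distr_distr[OF measurable_snd c_meas]) (simp add: comp_def)
  have supp: "AE x in M. \<forall>n. x n \<in> set_pmf (p n)"
    unfolding AE_all_countable
  proof
    fix n
    have "AE s in distr M (count_space UNIV) (\<lambda>x. x n). s \<in> set_pmf (p n)"
      unfolding dM by (simp add: AE_measure_pmf_iff)
    then show "AE x in M. x n \<in> set_pmf (p n)" by (subst (asm) AE_distr_iff[OF comp]) auto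
  qed
  have ae: "AE x in M. \<forall>e\<in>E. conf f x e \<longrightarrow> conf g x e"
    using aeM supp
  proof eventually_elim
    case (elim x)
    show ?case
    proof (intro ballI impI)
      fix e assume e: "e \<in> E" "conf f x e"
      then obtain n where n: "e \<in> F n" "e \<in> f (x n)" by (auto simp: conf_def)
      then have "e \<in> g (x n)" using dom[of "x n" n] elim by blast
      then show "conf g x e" using e n by (auto simp: conf_def)
    qed
  qed
  show ?thesis
  proof
    have "countable E" using F(1) unfolding F(3)[symmetric] by (intro countable_UN) (auto intro: countable_finite)
    moreover have "AE z in ?\<kappa>. fst z e \<longrightarrow> snd z e" if e: "e \<in> E" for e
    proof (subst AE_distr_iff[OF c_meas])
      have coord: "(\<lambda>\<omega>. \<omega> e) \<in> measurable (config_space E) (count_space UNIV)"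
        unfolding config_space_def using e by (rule measurable_component_singleton)
      have "Measurable.pred (config_space E \<Otimes>\<^sub>M config_space E) (\<lambda>z. fst z e \<longrightarrow> snd z e)"
        by (intro pred_intros_logic measurable_compose[OF measurable_fst coord] measurable_compose[OF measurable_snd coord])
      then show "{z \<in> space (config_space E \<Otimes>\<^sub>M config_space E). fst z e \<longrightarrow> snd z e}
          \<in> sets (config_space E \<Otimes>\<^sub>M config_space E)" by (simp only: pred_def)
      show "AE x in M. fst (conf f x, conf g x) e \<longrightarrow> snd (conf f x, conf g x) e"
        using ae by eventually_elim (use e in simp)
    qed
    ultimately have "AE z in ?\<kappa>. \<forall>e\<in>E. fst z e \<longrightarrow> snd z e" by (subst AE_ball_countable) auto
    then show "monotone_coupling E ?\<kappa>"
      unfolding monotone_coupling_def using M.prob_space_distr[OF c_meas] by (simp add: case_prod_beta')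
    show "\<And>n J A. J \<subseteq> F n \<Longrightarrow> config_law E (distr ?\<kappa> (config_space E) fst) J A = measure_pmf.prob (p n) {x. f x \<inter> J \<in> A}"
      unfolding d1 by (rule law[OF _ f])
    show "\<And>n J A. J \<subseteq> F n \<Longrightarrow> config_law E (distr ?\<kappa> (config_space E) snd) J A = measure_pmf.prob (p n) {x. g x \<inter> J \<in> A}"
      unfolding d2 by (rule law[OF _ g])
  qed
qed


section \<open>Exploring the whole tree\<close>

lemma rel_nat_choice:
  assumes "P 0 x0" and "\<And>n x. P n x \<Longrightarrow> \<exists>y. P (Suc n) y \<and> Q n x y"
  obtains f where "f 0 = x0" "\<And>n. P n (f n)" "\<And>n. Q n (f n) (f (Suc n))"
proof -
  have "\<exists>f. \<forall>n. (P n (f n) \<and> (n = 0 \<longrightarrow> f n = x0)) \<and> Q n (f n) (f (Suc n))"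
    by (rule dependent_nat_choice) (use assms in auto)
  then show ?thesis using that by blast
qed

locale exploration = reg_tree T k for T :: "('v, 'e) multigraph" and k +
  fixes U D :: "nat \<Rightarrow> 'v set" and E :: "nat \<Rightarrow> 'e set" and w :: "nat \<Rightarrow> 'v"
  assumes win: "\<And>n. window T (U n) (D n) (E n)" and w: "\<And>n. w n \<in> D n"
    and U_Suc: "\<And>n. U (Suc n) = insert (w n) (U n)"
    and D_Suc: "\<And>n. D (Suc n) = D n - {w n} \<union> far_end T (w n) ` (star T (w n) - E n)"
    and E_Suc: "\<And>n. E (Suc n) = E n \<union> star T (w n)"
    and covers: "\<And>n v. v \<in> D n \<Longrightarrow> \<exists>m. v \<in> U m"
begin

lemma E_mono: "n \<le> m \<Longrightarrow> E n \<subseteq> E m"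
  by (rule lift_Suc_mono_le[of E]) (auto simp: E_Suc)

lemma U_ne: "n \<ge> 1 \<Longrightarrow> U n \<noteq> {}"
  by (cases n) (auto simp: U_Suc)

lemma verts_covered:
  assumes v: "v \<in> verts T" shows "\<exists>n. v \<in> U n"
proof -
  have w0: "w 0 \<in> U 1" by (simp add: U_Suc)
  have "connected_in T (verts T) (edges T)" using reg by (simp add: regular_tree_def spanning_tree_def)
  moreover have "w 0 \<in> verts T" using w[of 0] window_invariants(5)[OF win[of 0]] by blast
  ultimately have "joined T {e\<in>edges T. ends T e \<subseteq> verts T} v (w 0)"
    using v by (intro connected_in_joined)
  then show ?thesis
  proof (induction rule: joined_induct)
    case refl then show ?case using w0 by blast
  next
    case (step x e z)
    then obtain n where n: "z \<in> U n" by blast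
    have "e \<in> star T z" using step(1,2) by (auto simp: star_def)
    then have "e \<in> E n" using window_invariants(9)[OF win n] by blast
    then have "x \<in> U n \<union> D n" using window_invariants(7)[OF win[of n]] step(2) by blast
    then show ?case using covers by blast
  qed
qed

lemma edges_covered: "(\<Union>n. E n) = edges T"
proof
  show "(\<Union>n. E n) \<subseteq> edges T" using window_invariants(6)[OF win] by blast
  show "edges T \<subseteq> (\<Union>n. E n)"
  proof
    fix e assume e: "e \<in> edges T"
    then obtain x y where xy: "ends T e = {x, y}" using card_ends by (metis card_2_iff)
    then obtain n where "x \<in> U n" using verts_covered[of x] ends_verts[OF e] by auto
    then have "star T x \<subseteq> E n" by (rule window_invariants(9)[OF win])
    then show "e \<in> (\<Union>n. E n)" using e xy by (auto simp: star_def)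
  qed
qed

lemma finite_subset_E:
  assumes "finite J" "J \<subseteq> edges T" obtains n where "n \<ge> 1" "J \<subseteq> E n"
proof -
  have "\<exists>n. J \<subseteq> E n"
    using assms
  proof (induction J rule: finite_induct)
    case (insert e J)
    then obtain n where n: "J \<subseteq> E n" by auto
    obtain m where m: "e \<in> E m" using insert.prems edges_covered by blast
    show ?case using n m E_mono[of n "max n m"] E_mono[of m "max n m"] by (intro exI[of _ "max n m"]) auto
  qed simp
  then obtain n where n: "J \<subseteq> E n" by blast
  show ?thesis using that[of "Suc n"] n E_mono[of n "Suc n"] by auto
qed

lemma exhaustion: "exhaustion T (\<lambda>n. U n \<union> D n)"
  unfolding exhaustion_def
proof (intro conjI allI)
  have "U n \<union> D n \<subseteq> U (Suc n) \<union> D (Suc n)" for n by (auto simp: U_Suc D_Suc)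
  then show "incseq (\<lambda>n. U n \<union> D n)" by (rule incseq_SucI)
  show "finite (U n \<union> D n)" for n using window_invariants(1,2)[OF win[of n]] by simp
  show "connected_in T (U n \<union> D n) (edges T)" for n
    unfolding connected_in_def
  proof (intro conjI ballI)
    show "U n \<union> D n \<noteq> {}" using w by blast
    show "U n \<union> D n \<subseteq> verts T" using window_invariants(5)[OF win] .
    fix x y assume xy: "x \<in> U n \<union> D n" "y \<in> U n \<union> D n"
    have "joined T (E n) x y" using window_invariants(8)[OF win xy] .
    then show "(x, y) \<in> {(x, y). x \<in> U n \<union> D n \<and> y \<in> U n \<union> D n \<and> (\<exists>e\<in>edges T. ends T e = {x, y})}\<^sup>*"
      using joined_imp_rtrancl_in[where F="E n" and G=T and W="U n \<union> D n" and F'="edges T",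
        OF window_invariants(7,6)[OF win] _ xy(2)] by blast
  qed
  show "(\<Union>n. U n \<union> D n) = verts T"
    using window_invariants(5)[OF win] verts_covered by blast
qed

end

context reg_tree begin

text \<open>The boundary is kept as a first-in-first-out queue, by which every discovered vertex gets its
  turn.\<close>

lemma exists_exploration:
  assumes "window T U0 D0 E0"
  obtains U D E w where "exploration T k U D E w" "U 0 = U0" "D 0 = D0" "E 0 = E0"
proof -
  let ?P = "\<lambda>(Q, U, E). window T U (set Q) E \<and> distinct Q"
  let ?R = "\<lambda>(Q, U, E) (Q', U', E'). U' = insert (hd Q) U \<and> E' = E \<union> star T (hd Q) \<and>
    (\<exists>cs. Q' = tl Q @ cs \<and> set cs = far_end T (hd Q) ` (star T (hd Q) - E))"
  obtain Q0 where Q0: "set Q0 = D0" "distinct Q0"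
    using finite_distinct_list[OF window_invariants(2)[OF assms]] by blast
  have step: "\<exists>s'. ?P s' \<and> ?R s s'" if P: "?P s" for s
  proof -
    obtain Q U E where s: "s = (Q, U, E)" by (metis prod.exhaust)
    have win: "window T U (set Q) E" and dist: "distinct Q" using P s by auto
    have ne: "Q \<noteq> []" using window_invariants(12)[OF win] by auto
    interpret window_step T k U "set Q" E "hd Q" using win ne by unfold_locales auto
    obtain cs where cs: "set cs = ch ` C" "distinct cs" using finite_distinct_list[of "ch ` C"] finite_C by auto
    have Qeq: "set (tl Q) = set Q - {hd Q}" using ne dist by (cases Q) auto
    then have "window T U' (set (tl Q @ cs)) E'" using win' cs(1) by simp
    moreover have "distinct (tl Q @ cs)"
    proof -
      have "set (tl Q) \<inter> ch ` C = {}" using ch_fresh Qeq by blast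
      then show ?thesis using cs dist by (simp add: distinct_tl)
    qed
    ultimately show ?thesis using cs(1) by (intro exI[of _ "(tl Q @ cs, U', E')"]) (auto simp: s)
  qed
  have init: "?P (Q0, U0, E0)" using assms Q0 by simp
  obtain st where st0: "st 0 = (Q0, U0, E0)" and stP: "\<And>n. ?P (st n)" and stR: "\<And>n. ?R (st n) (st (Suc n))"
    using rel_nat_choice[of "\<lambda>_. ?P" "(Q0, U0, E0)" "\<lambda>_. ?R"] init step by blast
  define Q where "Q n = fst (st n)" for n
  define U where "U n = fst (snd (st n))" for n
  define E where "E n = snd (snd (st n))" for n
  have sn: "st n = (Q n, U n, E n)" for n by (simp add: Q_def U_def E_def)
  have win: "window T (U n) (set (Q n)) (E n)" and dist: "distinct (Q n)" for n using stP[of n] sn by auto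
  have ne: "Q n \<noteq> []" for n using window_invariants(12)[OF win[of n]] by auto
  have rel: "U (Suc n) = insert (hd (Q n)) (U n)" "E (Suc n) = E n \<union> star T (hd (Q n))"
    "\<exists>cs. Q (Suc n) = tl (Q n) @ cs \<and> set cs = far_end T (hd (Q n)) ` (star T (hd (Q n)) - E n)" for n
    using stR[of n] unfolding sn by auto
  have Q_Suc: "set (Q (Suc n)) = set (Q n) - {hd (Q n)} \<union> far_end T (hd (Q n)) ` (star T (hd (Q n)) - E n)" for n
  proof -
    have "set (tl (Q n)) = set (Q n) - {hd (Q n)}" using ne[of n] dist[of n] by (cases "Q n") auto
    then show ?thesis using rel(3)[of n] by auto
  qed
  \<comment> \<open>A vertex at position \<open>i\<close> of the queue is explored after \<open>i\<close> further steps.\<close>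
  have fair: "i < length (Q n) \<Longrightarrow> Q n ! i \<in> U (n + Suc i)" for i n
  proof (induction i arbitrary: n)
    case 0 then show ?case using rel(1)[of n] by (simp add: hd_conv_nth ne)
  next
    case (Suc i)
    obtain cs where cs: "Q (Suc n) = tl (Q n) @ cs" using rel(3)[of n] by blast
    have "i < length (tl (Q n))" using Suc.prems by simp
    then have "Q (Suc n) ! i = Q n ! Suc i" "i < length (Q (Suc n))" by (simp_all add: cs nth_append nth_tl)
    then show ?case using Suc.IH[of "Suc n"] by simp
  qed
  have "exploration T k U (\<lambda>n. set (Q n)) E (\<lambda>n. hd (Q n))"
  proof (unfold_locales, goal_cases)
    case (6 n v)
    then show ?case using fair by (metis in_set_conv_nth)
  qed (use win ne rel Q_Suc in auto)
  then show ?thesis using that[of U "\<lambda>n. set (Q n)" E] st0 sn[of 0] Q0 by simp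
qed

end


section \<open>The exploration chain and its monotone couplings\<close>

lemma pmf_map_pmf_of_list:
  assumes "pmf_of_list_wf xs"
  shows "pmf (map_pmf f (pmf_of_list xs)) y = sum_list (map snd (filter (\<lambda>z. f (fst z) = y) xs))"
  unfolding pmf_map measure_pmf_of_list[OF assms] by (simp add: vimage_def)

text \<open>For a uniform variable on \<open>[0, 1]\<close>, label \<open>i\<close> is open below \<open>p\<^sub>i = (1 - t\<^sub>i) / (1 + q\<^sub>i)\<close> and closed
  with a joined child above \<open>1 - t\<^sub>i\<close>. The atoms are the intervals between
  \<open>0 \<le> p\<^sub>1 \<le> p\<^sub>2 \<le> 1 - t\<^sub>2 \<le> 1 - t\<^sub>1 \<le> 1\<close>.\<close>

lemma exists_label_coupling:
  assumes "q1 \<ge> 0" "q2 \<ge> 0" "0 \<le> t1" "t1 \<le> t2" "t2 \<le> 1" "(1 - t1) / (1 + q1) \<le> (1 - t2) / (1 + q2)"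
  obtains lam where "map_pmf fst lam = label_pmf q1 t1" "map_pmf snd lam = label_pmf q2 t2"
    "\<And>a b. (a, b) \<in> set_pmf lam \<Longrightarrow> (a = Opn \<longrightarrow> b = Opn) \<and> (a = Cl1 \<longrightarrow> b = Cl1)"
proof -
  define p1 where "p1 = (1 - t1) / (1 + q1)"
  define p2 where "p2 = (1 - t2) / (1 + q2)"
  have c: "q1 * (1 - t1) / (1 + q1) = 1 - p1 - t1" "q2 * (1 - t2) / (1 + q2) = 1 - p2 - t2"
    using assms(1,2) by (simp_all add: p1_def p2_def field_simps)
  have nn: "0 \<le> p1" "p1 \<le> p2" "0 \<le> 1 - p2 - t2"
    using assms by (simp_all add: p1_def p2_def flip: c(2)[unfolded p2_def])
  let ?xs = "[((Opn, Opn), p1), ((Cl0, Opn), p2 - p1), ((Cl0, Cl0), 1 - p2 - t2), ((Cl0, Cl1), t2 - t1), ((Cl1, Cl1), t1)]"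
  have wf: "pmf_of_list_wf ?xs" using nn assms by (auto simp: pmf_of_list_wf_def)
  have l1: "pmf (map_pmf fst (pmf_of_list ?xs)) a = pmf (label_pmf q1 t1) a" for a
    unfolding pmf_map_pmf_of_list[OF wf] using assms
    by (cases a) (simp_all add: pmf_label c p1_def)
  have l2: "pmf (map_pmf snd (pmf_of_list ?xs)) a = pmf (label_pmf q2 t2) a" for a
    unfolding pmf_map_pmf_of_list[OF wf] using assms
    by (cases a) (simp_all add: pmf_label c p2_def)
  have "(a = Opn \<longrightarrow> b = Opn) \<and> (a = Cl1 \<longrightarrow> b = Cl1)" if "(a, b) \<in> set_pmf (pmf_of_list ?xs)" for a b
    using set_pmf_of_list[OF wf] that by auto
  then show ?thesis using that[of "pmf_of_list ?xs"] l1 l2 by (simp add: pmf_eqI)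
qed

context exploration begin

abbreviation kids :: "nat \<Rightarrow> 'e set" where "kids n \<equiv> star T (w n) - E n"

lemma ws: "window_step T k (U n) (D n) (E n) (w n)"
  using win w by unfold_locales

definition update :: "nat \<Rightarrow> 'e set \<times> 'v set \<Rightarrow> 'e set \<times> 'e set \<Rightarrow> 'e set \<times> 'v set" where
  "update n x y = (fst x \<union> fst y, snd x - {w n} \<union> far_end T (w n) ` snd y)"

definition kernel :: "real \<Rightarrow> real \<Rightarrow> nat \<Rightarrow> 'e set \<times> 'v set \<Rightarrow> ('e set \<times> 'v set) pmf" where
  "kernel q t n = window_step.step_pmf T (E n) (w n) q (\<lambda>_. t)"

lemma kernel_eq:
  assumes "t \<ge> 0"
  shows "kernel q t n x = bind_pmf (pmf_of_set (kids n)) (\<lambda>c.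
    map_pmf (\<lambda>l. update n x (star_outcome (kids n) (w n \<in> snd x) l c)) (Pi_pmf (kids n) Cl0 (\<lambda>_. label_pmf q t)))"
proof -
  have "pick_pmf (kids n) (\<lambda>_. t) = pmf_of_set (kids n)"
    using window_step.finite_C[OF ws] window_step.C_ne[OF ws] assms by (rule pick_pmf_const)
  then show ?thesis
    unfolding kernel_def window_step.step_pmf_def[OF ws] star_pmf_def
    by (simp add: map_bind_pmf map_pmf_comp update_def case_prod_unfold)
qed

primrec chain_law :: "real \<Rightarrow> real \<Rightarrow> ('e set \<times> 'v set) pmf \<Rightarrow> nat \<Rightarrow> ('e set \<times> 'v set) pmf" where
  "chain_law q t p 0 = p"
| "chain_law q t p (Suc n) = bind_pmf (chain_law q t p n) (kernel q t n)"

lemma chain_law_bind: "chain_law q t (bind_pmf p f) n = bind_pmf p (\<lambda>x. chain_law q t (f x) n)"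
  by (induction n) (simp_all add: bind_assoc_pmf)

text \<open>One step of two chains, with coupled labels and with the same child picked.\<close>

definition kernel2 :: "(label \<times> label) pmf \<Rightarrow> nat \<Rightarrow> ('e set \<times> 'v set) \<times> ('e set \<times> 'v set) \<Rightarrow>
    (('e set \<times> 'v set) \<times> ('e set \<times> 'v set)) pmf" where
  "kernel2 lam n z = bind_pmf (pmf_of_set (kids n)) (\<lambda>c. map_pmf (\<lambda>l.
     (update n (fst z) (star_outcome (kids n) (w n \<in> snd (fst z)) (fst \<circ> l) c),
      update n (snd z) (star_outcome (kids n) (w n \<in> snd (snd z)) (snd \<circ> l) c)))
     (Pi_pmf (kids n) (Cl0, Cl0) (\<lambda>_. lam)))"

lemma kernel2_fst:
  assumes "t \<ge> 0" "map_pmf fst lam = label_pmf q t"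
  shows "map_pmf fst (kernel2 lam n z) = kernel q t n (fst z)"
proof -
  have "Pi_pmf (kids n) Cl0 (\<lambda>_. label_pmf q t) = map_pmf (\<lambda>l. fst \<circ> l) (Pi_pmf (kids n) (Cl0, Cl0) (\<lambda>_. lam))"
    unfolding assms(2)[symmetric] using window_step.finite_C[OF ws] by (intro Pi_pmf_map) simp_all
  then show ?thesis
    unfolding kernel_eq[OF assms(1)] kernel2_def by (simp add: map_bind_pmf map_pmf_comp)
qed

lemma kernel2_snd:
  assumes "t \<ge> 0" "map_pmf snd lam = label_pmf q t"
  shows "map_pmf snd (kernel2 lam n z) = kernel q t n (snd z)"
proof -
  have "Pi_pmf (kids n) Cl0 (\<lambda>_. label_pmf q t) = map_pmf (\<lambda>l. snd \<circ> l) (Pi_pmf (kids n) (Cl0, Cl0) (\<lambda>_. lam))"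
    unfolding assms(2)[symmetric] using window_step.finite_C[OF ws] by (intro Pi_pmf_map) simp_all
  then show ?thesis
    unfolding kernel_eq[OF assms(1)] kernel2_def by (simp add: map_bind_pmf map_pmf_comp)
qed

lemma kernel2_support:
  assumes "z' \<in> set_pmf (kernel2 lam n z)"
  obtains c l where "c \<in> kids n" "\<And>e. e \<in> kids n \<Longrightarrow> l e \<in> set_pmf lam"
    "z' = (update n (fst z) (star_outcome (kids n) (w n \<in> snd (fst z)) (fst \<circ> l) c),
      update n (snd z) (star_outcome (kids n) (w n \<in> snd (snd z)) (snd \<circ> l) c))"
proof -
  have kids: "finite (kids n)" "kids n \<noteq> {}"
    using window_step.finite_C[OF ws] window_step.C_ne[OF ws] by blast+
  obtain c l where "c \<in> kids n" "l \<in> set_pmf (Pi_pmf (kids n) (Cl0, Cl0) (\<lambda>_. lam))"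
    "z' = (update n (fst z) (star_outcome (kids n) (w n \<in> snd (fst z)) (fst \<circ> l) c),
      update n (snd z) (star_outcome (kids n) (w n \<in> snd (snd z)) (snd \<circ> l) c))"
    using assms kids unfolding kernel2_def by auto
  moreover from this(2) have "l e \<in> set_pmf lam" if "e \<in> kids n" for e
    using that kids(1) by (auto simp: set_Pi_pmf PiE_dflt_def)
  ultimately show ?thesis using that by blast
qed

lemma outcome_subset: "c \<in> kids n \<Longrightarrow> fst (star_outcome (kids n) s l c) \<subseteq> kids n"
  by (auto simp: star_outcome_def split: if_splits)

text \<open>The coupled kernel preserves the order of the two states: coupled labels are ordered, and if the
  explored vertex is joined to infinity in the smaller state, then also in the larger one, where the
  same child is picked. The edges in \<open>E 0\<close> are exempt, as they may be ordered the wrong way at the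
  start.\<close>

lemma coupled_chain:
  assumes q: "0 \<le> t1" "0 \<le> t2"
    and lam: "map_pmf fst lam = label_pmf q1 t1" "map_pmf snd lam = label_pmf q2 t2"
    and lam_mono: "\<And>a b. (a, b) \<in> set_pmf lam \<Longrightarrow> (a = Opn \<longrightarrow> b = Opn) \<and> (a = Cl1 \<longrightarrow> b = Cl1)"
    and P0: "\<And>x y. (x, y) \<in> set_pmf P0 \<Longrightarrow> fst x - E 0 \<subseteq> fst y \<and> snd x \<subseteq> snd y"
  obtains \<kappa> where "monotone_coupling (edges T - E 0) \<kappa>"
    "\<And>n J A. J \<subseteq> E n - E 0 \<Longrightarrow> config_law (edges T - E 0) (distr \<kappa> (config_space (edges T - E 0)) fst) J A =
      measure_pmf.prob (chain_law q1 t1 (map_pmf fst P0) n) {x. fst x \<inter> J \<in> A}"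
    "\<And>n J A. J \<subseteq> E n - E 0 \<Longrightarrow> config_law (edges T - E 0) (distr \<kappa> (config_space (edges T - E 0)) snd) J A =
      measure_pmf.prob (chain_law q2 t2 (map_pmf snd P0) n) {x. fst x \<inter> J \<in> A}"
proof -
  define p where "p = rec_nat P0 (\<lambda>n p. bind_pmf p (kernel2 lam n))"
  have p0: "p 0 = P0" and pS: "p (Suc n) = bind_pmf (p n) (kernel2 lam n)" for n by (simp_all add: p_def)
  have p1: "map_pmf fst (p n) = chain_law q1 t1 (map_pmf fst P0) n" for n
  proof (induction n)
    case (Suc n)
    then show ?case
      by (simp add: pS map_bind_pmf kernel2_fst[OF q(1) lam(1)] bind_map_pmf flip: Suc)
  qed (simp add: p0)
  have p2: "map_pmf snd (p n) = chain_law q2 t2 (map_pmf snd P0) n" for n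
  proof (induction n)
    case (Suc n)
    then show ?case
      by (simp add: pS map_bind_pmf kernel2_snd[OF q(2) lam(2)] bind_map_pmf flip: Suc)
  qed (simp add: p0)
  have mono: "fst (fst z) - E 0 \<subseteq> fst (snd z) \<and> snd (fst z) \<subseteq> snd (snd z)" if "z \<in> set_pmf (p n)" for n z
    using that
  proof (induction n arbitrary: z)
    case 0
    then show ?case using P0[of "fst z" "snd z"] by (simp add: p0)
  next
    case (Suc n)
    then obtain z0 where z0: "z0 \<in> set_pmf (p n)" "z \<in> set_pmf (kernel2 lam n z0)" by (auto simp: pS)
    obtain c l where cl: "c \<in> kids n" "\<And>e. e \<in> kids n \<Longrightarrow> l e \<in> set_pmf lam"
      "z = (update n (fst z0) (star_outcome (kids n) (w n \<in> snd (fst z0)) (fst \<circ> l) c),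
        update n (snd z0) (star_outcome (kids n) (w n \<in> snd (snd z0)) (snd \<circ> l) c))"
      using kernel2_support[OF z0(2)] by metis
    have IH: "fst (fst z0) - E 0 \<subseteq> fst (snd z0)" "snd (fst z0) \<subseteq> snd (snd z0)" using Suc.IH[OF z0(1)] by auto
    have lm: "(fst (l e) = Opn \<longrightarrow> snd (l e) = Opn) \<and> (fst (l e) = Cl1 \<longrightarrow> snd (l e) = Cl1)" if "e \<in> kids n" for e
      using lam_mono[of "fst (l e)" "snd (l e)"] cl(2)[OF that] by simp
    let ?o1 = "star_outcome (kids n) (w n \<in> snd (fst z0)) (fst \<circ> l) c"
    let ?o2 = "star_outcome (kids n) (w n \<in> snd (snd z0)) (snd \<circ> l) c"
    have o: "fst ?o1 \<subseteq> fst ?o2" "snd ?o1 \<subseteq> snd ?o2"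
      using lm IH(2) by (auto simp: star_outcome_def)
    have z: "fst (fst z) = fst (fst z0) \<union> fst ?o1" "snd (fst z) = snd (fst z0) - {w n} \<union> far_end T (w n) ` snd ?o1"
      "fst (snd z) = fst (snd z0) \<union> fst ?o2" "snd (snd z) = snd (snd z0) - {w n} \<union> far_end T (w n) ` snd ?o2"
      unfolding cl(3) by (simp_all add: update_def)
    show ?case unfolding z using IH o by blast
  qed
  have keep: "fst (fst z') \<inter> (E n - E 0) = fst (fst z) \<inter> (E n - E 0)" "fst (snd z') \<inter> (E n - E 0) = fst (snd z) \<inter> (E n - E 0)"
    if z': "z' \<in> set_pmf (kernel2 lam n z)" for n z z'
  proof -
    obtain c l where cl: "c \<in> kids n"
      "z' = (update n (fst z) (star_outcome (kids n) (w n \<in> snd (fst z)) (fst \<circ> l) c),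
        update n (snd z) (star_outcome (kids n) (w n \<in> snd (snd z)) (snd \<circ> l) c))"
      using kernel2_support[OF z'] by metis
    show "fst (fst z') \<inter> (E n - E 0) = fst (fst z) \<inter> (E n - E 0)" "fst (snd z') \<inter> (E n - E 0) = fst (snd z) \<inter> (E n - E 0)"
      using outcome_subset[OF cl(1)] unfolding cl(2) update_def by auto
  qed
  have F: "finite (E n - E 0)" "E n - E 0 \<subseteq> E (Suc n) - E 0" for n
    using window_invariants(3)[OF win[of n]] E_mono[of n "Suc n"] by auto
  have Fun: "(\<Union>n. E n - E 0) = edges T - E 0" using edges_covered by blast
  have dom: "fst (fst x) \<inter> (E n - E 0) \<subseteq> fst (snd x)" if "x \<in> set_pmf (p n)" for n x using mono[OF that] by blast
  obtain \<kappa> where "monotone_coupling (edges T - E 0) \<kappa>"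
    and L1: "\<And>n J A. J \<subseteq> E n - E 0 \<Longrightarrow> config_law (edges T - E 0) (distr \<kappa> (config_space (edges T - E 0)) fst) J A =
      measure_pmf.prob (p n) {x. fst (fst x) \<inter> J \<in> A}"
    and L2: "\<And>n J A. J \<subseteq> E n - E 0 \<Longrightarrow> config_law (edges T - E 0) (distr \<kappa> (config_space (edges T - E 0)) snd) J A =
      measure_pmf.prob (p n) {x. fst (snd x) \<inter> J \<in> A}"
    by (rule chain_config_coupling[of p "kernel2 lam" "\<lambda>n. E n - E 0" "edges T - E 0" "\<lambda>z. fst (fst z)" "\<lambda>z. fst (snd z)",
        OF pS F Fun]) (erule keep(1) | erule keep(2) | erule dom | (rule that, assumption+))+
  then show ?thesis
    by (intro that[of \<kappa>]) (simp_all add: vimage_def flip: p1 p2)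
qed

text \<open>The criterion by which both parts of the theorem are obtained.\<close>

text \<open>Measures on configurations whose cylinder probabilities are those of two chains are ordered if the
  label probabilities and the initial states are.\<close>

lemma stoch_dominated_chain:
  assumes q: "0 \<le> q1" "0 \<le> q2" and t: "0 \<le> t1" "t1 \<le> t2" "t2 \<le> 1" "(1 - t1) / (1 + q1) \<le> (1 - t2) / (1 + q2)"
    and P0: "\<And>x y. (x, y) \<in> set_pmf P0 \<Longrightarrow> fst x - E 0 \<subseteq> fst y \<and> snd x \<subseteq> snd y"
    and \<mu>: "prob_space \<mu>" "sets \<mu> = sets (config_space (edges T - E 0))"
      "\<And>n J A. n \<ge> 1 \<Longrightarrow> J \<subseteq> E n - E 0 \<Longrightarrow> config_law (edges T - E 0) \<mu> J A =
        measure_pmf.prob (chain_law q1 t1 (map_pmf fst P0) n) {x. fst x \<inter> J \<in> A}"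
    and \<nu>: "prob_space \<nu>" "sets \<nu> = sets (config_space (edges T - E 0))"
      "\<And>n J A. n \<ge> 1 \<Longrightarrow> J \<subseteq> E n - E 0 \<Longrightarrow> config_law (edges T - E 0) \<nu> J A =
        measure_pmf.prob (chain_law q2 t2 (map_pmf snd P0) n) {x. fst x \<inter> J \<in> A}"
  shows "stoch_dominated (edges T - E 0) \<mu> \<nu>"
proof -
  let ?E = "edges T - E 0"
  obtain lam where lam: "map_pmf fst lam = label_pmf q1 t1" "map_pmf snd lam = label_pmf q2 t2"
    "\<And>a b. (a, b) \<in> set_pmf lam \<Longrightarrow> (a = Opn \<longrightarrow> b = Opn) \<and> (a = Cl1 \<longrightarrow> b = Cl1)"
    using exists_label_coupling[OF q t] by metis
  have t2: "0 \<le> t2" using t by simp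
  obtain \<kappa> where mc: "monotone_coupling ?E \<kappa>"
    and L1: "\<And>n J A. J \<subseteq> E n - E 0 \<Longrightarrow> config_law ?E (distr \<kappa> (config_space ?E) fst) J A =
      measure_pmf.prob (chain_law q1 t1 (map_pmf fst P0) n) {x. fst x \<inter> J \<in> A}"
    and L2: "\<And>n J A. J \<subseteq> E n - E 0 \<Longrightarrow> config_law ?E (distr \<kappa> (config_space ?E) snd) J A =
      measure_pmf.prob (chain_law q2 t2 (map_pmf snd P0) n) {x. fst x \<inter> J \<in> A}"
    by (rule coupled_chain[OF t(1) t2 lam P0]) (assumption | rule that)+
  note \<kappa> = mc[unfolded monotone_coupling_def, THEN conjunct1] mc[unfolded monotone_coupling_def, THEN conjunct2, THEN conjunct1]
    mc[unfolded monotone_coupling_def, THEN conjunct2, THEN conjunct2]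
  interpret prob_space \<kappa> by (rule \<kappa>(1))
  have m: "fst \<in> measurable \<kappa> (config_space ?E)" "snd \<in> measurable \<kappa> (config_space ?E)"
    unfolding measurable_cong_sets[OF \<kappa>(2) refl] by simp_all
  have cover: "\<exists>n\<ge>1. J \<subseteq> E n - E 0" if "finite J" "J \<subseteq> ?E" for J
  proof -
    have J: "finite J" "J \<subseteq> edges T" using that by auto
    obtain n where "n \<ge> 1" "J \<subseteq> E n" by (rule finite_subset_E[OF J])
    then show ?thesis using that(2) by blast
  qed
  have "distr \<kappa> (config_space ?E) fst = \<mu>"
  proof (rule config_measure_eqI[OF prob_space_distr[OF m(1)] \<mu>(1) _ \<mu>(2)])
    fix J A assume "finite J" "J \<subseteq> ?E"
    then obtain n where "n \<ge> 1" "J \<subseteq> E n - E 0" using cover by blast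
    then show "config_law ?E (distr \<kappa> (config_space ?E) fst) J A = config_law ?E \<mu> J A"
      using L1 \<mu>(3) by simp
  qed simp
  moreover have "distr \<kappa> (config_space ?E) snd = \<nu>"
  proof (rule config_measure_eqI[OF prob_space_distr[OF m(2)] \<nu>(1) _ \<nu>(2)])
    fix J A assume "finite J" "J \<subseteq> ?E"
    then obtain n where "n \<ge> 1" "J \<subseteq> E n - E 0" using cover by blast
    then show "config_law ?E (distr \<kappa> (config_space ?E) snd) J A = config_law ?E \<nu> J A"
      using L2 \<nu>(3) by simp
  qed simp
  ultimately show ?thesis unfolding stoch_dominated_def using \<kappa> by blast
qed

end

locale gas_exploration = gas_tree T k q + exploration T k U D E w
  for T :: "('v, 'e) multigraph" and k q U D E w
begin

text \<open>The first step is separate because a root vertex has \<open>k\<close> children instead of \<open>k - 1\<close>. From then on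
  \<open>ustar\<close> reproduces itself under the recursion.\<close>

lemma gibbs_chain_law:
  fixes ub :: "'v \<Rightarrow> real"
  defines "s \<equiv> real (card (kids 0)) * ustar"
  assumes g0: "gibbs T q ub (U 0) (D 0) (E 0) p"
    and ub: "ub (w 0) = s / (1 + q + s)" "\<And>b. b \<in> D 0 - {w 0} \<Longrightarrow> ub b = ustar"
  shows "n \<ge> 1 \<Longrightarrow> gibbs T q (\<lambda>_. ustar) (U n) (D n) (E n) (chain_law q ustar p n)"
proof (induction n rule: dec_induct)
  case base
  interpret window_step T k "U 0" "D 0" "E 0" "w 0" by (rule ws)
  have "gibbs T q (\<lambda>_. ustar) U' D' E' (bind_pmf p (step_pmf q (\<lambda>_. ustar)))"
    using q ustar g0 ub by (intro gibbs_step) (auto simp: s_def)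
  then show ?case using U_Suc[of 0] D_Suc[of 0] E_Suc[of 0] by (simp add: kernel_def[abs_def])
next
  case (step n)
  interpret window_step T k "U n" "D n" "E n" "w n" by (rule ws)
  have "real (card C) = d" using card_C U_ne[OF step(1)] by (simp add: d_def)
  then have "ustar = (\<Sum>c\<in>C. ustar) / (1 + q + (\<Sum>c\<in>C. ustar))" using h_ustar by (simp add: h_def)
  then have "gibbs T q (\<lambda>_. ustar) U' D' E' (bind_pmf (chain_law q ustar p n) (step_pmf q (\<lambda>_. ustar)))"
    using q ustar step.IH by (intro gibbs_step) auto
  then show ?case using U_Suc[of n] D_Suc[of n] E_Suc[of n] by (simp add: kernel_def[abs_def])
qed

end


section \<open>The wired limit and its monotonicity\<close>

lemma exists_bernoulli_coupling:
  assumes "0 \<le> (s::real)" "s \<le> t" "t \<le> 1"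
  obtains B where "map_pmf fst B = bernoulli_pmf s" "map_pmf snd B = bernoulli_pmf t"
    "\<And>a b. (a, b) \<in> set_pmf B \<Longrightarrow> a \<longrightarrow> b"
proof -
  let ?xs = "[((True, True), s), ((False, True), t - s), ((False, False), 1 - t)]"
  have wf: "pmf_of_list_wf ?xs" using assms by (auto simp: pmf_of_list_wf_def)
  have "map_pmf fst (pmf_of_list ?xs) = bernoulli_pmf s"
  proof (rule pmf_eqI)
    show "pmf (map_pmf fst (pmf_of_list ?xs)) a = pmf (bernoulli_pmf s) a" for a
      unfolding pmf_map_pmf_of_list[OF wf] using assms by (cases a) simp_all
  qed
  moreover have "map_pmf snd (pmf_of_list ?xs) = bernoulli_pmf t"
  proof (rule pmf_eqI)
    show "pmf (map_pmf snd (pmf_of_list ?xs)) a = pmf (bernoulli_pmf t) a" for a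
      unfolding pmf_map_pmf_of_list[OF wf] using assms by (cases a) simp_all
  qed
  moreover have "a \<longrightarrow> b" if "(a, b) \<in> set_pmf (pmf_of_list ?xs)" for a b
    using set_pmf_of_list[OF wf] that by auto
  ultimately show ?thesis by (rule that)
qed

lemma odds_mono:
  fixes x y q1 q2 :: real
  assumes "x * q2 \<le> y * q1" "q1 + x > 0" "q2 + y > 0"
  shows "x / (q1 + x) \<le> y / (q2 + y)"
proof -
  have "x * (q2 + y) \<le> y * (q1 + x)" using assms(1) by (simp add: algebra_simps)
  then show ?thesis using assms(2,3) by (simp add: divide_le_eq pos_le_divide_eq mult.commute)
qed

definition root_state :: "'v \<Rightarrow> bool \<Rightarrow> 'e set \<times> 'v set" where
  "root_state v b = ({}, if b then {v} else {})"

context gas_tree begin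

text \<open>For the window that consists of one unexplored vertex, the relative weights of not being joined to
  infinity and of being joined are \<open>q\<close> and \<open>k * ustar\<close>.\<close>

definition root_prob :: real where "root_prob = k * ustar / (q + k * ustar)"

lemma root_denominator: "q + k * ustar > 0"
proof (cases "q = 0")
  case True then show ?thesis using ustar_pos k by simp
next
  case False then show ?thesis using q ustar(1) by (simp add: add_pos_nonneg)
qed

lemma root_prob: "0 \<le> root_prob" "root_prob \<le> 1"
  using root_denominator q ustar(1) by (simp_all add: root_prob_def)

lemma gibbs_root:
  assumes "v \<in> verts T"
  shows "gibbs T q (\<lambda>_. k * ustar / (1 + q + k * ustar)) {} {v} {} (map_pmf (root_state v) (bernoulli_pmf root_prob))"
proof -
  define s where "s = k * ustar"
  let ?u = "s / (1 + q + s)"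
  have s: "s \<ge> 0" using ustar(1) by (simp add: s_def)
  have pos: "1 + q + s > 0" using q s by simp
  have "1 - ?u = (1 + q) / (1 + q + s)" using pos by (simp add: field_simps)
  then have c: "(1 - ?u) / (1 + q) = 1 / (1 + q + s)" using q by simp
  have inj: "inj (root_state v :: bool \<Rightarrow> 'e set \<times> 'v set)" by (auto simp: inj_on_def root_state_def split: if_splits)
  define z where "z = (q + s) / (1 + q + s)"
  have qs: "q + s > 0" using root_denominator by (simp add: s_def)
  then have z: "z > 0" using pos by (simp add: z_def)
  have rp1: "root_prob = s / (q + s)" by (simp add: root_prob_def s_def)
  have "s / (q + s) + q / (q + s) = 1" using qs by (simp add: add.commute flip: add_divide_distrib)
  then have rp2: "1 - root_prob = q / (q + s)" unfolding rp1 by linarith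
  have zr: "z * root_prob = ?u" "z * (1 - root_prob) = q * (1 / (1 + q + s))"
    unfolding rp2 unfolding rp1 z_def using qs by simp_all
  have "weight T q (\<lambda>_. ?u) {} {v} {} x = z * pmf (map_pmf (root_state v) (bernoulli_pmf root_prob)) x" for x
  proof (cases "x \<in> range (root_state v)")
    case True
    then obtain b where x: "x = root_state v b" by blast
    have "pmf (map_pmf (root_state v) (bernoulli_pmf root_prob)) x = pmf (bernoulli_pmf root_prob) b"
      unfolding x by (rule pmf_map_inj'[OF inj])
    then show ?thesis
      using zr root_prob c unfolding x
      by (cases b) (simp_all add: weight_def root_state_def separated_def boundary_weight_def)
  next
    case False
    then have "pmf (map_pmf (root_state v) (bernoulli_pmf root_prob)) x = 0"
      by (auto simp: pmf_eq_0_set_pmf)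
    moreover have "weight T q (\<lambda>_. ?u) {} {v} {} x = 0"
    proof (rule ccontr)
      assume "weight T q (\<lambda>_. ?u) {} {v} {} x \<noteq> 0"
      then have "fst x = {}" "snd x \<subseteq> {v}" using weight_pos_subset by blast+
      then have "x = root_state v (snd x = {v})" by (auto simp: root_state_def prod_eq_iff)
      then show False using False by blast
    qed
    ultimately show ?thesis by simp
  qed
  then show ?thesis using z unfolding gibbs_def s_def by blast
qed

lemma gibbs_root_chain:
  assumes "exploration T k U D E w" "U 0 = {}" "D 0 = {v}" "E 0 = {}" "v \<in> verts T" "n \<ge> 1"
  shows "gibbs T q (\<lambda>_. ustar) (U n) (D n) (E n)
    (exploration.chain_law T E w q ustar (map_pmf (root_state v) (bernoulli_pmf root_prob)) n)"
proof -
  interpret exploration T k U D E w by fact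
  interpret gas_exploration T k q U D E w by unfold_locales
  have w0: "w 0 = v" using w[of 0] assms(3) by simp
  then have "card (kids 0) = k" using card_star[OF assms(5)] assms(4) by simp
  then show ?thesis
    using gibbs_root[OF assms(5)] assms w0 by (intro gibbs_chain_law[where ub="\<lambda>_. k * ustar / (1 + q + k * ustar)"]) auto
qed

lemma exists_root_exploration:
  obtains U D E w v where "exploration T k U D E w" "U 0 = {}" "D 0 = {v}" "E 0 = {}" "v \<in> verts T"
proof -
  have "verts T \<noteq> {}" using reg by (auto simp: regular_tree_def spanning_tree_def connected_in_def)
  then obtain v where v: "v \<in> verts T" by blast
  obtain U D E w where "exploration T k U D E w" "U 0 = {}" "D 0 = {v}" "E 0 = {}"
    by (rule exists_exploration[OF window.vertex[OF v]])
  then show ?thesis using v by (rule that)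
qed

lemma is_wired_limit_iff:
  "is_wired_limit T (gas q) \<mu> \<longleftrightarrow> prob_space \<mu> \<and> sets \<mu> = sets (config_space (edges T)) \<and>
    (\<forall>V. exhaustion T V \<longrightarrow> (\<forall>J A. finite J \<and> J \<subseteq> edges T \<and> A \<subseteq> Pow J \<longrightarrow>
      (\<lambda>n. measure_pmf.prob (gas q (wired_graph T (V n))) {\<eta>. \<eta> \<inter> J \<in> A}) \<longlonglongrightarrow> config_law (edges T) \<mu> J A))"
proof (cases "sets \<mu> = sets (config_space (edges T))")
  case True
  then have "space \<mu> = space (config_space (edges T))" by (rule sets_eq_imp_space_eq)
  then show ?thesis unfolding is_wired_limit_def config_law_def by simp
qed (simp add: is_wired_limit_def)

lemma is_wired_limitD:
  assumes "is_wired_limit T (gas q) \<mu>" "exhaustion T V" "finite J" "J \<subseteq> edges T" "A \<subseteq> Pow J"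
  shows "(\<lambda>n. measure_pmf.prob (gas q (wired_graph T (V n))) {\<eta>. \<eta> \<inter> J \<in> A}) \<longlonglongrightarrow> config_law (edges T) \<mu> J A"
  using assms unfolding is_wired_limit_iff by blast

text \<open>The exploration chain, coupled with itself, provides a measure on configurations. On every window
  its law is the Gibbs law to which the finite-volume laws converge.\<close>

lemma wired_limit_exists: "\<exists>\<mu>. is_wired_limit T (gas q) \<mu>"
proof -
  obtain U D E w v where ex: "exploration T k U D E w" "U 0 = {}" "D 0 = {v}" "E 0 = {}" "v \<in> verts T"
    by (rule exists_root_exploration)
  interpret exploration T k U D E w by fact
  let ?init = "map_pmf (root_state v) (bernoulli_pmf root_prob) :: ('e set \<times> 'v set) pmf"
  let ?p = "chain_law q ustar ?init"
  obtain lam where lam: "map_pmf fst lam = label_pmf q ustar" "map_pmf snd lam = label_pmf q ustar"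
    "\<And>a b. (a, b) \<in> set_pmf lam \<Longrightarrow> (a = Opn \<longrightarrow> b = Opn) \<and> (a = Cl1 \<longrightarrow> b = Cl1)"
    using exists_label_coupling[OF q q ustar(1) order_refl ustar(2) order_refl] by metis
  let ?both = "map_pmf (\<lambda>x. (x, x)) ?init"
  have P0: "\<And>x y. (x, y) \<in> set_pmf ?both \<Longrightarrow> fst x - E 0 \<subseteq> fst y \<and> snd x \<subseteq> snd y" by auto
  have P0f: "map_pmf fst ?both = ?init" by (simp add: map_pmf_comp)
  obtain \<kappa> where mc: "monotone_coupling (edges T - E 0) \<kappa>"
    and L: "\<And>n J A. J \<subseteq> E n - E 0 \<Longrightarrow> config_law (edges T - E 0) (distr \<kappa> (config_space (edges T - E 0)) fst) J A =
      measure_pmf.prob (chain_law q ustar (map_pmf fst ?both) n) {x. fst x \<inter> J \<in> A}"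
    by (rule coupled_chain[OF ustar(1) ustar(1) lam P0]) (assumption | rule that)+
  let ?\<mu> = "distr \<kappa> (config_space (edges T)) fst"
  have \<kappa>: "prob_space \<kappa>" "sets \<kappa> = sets (config_space (edges T - E 0) \<Otimes>\<^sub>M config_space (edges T - E 0))"
    using mc unfolding monotone_coupling_def by blast+
  interpret prob_space \<kappa> by (rule \<kappa>(1))
  have m: "fst \<in> measurable \<kappa> (config_space (edges T))"
    using \<kappa>(2) ex(4) unfolding measurable_cong_sets[OF \<kappa>(2) refl] by simp
  have "is_wired_limit T (gas q) ?\<mu>"
    unfolding is_wired_limit_iff
  proof (intro conjI allI impI)
    show "prob_space ?\<mu>" by (rule prob_space_distr[OF m])
    fix V J A assume V: "exhaustion T V" and J: "finite J \<and> J \<subseteq> edges T \<and> A \<subseteq> Pow J"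
    have fJ: "finite J" "J \<subseteq> edges T" using J by auto
    obtain n where n: "n \<ge> 1" "J \<subseteq> E n" by (rule finite_subset_E[OF fJ])
    have "config_law (edges T) ?\<mu> J A = measure_pmf.prob (?p n) {x. fst x \<inter> J \<in> A}"
      using L[of J n A] n(2) ex(4) unfolding P0f by simp
    moreover have "gibbs T q (\<lambda>_. ustar) (U n) (D n) (E n) (?p n)" using gibbs_root_chain[OF ex n(1)] .
    ultimately show "(\<lambda>n. measure_pmf.prob (gas q (wired_graph T (V n))) {\<eta>. \<eta> \<inter> J \<in> A}) \<longlonglongrightarrow> config_law (edges T) ?\<mu> J A"
      using gas_converges[OF win U_ne[OF n(1)] _ V n(2)] by simp
  qed simp
  then show ?thesis by blast
qed

lemma wired_limit_law:
  assumes \<mu>: "is_wired_limit T (gas q) \<mu>" and win: "window T U D E" "U \<noteq> {}"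
    and g: "gibbs T q (\<lambda>_. ustar) U D E p" and J: "J \<subseteq> E"
  shows "config_law (edges T) \<mu> J A = measure_pmf.prob p {x. fst x \<inter> J \<in> A}"
proof -
  obtain U' D' E' w v where "exploration T k U' D' E' w" by (rule exists_root_exploration)
  then interpret ex: exploration T k U' D' E' w .
  have fin: "finite J" "J \<subseteq> edges T" using finite_subset[OF J window_invariants(3)[OF win(1)]] J window_invariants(6)[OF win(1)] by auto
  have "config_law (edges T) \<mu> J A = config_law (edges T) \<mu> J (A \<inter> Pow J)"
    unfolding config_law_def by (rule arg_cong[where f="measure \<mu>"]) auto
  also have "\<dots> = measure_pmf.prob p {x. fst x \<inter> J \<in> A \<inter> Pow J}"
  proof (rule LIMSEQ_unique)
    show "(\<lambda>n. measure_pmf.prob (gas q (wired_graph T (U' n \<union> D' n))) {\<eta>. \<eta> \<inter> J \<in> A \<inter> Pow J})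
        \<longlonglongrightarrow> config_law (edges T) \<mu> J (A \<inter> Pow J)"
      by (rule is_wired_limitD[OF \<mu> ex.exhaustion fin Int_lower2])
    show "(\<lambda>n. measure_pmf.prob (gas q (wired_graph T (U' n \<union> D' n))) {\<eta>. \<eta> \<inter> J \<in> A \<inter> Pow J})
        \<longlonglongrightarrow> measure_pmf.prob p {x. fst x \<inter> J \<in> A \<inter> Pow J}"
      by (rule gas_converges[OF win g ex.exhaustion J])
  qed
  also have "{x. fst x \<inter> J \<in> A \<inter> Pow J} = {x. fst x \<inter> J \<in> A}" by auto
  finally show ?thesis .
qed

lemma wired_limit: "is_wired_limit T (gas q) (wired_limit T (gas q))"
  unfolding wired_limit_def
proof (rule theI')
  obtain \<mu> where \<mu>: "is_wired_limit T (gas q) \<mu>" using wired_limit_exists by blast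
  obtain U D E w v where ex: "exploration T k U D E w" "U 0 = {}" "D 0 = {v}" "E 0 = {}" "v \<in> verts T"
    by (rule exists_root_exploration)
  interpret exploration T k U D E w by fact
  have "\<nu> = \<mu>" if \<nu>: "is_wired_limit T (gas q) \<nu>" for \<nu>
  proof (rule config_measure_eqI[of _ _ "edges T"])
    show "prob_space \<nu>" "prob_space \<mu>" "sets \<nu> = sets (config_space (edges T))" "sets \<mu> = sets (config_space (edges T))"
      using \<mu> \<nu> unfolding is_wired_limit_iff by auto
    fix J A assume J: "finite J" "J \<subseteq> edges T"
    obtain n where n: "n \<ge> 1" "J \<subseteq> E n" by (rule finite_subset_E[OF J])
    show "config_law (edges T) \<nu> J A = config_law (edges T) \<mu> J A"
      using wired_limit_law[OF \<nu> win U_ne[OF n(1)] gibbs_root_chain[OF ex n(1)] n(2)]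
        wired_limit_law[OF \<mu> win U_ne[OF n(1)] gibbs_root_chain[OF ex n(1)] n(2)] by simp
  qed
  then show "\<exists>!\<mu>. is_wired_limit T (gas q) \<mu>" using \<mu> by blast
qed

end

context reg_tree begin

text \<open>The second quantity is the minimum of \<open>1 / (1 + q)\<close> and \<open>1 / (k - 1)\<close>. The latter is the critical
  probability of percolation on \<open>T\<close>, which takes over at \<open>q = k - 2\<close>.\<close>

lemma ustar_antimono:
  assumes "0 \<le> q2" "q2 \<le> q1"
  shows "gas_tree.ustar k q1 \<le> gas_tree.ustar k q2"
    "(1 - gas_tree.ustar k q1) / (1 + q1) \<le> (1 - gas_tree.ustar k q2) / (1 + q2)"
proof -
  interpret g1: gas_tree T k q1 using assms by unfold_locales simp
  interpret g2: gas_tree T k q2 using assms by unfold_locales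
  define d where "d = real (k - 1)"
  have d: "d > 0" using k by (simp add: d_def)
  have u: "g1.ustar = max 0 (1 - (1 + q1) / d)" "g2.ustar = max 0 (1 - (1 + q2) / d)"
    by (simp_all add: g1.ustar_def g2.ustar_def g1.d_def d_def)
  have "(1 + q2) / d \<le> (1 + q1) / d" using d assms by (intro divide_right_mono) auto
  then show "g1.ustar \<le> g2.ustar" unfolding u by simp
  have p: "(1 - max 0 (1 - (1 + q) / d)) / (1 + q) = min (1 / (1 + q)) (1 / d)" if "q \<ge> 0" for q
  proof (cases "(1 + q) / d \<le> 1")
    case True
    then have "1 / d \<le> 1 / (1 + q)" using d that by (simp add: field_simps)
    then show ?thesis using True that d by (simp add: max_def min_def)
  next
    case False
    then have "1 / (1 + q) \<le> 1 / d" using d that by (simp add: field_simps)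
    then show ?thesis using False that d by (simp add: max_def min_def)
  qed
  have "1 / (1 + q1) \<le> 1 / (1 + q2)" using assms by (simp add: frac_le)
  then show "(1 - g1.ustar) / (1 + q1) \<le> (1 - g2.ustar) / (1 + q2)"
    unfolding u using p assms by (simp add: min_le_iff_disj)
qed

lemma wired_limit_mono:
  assumes "0 \<le> q2" "q2 \<le> q1"
  shows "stoch_dominated (edges T) (wired_limit T (gas q1)) (wired_limit T (gas q2))"
proof -
  interpret g1: gas_tree T k q1 using assms by unfold_locales simp
  interpret g2: gas_tree T k q2 using assms by unfold_locales
  obtain U D E w v where ex: "exploration T k U D E w" "U 0 = {}" "D 0 = {v}" "E 0 = {}" "v \<in> verts T"
    by (rule g1.exists_root_exploration)
  interpret exploration T k U D E w by fact
  note u = ustar_antimono[OF assms]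
  have "g1.root_prob \<le> g2.root_prob"
  proof -
    have "(k * g1.ustar) * q2 \<le> (k * g2.ustar) * q1"
      using u(1) assms g1.ustar(1) g2.ustar(1) by (intro mult_mono mult_left_mono) auto
    then show ?thesis
      unfolding g1.root_prob_def g2.root_prob_def
      using g1.root_denominator g2.root_denominator by (rule odds_mono)
  qed
  then obtain B where B: "map_pmf fst B = bernoulli_pmf g1.root_prob" "map_pmf snd B = bernoulli_pmf g2.root_prob"
    "\<And>a b. (a, b) \<in> set_pmf B \<Longrightarrow> a \<longrightarrow> b"
    using exists_bernoulli_coupling[OF g1.root_prob(1) _ g2.root_prob(2)] by metis
  let ?P0 = "map_pmf (map_prod (root_state v) (root_state v)) B :: (('e set \<times> 'v set) \<times> ('e set \<times> 'v set)) pmf"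
  have P1: "map_pmf fst ?P0 = map_pmf (root_state v) (bernoulli_pmf g1.root_prob)"
    by (simp add: map_pmf_comp flip: B(1))
  have P2: "map_pmf snd ?P0 = map_pmf (root_state v) (bernoulli_pmf g2.root_prob)"
    by (simp add: map_pmf_comp flip: B(2))
  note L1 = g1.wired_limit[unfolded g1.is_wired_limit_iff]
  note L2 = g2.wired_limit[unfolded g2.is_wired_limit_iff]
  have "stoch_dominated (edges T - E 0) (wired_limit T (gas q1)) (wired_limit T (gas q2))"
  proof (rule stoch_dominated_chain[of q1 q2 g1.ustar g2.ustar ?P0])
    show "0 \<le> q1" "0 \<le> q2" "0 \<le> g1.ustar" "g2.ustar \<le> 1" using assms g1.ustar g2.ustar by auto
    show "fst x - E 0 \<subseteq> fst y \<and> snd x \<subseteq> snd y" if xy: "(x, y) \<in> set_pmf ?P0" for x y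
    proof -
      obtain a b where ab: "(a, b) \<in> set_pmf B" "x = root_state v a" "y = root_state v b" using xy by auto
      show ?thesis using B(3)[OF ab(1)] unfolding ab(2,3) by (cases a; cases b) (simp_all add: root_state_def)
    qed
    show "config_law (edges T - E 0) (wired_limit T (gas q1)) J A =
        measure_pmf.prob (chain_law q1 g1.ustar (map_pmf fst ?P0) n) {x. fst x \<inter> J \<in> A}"
      if "n \<ge> 1" "J \<subseteq> E n - E 0" for n J A
      using g1.wired_limit_law[OF g1.wired_limit win U_ne[OF that(1)] g1.gibbs_root_chain[OF ex that(1)], of J A] that(2) ex(4)
      unfolding P1 by simp
    show "config_law (edges T - E 0) (wired_limit T (gas q2)) J A =
        measure_pmf.prob (chain_law q2 g2.ustar (map_pmf snd ?P0) n) {x. fst x \<inter> J \<in> A}"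
      if "n \<ge> 1" "J \<subseteq> E n - E 0" for n J A
      using g2.wired_limit_law[OF g2.wired_limit win U_ne[OF that(1)] g2.gibbs_root_chain[OF ex that(1)], of J A] that(2) ex(4)
      unfolding P2 by simp
  qed (use u L1 L2 ex(4) in simp_all)
  then show ?thesis using ex(4) by simp
qed

end


section \<open>Conditioning on an edge\<close>

lemma measure_bind_pmf:
  "measure_pmf.prob (bind_pmf p f) Q = (\<integral>x. measure_pmf.prob (f x) Q \<partial>measure_pmf p)"
proof -
  have m: "measure_pmf.prob p Q = pmf (map_pmf (\<lambda>y. y \<in> Q) p) True" for p
    by (simp add: pmf_map vimage_def)
  show ?thesis unfolding m by (simp only: map_bind_pmf pmf_bind)
qed

text \<open>Let \<open>A = (1 - ustar) / (1 + q)\<close> and \<open>B = ustar\<close> be the weights of an end of \<open>e\<close> being not joined or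
  joined to infinity in its own branch, and \<open>X = q A\<close>. If \<open>e\<close> is closed, the weights of the four
  states of the two ends are \<open>X\<^sup>2\<close>, \<open>X B\<close>, \<open>X B\<close>, \<open>B\<^sup>2\<close>, so each end is independently joined with
  probability \<open>t\<close>. If \<open>e\<close> is open, the weights are \<open>A X\<close>, \<open>A B\<close>, \<open>A B\<close>, 0, so each end is the only
  joined one with probability \<open>g\<close>.\<close>

locale edge_root = gas_tree T k q for T :: "('v, 'e) multigraph" and k q +
  fixes e :: 'e and a b :: 'v
  assumes q_pos: "q > 0" and e: "e \<in> edges T" and ab: "ends T e = {a, b}" "a \<noteq> b"
begin

definition X :: real where "X = q * (1 - ustar) / (1 + q)"
definition t :: real where "t = ustar / (X + ustar)"
definition g :: real where "g = ustar / (X + 2 * ustar)"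

lemma X_pos: "X > 0"
proof -
  have "(1 + q) / d > 0" using q_pos d by simp
  then have "ustar < 1" by (simp add: ustar_def)
  then show ?thesis using q_pos by (simp add: X_def)
qed

text \<open>The masses of the coupling are nonnegative. Both inequalities come down to
  \<open>X (X + 2 B) \<le> (X + B)\<^sup>2\<close>.\<close>

lemma bounds: "0 \<le> t" "t \<le> 1" "t * (1 - t) \<le> g" "2 * g \<le> 2 * t - t\<^sup>2"
  and vals: "1 - t = X / (X + ustar)" "1 - 2 * g = X / (X + 2 * ustar)"
proof -
  let ?B = ustar
  have B: "?B \<ge> 0" by (rule ustar(1))
  have p: "X + ?B > 0" "X + 2 * ?B > 0" using X_pos B by simp_all
  show v: "1 - t = X / (X + ?B)" "1 - 2 * g = X / (X + 2 * ?B)"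
    using p by (simp_all add: t_def g_def field_simps)
  show "0 \<le> t" "t \<le> 1" using p B X_pos by (simp_all add: t_def)
  have "t * (1 - t) = t * (X / (X + ?B))" by (simp only: v(1))
  also have "\<dots> = ?B * X / (X + ?B)\<^sup>2" by (simp add: t_def power2_eq_square)
  also have "\<dots> \<le> g"
  proof -
    have "X * (X + 2 * ?B) \<le> (X + ?B)\<^sup>2" by (simp add: power2_eq_square algebra_simps)
    then have "X / (X + ?B)\<^sup>2 \<le> 1 / (X + 2 * ?B)" using p by (simp add: field_simps)
    then have "?B * (X / (X + ?B)\<^sup>2) \<le> ?B * (1 / (X + 2 * ?B))" using B by (rule mult_left_mono)
    then show ?thesis by (simp add: g_def)
  qed
  finally show "t * (1 - t) \<le> g" .
  have "X\<^sup>2 / (X + ?B)\<^sup>2 \<le> X / (X + 2 * ?B)"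
  proof -
    have "X * (X + 2 * ?B) \<le> (X + ?B)\<^sup>2" by (simp add: power2_eq_square algebra_simps)
    then have "X / (X + ?B)\<^sup>2 \<le> 1 / (X + 2 * ?B)" using p by (simp add: field_simps)
    then have "X * (X / (X + ?B)\<^sup>2) \<le> X * (1 / (X + 2 * ?B))" using X_pos by (intro mult_left_mono) auto
    then show ?thesis by (simp add: power2_eq_square)
  qed
  then have "(1 - t)\<^sup>2 \<le> 1 - 2 * g" unfolding v by (simp add: power_divide)
  then show "2 * g \<le> 2 * t - t\<^sup>2" by (simp add: power2_eq_square algebra_simps)
qed

text \<open>A coupling of the states for open and for closed \<open>e\<close>. An only joined end stays the only one with
  mass \<open>t (1 - t)\<close>; all the remaining mass goes to the state in which both ends are joined.\<close>

definition atoms :: "((('e set \<times> 'v set) \<times> ('e set \<times> 'v set)) \<times> real) list" where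
  "atoms = [((({e}, {}), ({}, {})), (1 - t)\<^sup>2), ((({e}, {}), ({}, {a, b})), 2 * t - t\<^sup>2 - 2 * g),
    ((({e}, {a}), ({}, {a})), t * (1 - t)), ((({e}, {a}), ({}, {a, b})), g - t * (1 - t)),
    ((({e}, {b}), ({}, {b})), t * (1 - t)), ((({e}, {b}), ({}, {a, b})), g - t * (1 - t))]"

definition init :: "(('e set \<times> 'v set) \<times> ('e set \<times> 'v set)) pmf" where
  "init = pmf_of_list atoms"

lemma wf: "pmf_of_list_wf atoms"
proof (rule pmf_of_list_wfI)
  have "0 \<le> t * (1 - t)" using bounds by simp
  then show "x \<ge> 0" if "x \<in> set (map snd atoms)" for x
    using that bounds by (auto simp: atoms_def)
  show "sum_list (map snd atoms) = 1" by (simp add: atoms_def power2_eq_square algebra_simps)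
qed

lemma init_support:
  "z \<in> set_pmf init \<Longrightarrow> fst (fst z) = {e} \<and> fst (snd z) = {} \<and> snd (fst z) \<subseteq> snd (snd z)"
  using set_pmf_of_list[OF wf] unfolding init_def by (auto simp: atoms_def)

lemma pmf_open:
  "pmf (map_pmf fst init) x = (if x = ({e}, {}) then 1 - 2 * g else if x = ({e}, {a}) \<or> x = ({e}, {b}) then g else 0)"
  unfolding init_def pmf_map_pmf_of_list[OF wf] unfolding atoms_def using ab(2)
  by (auto simp: power2_eq_square algebra_simps)

lemma pmf_closed:
  "pmf (map_pmf snd init) x = (if x = ({}, {}) then (1 - t)\<^sup>2 else if x = ({}, {a}) \<or> x = ({}, {b}) then t * (1 - t)
    else if x = ({}, {a, b}) then t\<^sup>2 else 0)"
  unfolding init_def pmf_map_pmf_of_list[OF wf] unfolding atoms_def using ab(2)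
  by (auto simp: power2_eq_square algebra_simps doubleton_eq_iff)

text \<open>\<open>Z\<close> is the total weight and \<open>r\<close> the probability that \<open>e\<close> is open.\<close>

definition Z :: real where "Z = X * (1 - ustar) / (1 + q) + 2 * ((1 - ustar) / (1 + q)) * ustar + (X + ustar)\<^sup>2"
definition r :: real where "r = (X * (1 - ustar) / (1 + q) + 2 * ((1 - ustar) / (1 + q)) * ustar) / Z"

lemma Z_r: "Z > 0" "0 < r" "r < 1"
  "Z * r = (1 - ustar) / (1 + q) * (X + 2 * ustar)" "Z * (1 - r) = (X + ustar)\<^sup>2"
proof -
  let ?A = "(1 - ustar) / (1 + q)"
  have "ustar < 1" using X_pos q_pos by (simp add: X_def zero_less_mult_iff zero_less_divide_iff)
  then have A: "?A > 0" using q by simp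
  have st: "?A * (X + 2 * ustar) > 0" using A X_pos ustar(1) by (intro mult_pos_pos add_pos_nonneg) simp_all
  have c: "(X + ustar)\<^sup>2 > 0" using X_pos ustar(1) by (simp add: add_pos_nonneg)
  have num: "X * (1 - ustar) / (1 + q) + 2 * ((1 - ustar) / (1 + q)) * ustar = ?A * (X + 2 * ustar)"
    by (simp add: algebra_simps)
  have Z: "Z = ?A * (X + 2 * ustar) + (X + ustar)\<^sup>2" unfolding Z_def num ..
  have r: "r = ?A * (X + 2 * ustar) / Z" unfolding r_def num ..
  show Zp: "Z > 0" unfolding Z using st c by (rule add_pos_pos)
  show "0 < r" unfolding r using st Zp by (rule divide_pos_pos)
  show "r < 1" proof -
    have "?A * (X + 2 * ustar) < Z" unfolding Z using c by (rule less_add_same_cancel1[THEN iffD2])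
    then show ?thesis unfolding r using Zp by (simp only: divide_less_eq_1_pos)
  qed
  show 1: "Z * r = ?A * (X + 2 * ustar)" unfolding r using Zp by simp
  show "Z * (1 - r) = (X + ustar)\<^sup>2" using 1 Z by (simp add: right_diff_distrib)
qed

lemma gibbs_init:
  "gibbs T q (\<lambda>_. ustar) {} {a, b} {e}
    (bind_pmf (bernoulli_pmf r) (\<lambda>st. if st then map_pmf fst init else map_pmf snd init))"
proof -
  let ?p = "bind_pmf (bernoulli_pmf r) (\<lambda>st. if st then map_pmf fst init else map_pmf snd init)"
  define A where "A = (1 - ustar) / (1 + q)"
  let ?B = "ustar"
  have pB: "X + ?B > 0" "X + 2 * ?B > 0" using X_pos ustar(1) by simp_all
  have XA: "X = q * A" by (simp add: X_def A_def)
  have pm: "pmf ?p x = r * pmf (map_pmf fst init) x + (1 - r) * pmf (map_pmf snd init) x" for x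
    using Z_r by (simp add: pmf_bind integral_bernoulli_pmf)
  have v: "Z * (r * (1 - 2 * g)) = q * (A * A)" "Z * (r * g) = A * ?B"
    "Z * ((1 - r) * (1 - t)\<^sup>2) = q\<^sup>2 * (A * A)" "Z * ((1 - r) * (t * (1 - t))) = q * (A * ?B)" "Z * ((1 - r) * t\<^sup>2) = ?B * ?B"
  proof -
    have "Z * (r * (1 - 2 * g)) = (Z * r) * (X / (X + 2 * ?B))" by (simp add: vals)
    also have "\<dots> = A * X" unfolding Z_r A_def[symmetric] using pB by simp
    finally show "Z * (r * (1 - 2 * g)) = q * (A * A)" by (simp add: XA)
    have "Z * (r * g) = (Z * r) * (?B / (X + 2 * ?B))" by (simp add: g_def)
    also have "\<dots> = A * ?B" unfolding Z_r A_def[symmetric] using pB by simp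
    finally show "Z * (r * g) = A * ?B" .
    have "Z * ((1 - r) * (1 - t)\<^sup>2) = (Z * (1 - r)) * (X / (X + ?B))\<^sup>2" by (simp add: vals)
    also have "\<dots> = X\<^sup>2" unfolding Z_r A_def[symmetric] using pB by (simp add: power_divide)
    finally show "Z * ((1 - r) * (1 - t)\<^sup>2) = q\<^sup>2 * (A * A)" by (simp add: XA power2_eq_square)
    have "Z * ((1 - r) * (t * (1 - t))) = (Z * (1 - r)) * (?B / (X + ?B) * (X / (X + ?B)))" by (simp add: vals, simp add: t_def)
    also have "\<dots> = ?B * X" unfolding Z_r A_def[symmetric] using pB by (simp add: power2_eq_square)
    finally show "Z * ((1 - r) * (t * (1 - t))) = q * (A * ?B)" by (simp add: XA)
    have "Z * ((1 - r) * t\<^sup>2) = (Z * (1 - r)) * (?B / (X + ?B))\<^sup>2" by (simp add: t_def)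
    also have "\<dots> = ?B\<^sup>2" unfolding Z_r A_def[symmetric] using pB by (simp add: power_divide)
    finally show "Z * ((1 - r) * t\<^sup>2) = ?B * ?B" by (simp add: power2_eq_square)
  qed
  have j: "joined T {e} a b" using ab(1) by (intro joined_edge[of e]) auto
  have nj: "joined T {} x y \<longleftrightarrow> x = y" for x y by (auto elim: joined_cases)
  have bw: "boundary_weight q (\<lambda>_. ?B) {a, b} \<sigma> = (if a \<in> \<sigma> then ?B else A) * (if b \<in> \<sigma> then ?B else A)" for \<sigma>
    using ab(2) by (simp add: boundary_weight_def A_def)
  have sep: "separated T {} \<sigma>" "separated T {e} {}" "separated T {e} {a}" "separated T {e} {b}" "\<not> separated T {e} {a, b}" for \<sigma>
    using j ab(2) by (auto simp: separated_def nj)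
  have "weight T q (\<lambda>_. ?B) {} {a, b} {e} x = Z * pmf ?p x" for x
  proof (cases "fst x \<subseteq> {e} \<and> snd x \<subseteq> {a, b}")
    case False
    then have "weight T q (\<lambda>_. ?B) {} {a, b} {e} x = 0" by (auto simp: weight_def)
    moreover have "x \<noteq> ({e}, {})" "x \<noteq> ({e}, {a})" "x \<noteq> ({e}, {b})" "x \<noteq> ({}, {})" "x \<noteq> ({}, {a})" "x \<noteq> ({}, {b})" "x \<noteq> ({}, {a, b})"
      using False by auto
    ultimately show ?thesis unfolding pm pmf_open pmf_closed by simp
  next
    case True
    then have "fst x = {} \<or> fst x = {e}" "snd x = {} \<or> snd x = {a} \<or> snd x = {b} \<or> snd x = {a, b}" by auto
    then consider "x = ({}, {})" | "x = ({}, {a})" | "x = ({}, {b})" | "x = ({}, {a, b})" |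
      "x = ({e}, {})" | "x = ({e}, {a})" | "x = ({e}, {b})" | "x = ({e}, {a, b})" by (cases x) auto
    then show ?thesis
      unfolding pm pmf_open pmf_closed
      using ab(2) by cases (simp_all add: weight_def bw sep v[unfolded power2_eq_square] doubleton_eq_iff power2_eq_square)
  qed
  then show ?thesis using Z_r(1) unfolding gibbs_def by blast
qed

text \<open>The Gibbs law at the edge is the mixture of the two initial laws, and the exploration never changes
  the state of \<open>e\<close>. Hence the limit measure, conditioned on the state of \<open>e\<close>, belongs to the chain that
  starts from the corresponding initial law, and the coupling of the initial laws applies.\<close>

lemma conditional_domination:
  "stoch_dominated (edges T - {e}) (cond_off (edges T) (wired_limit T (gas q)) e True)
     (cond_off (edges T) (wired_limit T (gas q)) e False)"
proof -
  let ?\<mu> = "wired_limit T (gas q)"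
  have win0: "window T {} {a, b} {e}" using window.edge[OF e] ab by simp
  obtain U D E w where ex: "exploration T k U D E w" "U 0 = {}" "D 0 = {a, b}" "E 0 = {e}"
    by (rule exists_exploration[OF win0])
  interpret exploration T k U D E w by fact
  interpret gas_exploration T k q U D E w by unfold_locales
  define p where "p st = (if st then map_pmf fst init else map_pmf snd init)" for st
  have cd: "real (card (star T (w 0) - {e})) = d" using window_step.card_C[OF ws[of 0]] ex(4) by (simp add: d_def)
  have gibbs_n: "gibbs T q (\<lambda>_. ustar) (U n) (D n) (E n) (chain_law q ustar (bind_pmf (bernoulli_pmf r) p) n)" if "n \<ge> 1" for n
    using gibbs_init h_ustar that unfolding p_def[abs_def]
    by (intro gibbs_chain_law[where ub="\<lambda>_. ustar"]) (simp_all add: ex cd h_def)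
  have keep: "(e \<in> fst x) = st" if "x \<in> set_pmf (chain_law q ustar (p st) n)" for st n x
    using that
  proof (induction n arbitrary: x)
    case 0
    then obtain z where z: "z \<in> set_pmf init" "x = (if st then fst z else snd z)"
      by (cases st) (auto simp: p_def)
    then show ?case using init_support[OF z(1)] by (cases st) simp_all
  next
    case (Suc n)
    then obtain y where y: "y \<in> set_pmf (chain_law q ustar (p st) n)" "x \<in> set_pmf (kernel q ustar n y)" by auto
    have kids: "finite (kids n)" "kids n \<noteq> {}"
      using window_step.finite_C[OF ws] window_step.C_ne[OF ws] by blast+
    have en: "e \<in> E n" using E_mono[of 0 n] ex(4) by auto
    obtain c l where cl: "c \<in> kids n" "x = update n y (star_outcome (kids n) (w n \<in> snd y) l c)"
      using y(2) kids unfolding kernel_eq[OF ustar(1)] by auto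
    have "fst (star_outcome (kids n) (w n \<in> snd y) l c) \<subseteq> kids n" by (rule outcome_subset[OF cl(1)])
    then have "e \<in> fst x \<longleftrightarrow> e \<in> fst y" using en unfolding cl(2) by (auto simp: update_def)
    then show ?case using Suc.IH[OF y(1)] by simp
  qed
  have \<mu>: "prob_space ?\<mu>" "sets ?\<mu> = sets (config_space (edges T))"
    using wired_limit unfolding is_wired_limit_iff by auto
  then have sp: "space ?\<mu> = space (config_space (edges T))" by (intro sets_eq_imp_space_eq)
  interpret \<mu>: prob_space ?\<mu> by fact
  have joint: "config_law (edges T) ?\<mu> (insert e J) {S. (e \<in> S) = st \<and> S \<inter> J \<in> A} =
      pmf (bernoulli_pmf r) st * measure_pmf.prob (chain_law q ustar (p st) n) {x. fst x \<inter> J \<in> A}"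
    if n: "n \<ge> 1" and J: "J \<subseteq> E n - E 0" for n J A st
  proof -
    have sub: "insert e J \<subseteq> E n" using J E_mono[of 0 n] ex(4) by auto
    let ?Q = "{x. fst x \<inter> insert e J \<in> {S. (e \<in> S) = st \<and> S \<inter> J \<in> A}}"
    have Q: "?Q = {x. (e \<in> fst x) = st \<and> fst x \<inter> J \<in> A}"
    proof -
      have "insert e J \<inter> J = J" by auto
      then show ?thesis by (simp add: Int_assoc)
    qed
    have "config_law (edges T) ?\<mu> (insert e J) {S. (e \<in> S) = st \<and> S \<inter> J \<in> A} =
      measure_pmf.prob (chain_law q ustar (bind_pmf (bernoulli_pmf r) p) n) ?Q"
      by (rule wired_limit_law[OF wired_limit win U_ne[OF n] gibbs_n[OF n] sub])
    also have "\<dots> = measure_pmf.prob (bind_pmf (bernoulli_pmf r) (\<lambda>st. chain_law q ustar (p st) n)) ?Q"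
      by (simp only: chain_law_bind)
    also have "\<dots> = (\<Sum>st'\<in>UNIV. pmf (bernoulli_pmf r) st' * measure_pmf.prob (chain_law q ustar (p st') n) ?Q)"
      by (simp add: measure_bind_pmf integral_measure_pmf_real[of UNIV] UNIV_bool algebra_simps)
    also have "\<dots> = (\<Sum>st'\<in>UNIV. if st' = st then pmf (bernoulli_pmf r) st * measure_pmf.prob (chain_law q ustar (p st) n) {x. fst x \<inter> J \<in> A} else 0)"
    proof (intro sum.cong refl)
      fix st'
      have "measure_pmf.prob (chain_law q ustar (p st') n) ?Q =
        measure_pmf.prob (chain_law q ustar (p st') n) (if st' = st then {x. fst x \<inter> J \<in> A} else {})"
        unfolding Q by (rule measure_eq_AE) (use keep[of _ st' n] in \<open>auto simp: AE_measure_pmf_iff\<close>)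
      then show "pmf (bernoulli_pmf r) st' * measure_pmf.prob (chain_law q ustar (p st') n) ?Q =
        (if st' = st then pmf (bernoulli_pmf r) st * measure_pmf.prob (chain_law q ustar (p st) n) {x. fst x \<inter> J \<in> A} else 0)"
        by simp
    qed
    also have "\<dots> = pmf (bernoulli_pmf r) st * measure_pmf.prob (chain_law q ustar (p st) n) {x. fst x \<inter> J \<in> A}"
      by simp
    finally show ?thesis .
  qed
  let ?C = "\<lambda>st. {\<omega> \<in> space ?\<mu>. \<omega> e = st}"
  have cyl: "{\<omega> \<in> space ?\<mu>. {x \<in> J. \<omega> x} \<in> A} \<in> sets ?\<mu>" if "finite J" "J \<subseteq> edges T" for J A
    unfolding sp \<mu>(2) using cylinder_measurable[OF that] .
  have C_cyl: "?C st = {\<omega> \<in> space ?\<mu>. {x \<in> {e}. \<omega> x} \<in> {S. (e \<in> S) = st}}" for st by auto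
  have C_meas: "?C st \<in> sets ?\<mu>" for st unfolding C_cyl using e by (intro cyl) auto
  have C_prob: "measure ?\<mu> (?C st) = pmf (bernoulli_pmf r) st" for st
  proof -
    have "measure ?\<mu> (?C st) = config_law (edges T) ?\<mu> (insert e {}) {S. (e \<in> S) = st \<and> S \<inter> {} \<in> UNIV}"
      unfolding C_cyl config_law_def sp by simp
    also have "\<dots> = pmf (bernoulli_pmf r) st" by (subst joint[of 1]) simp_all
    finally show ?thesis .
  qed
  have C_pos: "measure ?\<mu> (?C st) > 0" for st unfolding C_prob using Z_r by (cases st) simp_all
  have cond: "prob_space (cond_off (edges T) ?\<mu> e st)"
    "sets (cond_off (edges T) ?\<mu> e st) = sets (config_space (edges T - E 0))"
    "\<And>n J A. n \<ge> 1 \<Longrightarrow> J \<subseteq> E n - E 0 \<Longrightarrow> config_law (edges T - E 0) (cond_off (edges T) ?\<mu> e st) J A =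
        measure_pmf.prob (chain_law q ustar (p st) n) {x. fst x \<inter> J \<in> A}" for st
  proof -
    let ?u = "uniform_measure ?\<mu> (?C st)" let ?r = "\<lambda>\<omega>. restrict \<omega> (edges T - {e})"
    have em: "emeasure ?\<mu> (?C st) \<noteq> 0" "emeasure ?\<mu> (?C st) \<noteq> \<infinity>"
      using C_pos[of st] by (simp_all add: \<mu>.emeasure_eq_measure)
    interpret u: prob_space ?u by (rule prob_space_uniform_measure[OF em])
    have rm: "?r \<in> measurable ?u (config_space (edges T - {e}))"
      unfolding measurable_cong_sets[OF trans[OF sets_uniform_measure \<mu>(2)] refl] config_space_def
      by (rule measurable_restrict_subset) auto
    show "prob_space (cond_off (edges T) ?\<mu> e st)" unfolding cond_off_def by (rule u.prob_space_distr[OF rm])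
    show "sets (cond_off (edges T) ?\<mu> e st) = sets (config_space (edges T - E 0))" by (simp add: cond_off_def ex(4))
    fix n J A assume n: "n \<ge> 1" and J: "J \<subseteq> E n - E 0"
    have fJ: "finite J" "J \<subseteq> edges T - {e}"
      using J finite_subset[OF J] window_invariants(3,6)[OF win[of n]] ex(4) by auto
    have fJ': "J \<subseteq> edges T" using fJ by auto
    let ?S = "{\<omega> \<in> space ?\<mu>. {x \<in> J. \<omega> x} \<in> A}"
    have "config_law (edges T - E 0) (cond_off (edges T) ?\<mu> e st) J A =
      measure ?u (?r -` {\<omega> \<in> space (config_space (edges T - {e})). {x \<in> J. \<omega> x} \<in> A} \<inter> space ?u)"
      unfolding config_law_def cond_off_def ex(4) by (rule measure_distr[OF rm cylinder_measurable[OF fJ]])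
    also have "?r -` {\<omega> \<in> space (config_space (edges T - {e})). {x \<in> J. \<omega> x} \<in> A} \<inter> space ?u = ?S"
    proof -
      have "{x \<in> J. ?r \<omega> x} = {x \<in> J. \<omega> x}" for \<omega> using fJ(2) by auto
      moreover have "?r \<omega> \<in> space (config_space (edges T - {e}))" for \<omega> by simp
      ultimately show ?thesis by (simp only: space_uniform_measure vimage_def mem_Collect_eq Int_def conj_commute) auto
    qed
    also have "measure ?u ?S = measure ?\<mu> (?C st \<inter> ?S) / measure ?\<mu> (?C st)"
      using em cyl[OF fJ(1) fJ'] by (intro measure_uniform_measure) auto
    also have "?C st \<inter> ?S = {\<omega> \<in> space (config_space (edges T)). {x \<in> insert e J. \<omega> x} \<in> {S. (e \<in> S) = st \<and> S \<inter> J \<in> A}}"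
    proof -
      have "{x \<in> insert e J. \<omega> x} \<inter> J = {x \<in> J. \<omega> x}" for \<omega> by auto
      then show ?thesis unfolding sp by auto
    qed
    also have "measure ?\<mu> \<dots> = pmf (bernoulli_pmf r) st * measure_pmf.prob (chain_law q ustar (p st) n) {x. fst x \<inter> J \<in> A}"
      using joint[OF n J] unfolding config_law_def .
    finally show "config_law (edges T - E 0) (cond_off (edges T) ?\<mu> e st) J A =
        measure_pmf.prob (chain_law q ustar (p st) n) {x. fst x \<inter> J \<in> A}"
      using C_pos[of st] unfolding C_prob by simp
  qed
  have "stoch_dominated (edges T - E 0) (cond_off (edges T) ?\<mu> e True) (cond_off (edges T) ?\<mu> e False)"
  proof (rule stoch_dominated_chain[of q q ustar ustar init])
    show "fst x - E 0 \<subseteq> fst y \<and> snd x \<subseteq> snd y" if "(x, y) \<in> set_pmf init" for x y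
      using init_support[OF that] ex(4) by auto
    show "config_law (edges T - E 0) (cond_off (edges T) ?\<mu> e True) J A =
        measure_pmf.prob (chain_law q ustar (map_pmf fst init) n) {x. fst x \<inter> J \<in> A}"
      if "n \<ge> 1" "J \<subseteq> E n - E 0" for n J A
      using cond(3)[OF that, of True A] by (simp add: p_def)
    show "config_law (edges T - E 0) (cond_off (edges T) ?\<mu> e False) J A =
        measure_pmf.prob (chain_law q ustar (map_pmf snd init) n) {x. fst x \<inter> J \<in> A}"
      if "n \<ge> 1" "J \<subseteq> E n - E 0" for n J A
      using cond(3)[OF that, of False A] by (simp add: p_def)
  qed (use q ustar cond in simp_all)
  then show ?thesis by (simp add: ex(4))
qed

end

lemma wired_arboreal_gas_finite: "\<beta> > 0 \<Longrightarrow> wired_arboreal_gas T (ereal \<beta>) = wired_limit T (gas (1 / \<beta>))"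
  by (simp add: wired_arboreal_gas_def gas_def[abs_def])

lemma wired_arboreal_gas_infinity: "wired_arboreal_gas T \<infinity> = wired_limit T (gas 0)"
  by (simp add: wired_arboreal_gas_def gas_def[abs_def])

theorem corollary1p2:
  fixes T :: "('v, 'e) multigraph" and k :: nat
  assumes "k \<ge> 3" and "regular_tree k T"
  shows "(\<forall>\<beta>\<^sub>1 \<beta>\<^sub>2 :: ereal. 0 < \<beta>\<^sub>1 \<and> \<beta>\<^sub>1 < \<beta>\<^sub>2 \<longrightarrow>
            stoch_dominated (edges T) (wired_arboreal_gas T \<beta>\<^sub>1) (wired_arboreal_gas T \<beta>\<^sub>2))
       \<and> (\<forall>\<beta> :: real. \<forall>e\<in>edges T. 0 < \<beta> \<longrightarrow>
            stoch_dominated (edges T - {e})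
              (cond_off (edges T) (wired_arboreal_gas T (ereal \<beta>)) e True)
              (cond_off (edges T) (wired_arboreal_gas T (ereal \<beta>)) e False))"
proof (intro conjI allI impI ballI)
  interpret reg_tree T k using assms by unfold_locales
  {
    fix \<beta>\<^sub>1 \<beta>\<^sub>2 :: ereal assume \<beta>: "0 < \<beta>\<^sub>1 \<and> \<beta>\<^sub>1 < \<beta>\<^sub>2"
    then obtain x where x: "\<beta>\<^sub>1 = ereal x" "x > 0" by (cases \<beta>\<^sub>1) auto
    show "stoch_dominated (edges T) (wired_arboreal_gas T \<beta>\<^sub>1) (wired_arboreal_gas T \<beta>\<^sub>2)"
    proof (cases \<beta>\<^sub>2)
      case (real y)
      then have y: "x < y" using \<beta> x by simp
      then have "1 / y \<le> 1 / x" using x by (simp add: frac_le)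
      then show ?thesis
        using wired_limit_mono[of "1 / y" "1 / x"] x y by (simp add: real wired_arboreal_gas_finite)
    next
      case PInf
      then show ?thesis
        using wired_limit_mono[of 0 "1 / x"] x by (simp add: wired_arboreal_gas_finite wired_arboreal_gas_infinity)
    next
      case MInf
      then show ?thesis using \<beta> by simp
    qed
  next
    fix \<beta> :: real and e assume e: "e \<in> edges T" and \<beta>: "0 < \<beta>"
    obtain a b where ab: "ends T e = {a, b}" "a \<noteq> b" using card_ends[OF e] by (metis card_2_iff)
    interpret edge_root T k "1 / \<beta>" e a b using \<beta> e ab by unfold_locales auto
    show "stoch_dominated (edges T - {e}) (cond_off (edges T) (wired_arboreal_gas T (ereal \<beta>)) e True)
              (cond_off (edges T) (wired_arboreal_gas T (ereal \<beta>)) e False)"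
      using conditional_domination \<beta> by (simp add: wired_arboreal_gas_finite)
  }
qed

end
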